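(* For the root system $R=A_{n-1}$ and $\ell=2$, the Hamiltonian of the twisted Macdonald--Ruijsenaars system (of Chalykh and Etingof) is given by the following difference operator $D_{2,1}$: $$D_{2,1}=\sum_{i=1}^n a_i T_i^2+\sum_{i<j}^n b_{ij} T_iT_j,$$ where the coefficients $a_i$, $b_{ij}$ are given by $$a_i=\prod_{j\ne i}^n \frac{(1-tx_ix_j^{-1})(1-qtx_ix_j^{-1})}{(1-x_ix_j^{-1})(1-qx_ix_j^{-1})},$$ $$b_{ij}=q^{1/2}(t-1)(t-q)\frac{x_i^{1/2}x_j^{-1/2}+x_i^{-1/2}x_j^{1/2}}{(1-qx_ix_j^{-1})(1-qx_jx_i^{-1})}\prod_{l\ne i,j}^n \frac{(1-tx_ix_l^{-1})(1-tx_jx_l^{-1})}{(1-x_ix_l^{-1})(1-x_jx_l^{-1})}.$$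
   Context: Here $q\in\mathbb C^\times$ is not a root of unity, and $t\ne0$ is the coupling parameter of the system. One works in the algebra of difference operators in $n$ variables $z_1,\dots,z_n$; $T_i$ is the shift operator $T_if(z_1,\dots,z_n)=f(z_1,\dots,z_i+1,\dots,z_n)$. Exponential coordinates are $x_i=q^{z_i}$, with $x_i^{1/2}=q^{z_i/2}$ also allowed, so $T_i(x_i^{1/2})=q^{1/2}x_i^{1/2}$. The twisted Macdonald--Ruijsenaars systems are generalisations, depending on an integer $\ell\ge2$ and existing for any root system $R$, of the quantum Macdonald--Ruijsenaars system. Their eigenfunctions $\psi_\ell(\lambda,z)$ are constructed by integrating certain products of the Gaussian and the eigenfunctions of the usual Macdonald--Ruijsenaars system, and the existence of a complete family of commuting quantum Hamiltonians is deduced from the properties of $\psi_\ell$. For $R=A_{n-1}=\{e_a-e_b\}$ (with $e_1,\dots,e_n$ the standard basis of $\mathbb C^n$ and $\langle\cdot,\cdot\rangle$ the standard bilinear form), $W=S_n$, all multiplicities equal to $m\in\mathbb Z_{\ge0}$ (i.e. $t=q^{-m}$) and $\ell=2$, the eigenfunction is the twisted Baker--Akhiezer function, of the form $$\psi_2(\lambda,z)=q^{\langle\lambda,z\rangle/2}\sum_{\nu\in\mathcal N\cap\frac12P}\psi_\nu(\lambda)\,q^{\langle\nu,z\rangle},$$ where $P$ is the weight lattice of $R$ and $\mathcal N$ is the convex hull of the $W$-orbit of $\rho=\frac12\sum_{\alpha\in R_+}m\alpha$. It is characterised, uniquely up to a factor depending on $\lambda$ only, by the properties $$\psi_2(\lambda,z+je_a)=\epsilon^{j}\psi_2(\lambda,z+je_b)\quad\text{for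 } q^{z_a/2}=\epsilon q^{z_b/2},$$ for all $j=1,\dots,m$, distinct $a,b\in\{1,\dots,n\}$ and $\epsilon=\pm1$. The Hamiltonians of the system are commuting $W$-invariant difference operators $D_2^\pi$ in $z$, one for each dominant weight $\pi$, having $\psi_2$ as common eigenfunction: $D_2^\pi\psi_2=\mathfrak m_\pi(\lambda)\psi_2$, where $\mathfrak m_\pi(\lambda)=\sum_{\tau\in W\pi}q^{\langle\tau,\lambda\rangle}$ is the orbitsum. The Hamiltonian in question is the one with eigenvalue $\sum_{i=1}^nq^{\lambda_i}$.
   Formalization: With the printed a_i, b_ij the operator D_{2,1} has eigenvalue t^{n-1} times the sum of q^{λ_i}, so the Hamiltonian with eigenvalue exactly that sum is t^{1-n} D_{2,1}; this is what is proved (at t=q^{-m}, and for general t≠0 by continuation in t). *)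

theory Defs
  imports "HOL-Analysis.Analysis"
begin

text \<open>
  The number of variables is \<open>n = CARD('n)\<close>; the linear order on the index type \<open>'n\<close> is only used for
  \<open>i < j\<close> and for the choice of positive roots. Throughout, \<open>h\<close> is a fixed logarithm of \<open>q\<close>,
  so that all complex powers of \<open>q\<close> are formed with one branch: \<open>q\<^sup>s = exp (h s)\<close>.
\<close>

definition qpow :: "complex \<Rightarrow> complex \<Rightarrow> complex" where
  "qpow h s = exp (h * s)"

definition bil :: "complex ^ 'n \<Rightarrow> complex ^ 'n \<Rightarrow> complex" where
  "bil u v = (\<Sum>i\<in>UNIV. u $ i * v $ i)"

definition cvec :: "real ^ 'n \<Rightarrow> complex ^ 'n" where
  "cvec v = (\<chi> i. complex_of_real (v $ i))"

definition ivec :: "int ^ 'n \<Rightarrow> complex ^ 'n" where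
  "ivec k = (\<chi> i. of_int (k $ i))"

definition perm_vec :: "('n \<Rightarrow> 'n) \<Rightarrow> 'a ^ 'n \<Rightarrow> 'a ^ 'n" where
  "perm_vec p v = (\<chi> i. v $ p i)"

text \<open>Laurent polynomials in \<open>x\<^sub>i\<^sup>1\<^sup>/\<^sup>2 = q\<^bsup>z\<^sub>i/2\<^esup>\<close>, as functions of \<open>z\<close>.\<close>

definition laurent :: "complex \<Rightarrow> (complex ^ 'n \<Rightarrow> complex) \<Rightarrow> bool" where
  "laurent h f \<longleftrightarrow>
     (\<exists>(S :: (int ^ 'n) set) c. finite S \<and>
        f = (\<lambda>z. \<Sum>k\<in>S. c k * qpow h (bil (ivec k) z / 2)))"

text \<open>
  A property holds generically if it holds off the zero set of a nonzero Laurent polynomial.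
  Identities between rational (or meromorphic) functions are stated in this sense, since in HOL the value
  of a quotient at a zero of its denominator is a convention. The same notion is used for
  the spectral variable \<open>\<lambda>\<close>, with \<open>q\<^bsup>\<lambda>\<^sub>i/2\<^esup>\<close> in place of \<open>x\<^sub>i\<^sup>1\<^sup>/\<^sup>2\<close>.
\<close>

definition generically :: "complex \<Rightarrow> (complex ^ 'n \<Rightarrow> bool) \<Rightarrow> bool" where
  "generically h P \<longleftrightarrow>
     (\<exists>Q. laurent h Q \<and> Q \<noteq> (\<lambda>_. 0) \<and> (\<forall>z. Q z \<noteq> 0 \<longrightarrow> P z))"

definition rational :: "complex \<Rightarrow> (complex ^ 'n \<Rightarrow> complex) \<Rightarrow> bool" where
  "rational h f \<longleftrightarrow>
     (\<exists>P Q. laurent h P \<and> laurent h Q \<and> Q \<noteq> (\<lambda>_. 0) \<and> (\<forall>z. Q z \<noteq> 0 \<longrightarrow> f z = P z / Q z))"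

text \<open>
  \<open>D\<close> stands for the operator \<open>\<Sum>\<^sub>k D\<^sub>k(z) T\<^sup>k\<close> with \<open>T\<^sup>k = \<Prod>\<^sub>i T\<^sub>i\<^bsup>k\<^sub>i\<^esup>\<close> and \<open>k\<close> ranging over \<open>\<int>\<^sup>n\<close>.
\<close>

type_synonym 'n dop = "int ^ 'n \<Rightarrow> complex ^ 'n \<Rightarrow> complex"

definition diffop :: "complex \<Rightarrow> ('n::finite) dop \<Rightarrow> bool" where
  "diffop h D \<longleftrightarrow> finite {k. D k \<noteq> (\<lambda>_. 0)} \<and> (\<forall>k. rational h (D k))"

definition dop_apply :: "('n::finite) dop \<Rightarrow> (complex ^ 'n \<Rightarrow> complex) \<Rightarrow> complex ^ 'n \<Rightarrow> complex" where
  "dop_apply D f z = (\<Sum>k | D k \<noteq> (\<lambda>_. 0). D k z * f (z + ivec k))"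

definition dop_eq :: "complex \<Rightarrow> ('n::finite) dop \<Rightarrow> 'n dop \<Rightarrow> bool" where
  "dop_eq h D E \<longleftrightarrow> (\<forall>k. generically h (\<lambda>z. D k z = E k z))"

definition dop_scale :: "complex \<Rightarrow> ('n::finite) dop \<Rightarrow> 'n dop" where
  "dop_scale c D = (\<lambda>k z. c * D k z)"

definition dop_monom :: "(complex ^ 'n \<Rightarrow> complex) \<Rightarrow> int ^ 'n \<Rightarrow> ('n::finite) dop" where
  "dop_monom a k0 = (\<lambda>k z. if k = k0 then a z else 0)"

definition weyl_invariant :: "complex \<Rightarrow> ('n::finite) dop \<Rightarrow> bool" where
  "weyl_invariant h D \<longleftrightarrow>
     (\<forall>p k. p permutes UNIV \<longrightarrow>
        generically h (\<lambda>z. D (perm_vec p k) (perm_vec p z) = D k z))"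

definition roots :: "(real ^ 'n) set" where
  "roots = {axis a 1 - axis b 1 | a b. a \<noteq> b}"

definition pos_roots :: "(real ^ 'n :: {finite, linorder}) set" where
  "pos_roots = {axis a 1 - axis b 1 | a b. a < b}"

definition weight_lattice :: "(real ^ 'n) set" where
  "weight_lattice = {v \<in> span roots. \<forall>\<alpha>\<in>roots. 2 * (v \<bullet> \<alpha>) / (\<alpha> \<bullet> \<alpha>) \<in> \<int>}"

definition rho :: "nat \<Rightarrow> real ^ 'n :: {finite, linorder}" where
  "rho m = (1 / 2) *\<^sub>R (\<Sum>\<alpha>\<in>pos_roots. real m *\<^sub>R \<alpha>)"

definition rho_hull :: "nat \<Rightarrow> (real ^ 'n :: {finite, linorder}) set" where
  "rho_hull m = convex hull {perm_vec p (rho m) | p. p permutes UNIV}"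

definition BA_support :: "nat \<Rightarrow> (real ^ 'n :: {finite, linorder}) set" where
  "BA_support m = rho_hull m \<inter> (\<lambda>v. (1 / 2) *\<^sub>R v) ` weight_lattice"

definition BA_form ::
  "complex \<Rightarrow> nat \<Rightarrow> complex ^ 'n :: {finite, linorder} \<Rightarrow> (complex ^ 'n :: {finite, linorder} \<Rightarrow> complex) \<Rightarrow> bool" where
  "BA_form h m l f \<longleftrightarrow>
     (\<exists>c. \<forall>z. f z = qpow h (bil l z / 2) *
        (\<Sum>\<nu>\<in>BA_support m. c \<nu> * qpow h (bil (cvec \<nu>) z)))"

definition BA_conditions :: "complex \<Rightarrow> nat \<Rightarrow> (complex ^ 'n \<Rightarrow> complex) \<Rightarrow> bool" where
  "BA_conditions h m f \<longleftrightarrow>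
     (\<forall>j\<in>{1..m}. \<forall>a b. \<forall>\<epsilon>\<in>{1, - 1}. \<forall>z. a \<noteq> b \<longrightarrow>
        qpow h (z $ a / 2) = \<epsilon> * qpow h (z $ b / 2) \<longrightarrow>
        f (z + axis a (of_nat j)) = \<epsilon> ^ j * f (z + axis b (of_nat j)))"

text \<open>
  The conditions determine \<open>\<psi>(\<lambda>, \<cdot>)\<close> up to a factor only for generic \<open>\<lambda>\<close>: for special \<open>\<lambda>\<close>
  (e.g. \<open>n = 2\<close>, \<open>m = 1\<close>, \<open>q\<^bsup>\<lambda>\<^sub>1\<^esup> = q\<^bsup>\<lambda>\<^sub>2\<^esup>\<close>) there are further solutions, which are not limits
  of the generic ones. As the factor depending on \<open>\<lambda>\<close> is left arbitrary, no regularity in \<open>\<lambda>\<close> is assumed,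
  and statements about \<open>\<psi>\<close> are made for generic \<open>\<lambda>\<close>.
\<close>

definition twisted_BA ::
  "complex \<Rightarrow> nat \<Rightarrow> (complex ^ 'n :: {finite, linorder} \<Rightarrow> complex ^ 'n :: {finite, linorder} \<Rightarrow> complex) \<Rightarrow> bool" where
  "twisted_BA h m \<psi> \<longleftrightarrow>
     generically h (\<lambda>l. \<psi> l \<noteq> (\<lambda>_. 0) \<and> BA_form h m l (\<psi> l) \<and> BA_conditions h m (\<psi> l))"

definition twisted_hamiltonian ::
  "complex \<Rightarrow> (complex ^ 'n \<Rightarrow> complex ^ 'n \<Rightarrow> complex) \<Rightarrow> (complex ^ 'n \<Rightarrow> complex) \<Rightarrow> ('n::finite) dop \<Rightarrow> bool" where
  "twisted_hamiltonian h \<psi> e D \<longleftrightarrow>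
     diffop h D \<and> weyl_invariant h D \<and>
     generically h (\<lambda>l. generically h (\<lambda>z. dop_apply D (\<psi> l) z = e l * \<psi> l z))"

text \<open>The orbitsum \<open>\<Sum>\<^sub>i q\<^bsup>\<lambda>\<^sub>i\<^esup>\<close> of the weight \<open>e\<^sub>1\<close>.\<close>

definition orbitsum1 :: "complex \<Rightarrow> complex ^ 'n \<Rightarrow> complex" where
  "orbitsum1 h l = (\<Sum>i\<in>UNIV. qpow h (l $ i))"

text \<open>
  For arbitrary coupling \<open>t \<noteq> 0\<close> the Hamiltonian is the continuation in \<open>t\<close> of the Hamiltonians at
  \<open>t = q\<^bsup>-m\<^esup>\<close>: a family of difference operators whose coefficients are Laurent polynomials in \<open>t\<close> over the
  rational functions of \<open>x\<^sub>i\<^sup>1\<^sup>/\<^sup>2\<close>. Since \<open>q\<close> is not a root of unity, the points \<open>q\<^bsup>-m\<^esup>\<close> are pairwise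
  distinct and determine such a family.
\<close>

definition laurent_family :: "complex \<Rightarrow> (complex \<Rightarrow> ('n::finite) dop) \<Rightarrow> bool" where
  "laurent_family h F \<longleftrightarrow>
     (\<exists>(L :: int set) C. finite L \<and> (\<forall>r\<in>L. diffop h (C r)) \<and>
        (\<forall>t. t \<noteq> 0 \<longrightarrow> F t = (\<lambda>k z. \<Sum>r\<in>L. t powi r * C r k z)))"

definition twisted_hamiltonian_family ::
  "complex \<Rightarrow> (nat \<Rightarrow> complex ^ 'n \<Rightarrow> complex ^ 'n \<Rightarrow> complex) \<Rightarrow> (complex ^ 'n \<Rightarrow> complex) \<Rightarrow>
   (complex \<Rightarrow> ('n::finite) dop) \<Rightarrow> bool" where
  "twisted_hamiltonian_family h \<psi> e F \<longleftrightarrow>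
     laurent_family h F \<and>
     (\<forall>m. twisted_hamiltonian h (\<psi> m) e (F (qpow h (- of_nat m))))"

definition xratio :: "complex \<Rightarrow> complex ^ 'n \<Rightarrow> 'n \<Rightarrow> 'n \<Rightarrow> complex" where
  "xratio h z i j = qpow h (z $ i) / qpow h (z $ j)"

definition xhalf_ratio :: "complex \<Rightarrow> complex ^ 'n \<Rightarrow> 'n \<Rightarrow> 'n \<Rightarrow> complex" where
  "xhalf_ratio h z i j = qpow h (z $ i / 2) / qpow h (z $ j / 2)"

definition coeff_a :: "complex \<Rightarrow> complex \<Rightarrow> 'n \<Rightarrow> complex ^ 'n \<Rightarrow> complex" where
  "coeff_a h t i z =
     (\<Prod>j\<in>UNIV - {i}.
        ((1 - t * xratio h z i j) * (1 - qpow h 1 * t * xratio h z i j)) /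
        ((1 - xratio h z i j) * (1 - qpow h 1 * xratio h z i j)))"

definition coeff_b :: "complex \<Rightarrow> complex \<Rightarrow> 'n \<Rightarrow> 'n \<Rightarrow> complex ^ 'n \<Rightarrow> complex" where
  "coeff_b h t i j z =
     qpow h (1 / 2) * (t - 1) * (t - qpow h 1) *
     ((xhalf_ratio h z i j + xhalf_ratio h z j i) /
      ((1 - qpow h 1 * xratio h z i j) * (1 - qpow h 1 * xratio h z j i))) *
     (\<Prod>l\<in>UNIV - {i, j}.
        ((1 - t * xratio h z i l) * (1 - t * xratio h z j l)) /
        ((1 - xratio h z i l) * (1 - xratio h z j l)))"

definition D21 :: "complex \<Rightarrow> complex \<Rightarrow> ('n :: {finite, linorder}) dop" where
  "D21 h t = (\<lambda>k z.
     (\<Sum>i\<in>UNIV. dop_monom (coeff_a h t i) (axis i 2) k z) +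
     (\<Sum>(i, j) | i < j. dop_monom (coeff_b h t i j) (axis i 1 + axis j 1) k z))"

text \<open>
  In the normalisation above, \<open>D\<^bsub>2,1\<^esub> \<psi> = t\<^bsup>n-1\<^esup> (\<Sum>\<^sub>i q\<^bsup>\<lambda>\<^sub>i\<^esup>) \<psi>\<close> at \<open>t = q\<^bsup>-m\<^esup>\<close>, as can be read off from the
  leading terms in a Weyl chamber. So the operator with eigenvalue
  exactly \<open>\<Sum>\<^sub>i q\<^bsup>\<lambda>\<^sub>i\<^esup>\<close> is \<open>t\<^bsup>1-n\<^esup> D\<^bsub>2,1\<^esub>\<close>.
\<close>

definition D21_normalised :: "complex \<Rightarrow> complex \<Rightarrow> ('n :: {finite, linorder}) dop" where
  "D21_normalised h t = dop_scale (1 / t ^ (CARD('n) - 1)) (D21 h t)"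

end

theory Submission
  imports Defs
begin

text \<open>
  At \<open>t = q\<^bsup>-m\<^esup>\<close> let \<open>f = \<psi>(\<lambda>, \<cdot>)\<close> and \<open>D = D\<^bsub>2,1\<^esub>\<close>. The residues of \<open>D f\<close> along \<open>x\<^sub>a = x\<^sub>b\<close> and \<open>q x\<^sub>a = x\<^sub>b\<close>
  cancel by the conditions on \<open>f\<close>, so \<open>D f\<close> is again a sum of exponentials, and it satisfies the
  same conditions, because \<open>D\<close> is covariant under \<open>x\<^sub>a\<^sup>1\<^sup>/\<^sup>2 \<leftrightarrow> \<epsilon> x\<^sub>b\<^sup>1\<^sup>/\<^sup>2\<close> and its coefficients vanish where the
  conditions on \<open>f\<close> are exceeded. The coefficients of \<open>D\<close> are bounded at infinity, so the exponents of
  \<open>D f\<close> stay in the ball of radius \<open>|\<rho>|\<close>, and their limits in a Weyl chamber show that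
  \<open>g = D f - t\<^bsup>n-1\<^esup> (\<Sum>\<^sub>i q\<^bsup>\<lambda>\<^sub>i\<^esup>) f\<close> has no exponent in \<open>W \<rho>\<close>.

  Such a \<open>g\<close> vanishes for generic \<open>\<lambda>\<close>. The conditions force every nonempty intersection of the support of \<open>g\<close>
  with a line in the direction of a root \<open>\<alpha>\<close> to have length at least \<open>m \<alpha>\<close>. Hence an exponent of maximal
  norm has coordinates at mutual distance at least \<open>m\<close>, and in the ball of radius \<open>|\<rho>|\<close> only the vectors
  in \<open>W \<rho>\<close> have this property.

  The operator is unique since the shifts \<open>T\<^sup>k \<psi>\<close> are independent over the rational functions of
  \<open>x\<^sub>i\<^sup>1\<^sup>/\<^sup>2\<close>: in leading terms they differ by the factors \<open>q\<^bsup>\<langle>\<lambda>,k\<rangle>/2\<^esup>\<close>.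
\<close>

subsection \<open>Exponential sums and independence of characters\<close>

text \<open>The width bound on root lines rests on a count. Along a line, in steps of \<alpha>/2,
  the conditions give \<open>2 * m\<close> equations, one for each \<open>j\<close> and \<epsilon>,
  so \<open>2 * m\<close> consecutive coefficients form a square system. Up to scaling it depends on
  \<lambda> through one number \<open>X\<close>, which tends to 0 deep in a chamber; there it
  becomes a Vandermonde system with the nodes \<epsilon> q^(j/2), distinct because q is not a root
  of unity. A trivial kernel at one \<lambda> suffices: elimination yields a nonzero Laurent
  polynomial in q^(\<lambda>/2) off whose zeros the kernel stays trivial.

  The ball of radius |\<rho>| replaces the convex hull because the ray along a longest exponent v
  isolates v: every other exponent u with |u| \<le> |v| has a smaller inner product with v.

  A quotient at a pole has only a conventional value in HOL, so D f itself is not an exponential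
  sum. It agrees with one, \<open>G\<close>, off the poles, and all statements about D f at special
  points are statements about \<open>G\<close>, obtained as limits along real lines.\<close>

lemma qpow_add: "qpow h (a + b) = qpow h a * qpow h b"
  by (simp add: qpow_def distrib_left exp_add)

lemma qpow_diff: "qpow h (a - b) = qpow h a / qpow h b"
  by (simp add: qpow_def right_diff_distrib exp_diff)

lemma qpow_minus: "qpow h (- a) = 1 / qpow h a"
  using qpow_diff[of h 0 a] by (simp add: qpow_def)

lemma qpow_0 [simp]: "qpow h 0 = 1"
  by (simp add: qpow_def)

lemma qpow_nonzero [simp]: "qpow h a \<noteq> 0"
  by (simp add: qpow_def)

lemma qpow_of_nat_mult: "qpow h (of_nat n * a) = qpow h a ^ n"
  by (induction n) (simp_all add: qpow_add distrib_right)

lemma qpow_half_square: "qpow h (a / 2) ^ 2 = qpow h a"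
  using qpow_of_nat_mult[of h 2 "a / 2"] by simp

lemma bil_add_left: "bil (u + v) z = bil u z + bil v z"
  by (simp add: bil_def distrib_right sum.distrib)

lemma bil_add_right: "bil u (z + w) = bil u z + bil u w"
  by (simp add: bil_def distrib_left sum.distrib)

lemma bil_0_left [simp]: "bil 0 z = 0"
  by (simp add: bil_def)

lemma bil_0_right [simp]: "bil u 0 = 0"
  by (simp add: bil_def)

lemma bil_axis_right [simp]: "bil u (axis i c) = u $ i * c"
proof -
  have "bil u (axis i c) = (\<Sum>j\<in>UNIV. if j = i then u $ j * c else 0)"
    unfolding bil_def by (rule sum.cong) (auto simp: axis_def)
  then show ?thesis by simp
qed

lemma bil_axis_left [simp]: "bil (axis i c) z = c * z $ i"
  using bil_axis_right[of z i c] by (simp add: bil_def mult.commute)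

lemma cvec_nth [simp]: "cvec v $ i = complex_of_real (v $ i)"
  by (simp add: cvec_def)

lemma cvec_add: "cvec (u + v) = cvec u + cvec v"
  by (simp add: cvec_def vec_eq_iff)

lemma cvec_diff: "cvec (u - v) = cvec u - cvec v"
  by (simp add: cvec_def vec_eq_iff)

lemma cvec_0 [simp]: "cvec 0 = 0"
  by (simp add: cvec_def vec_eq_iff)

lemma bil_cvec: "bil (cvec u) (cvec v) = complex_of_real (u \<bullet> v)"
  by (simp add: bil_def inner_vec_def)

text \<open>For \<open>l = 0\<close> these are the monomials of the coefficients, for the spectral
  parameter \<open>l\<close> the terms of \<psi>. The prefactor is kept inside because multiplying a
  term of the second kind by one of the first only adds the exponents \<open>v\<close>.\<close>

definition echar :: "complex \<Rightarrow> complex ^ 'n \<Rightarrow> real ^ 'n \<Rightarrow> complex ^ 'n \<Rightarrow> complex" where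
  "echar h l v z = qpow h (bil l z / 2 + bil (cvec v) z)"

lemma echar_nonzero [simp]: "echar h l v z \<noteq> 0"
  by (simp add: echar_def)

lemma echar_0_right [simp]: "echar h l v 0 = 1"
  by (simp add: echar_def)

lemma echar_00 [simp]: "echar h 0 0 z = 1"
  by (simp add: echar_def)

lemma echar_add_right: "echar h l v (z + w) = echar h l v z * echar h l v w"
  by (simp add: echar_def bil_add_right add_divide_distrib qpow_add)

lemma echar_mult: "echar h 0 u z * echar h l v z = echar h l (u + v) z"
  by (simp add: echar_def bil_add_left cvec_add qpow_add)

lemma echar_split: "echar h l v z = qpow h (bil l z / 2) * echar h 0 v z"
  by (simp add: echar_def qpow_add)

lemma echar_axis: "echar h l v (axis i x) = qpow h ((l $ i / 2 + v $ i) * x)"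
  by (simp add: echar_def algebra_simps)

lemma xratio_echar: "xratio h z a b = echar h 0 (axis a 1 - axis b 1) z"
proof -
  have "bil (cvec (axis a 1 - axis b 1)) z = z $ a - z $ b"
    by (simp add: bil_def cvec_def axis_def left_diff_distrib sum_subtractf if_distrib[of complex_of_real]
      if_distrib[where f="\<lambda>x. x * _"] cong: if_cong)
  then show ?thesis by (simp add: xratio_def echar_def qpow_diff)
qed

lemma xhalf_ratio_echar: "xhalf_ratio h z a b = echar h 0 ((1/2) *\<^sub>R (axis a 1 - axis b 1)) z"
proof -
  have "bil (cvec ((1/2) *\<^sub>R (axis a 1 - axis b 1))) z = z $ a / 2 - z $ b / 2"
    by (simp add: bil_def cvec_def axis_def left_diff_distrib sum_subtractf diff_divide_distrib if_distrib[of complex_of_real]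
      if_distrib[where f="\<lambda>x. x * _"] if_distrib[where f="\<lambda>x. x / _"] cong: if_cong)
  then show ?thesis by (simp add: xhalf_ratio_def echar_def qpow_diff)
qed

text \<open>Artin's independence of characters; characters that agree on \<open>G\<close> are collected.\<close>

lemma character_classes:
  fixes ch :: "'i \<Rightarrow> 'w::monoid_add \<Rightarrow> complex"
  assumes "finite S" "0 \<in> G"
    and G: "\<And>u v. u \<in> G \<Longrightarrow> v \<in> G \<Longrightarrow> u + v \<in> G"
    and hom: "\<And>i u v. u \<in> G \<Longrightarrow> v \<in> G \<Longrightarrow> ch i (u + v) = ch i u * ch i v"
    and one: "\<And>i. ch i 0 = 1"
    and "\<And>w. w \<in> G \<Longrightarrow> (\<Sum>i\<in>S. d i * ch i w) = 0"
    and "v \<in> S"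
  shows "(\<Sum>i | i \<in> S \<and> (\<forall>w\<in>G. ch i w = ch v w). d i) = 0"
  using assms(1,6,7)
proof (induction "card S" arbitrary: S d)
  case 0
  then show ?case by auto
next
  case (Suc k)
  show ?case
  proof (cases "\<forall>i\<in>S. \<forall>w\<in>G. ch i w = ch v w")
    case True
    then have "{i. i \<in> S \<and> (\<forall>w\<in>G. ch i w = ch v w)} = S" by auto
    with Suc.prems(2)[OF \<open>0 \<in> G\<close>] one show ?thesis by simp
  next
    case False
    then obtain u w1 where u: "u \<in> S" "w1 \<in> G" "ch u w1 \<noteq> ch v w1" by auto
    define d' where "d' i = d i * (ch i w1 - ch u w1)" for i
    have "(\<Sum>i | i \<in> S - {u} \<and> (\<forall>w\<in>G. ch i w = ch v w). d' i) = 0"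
    proof (rule Suc.hyps(1))
      show "k = card (S - {u})" using Suc.hyps(2) Suc.prems(1) u by simp
      show "finite (S - {u})" using Suc.prems by simp
      show "v \<in> S - {u}" using Suc.prems u by auto
      fix w assume w: "w \<in> G"
      have "(\<Sum>i\<in>S - {u}. d' i * ch i w) = (\<Sum>i\<in>S. d' i * ch i w)"
        using Suc.prems(1) u(1) by (intro sum.mono_neutral_left) (auto simp: d'_def)
      also have "\<dots> = (\<Sum>i\<in>S. d i * ch i (w1 + w)) - ch u w1 * (\<Sum>i\<in>S. d i * ch i w)"
        using u w by (simp add: d'_def hom sum_distrib_left algebra_simps flip: sum_subtractf)
      also have "\<dots> = 0" using Suc.prems(2) u w G by simp
      finally show "(\<Sum>i\<in>S - {u}. d' i * ch i w) = 0" .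
    qed
    moreover have "{i. i \<in> S - {u} \<and> (\<forall>w\<in>G. ch i w = ch v w)} = {i. i \<in> S \<and> (\<forall>w\<in>G. ch i w = ch v w)}"
      using u by auto
    moreover have "(\<Sum>i | i \<in> S \<and> (\<forall>w\<in>G. ch i w = ch v w). d' i)
        = (\<Sum>i | i \<in> S \<and> (\<forall>w\<in>G. ch i w = ch v w). d i) * (ch v w1 - ch u w1)"
      using u unfolding sum_distrib_right by (intro sum.cong) (auto simp: d'_def)
    ultimately show ?thesis using u by simp
  qed
qed

text \<open>Elimination without division: a trivial kernel at \<open>x0\<close> provides a pivot
  that is nonzero there, the eliminated system \<open>M'\<close> has entries in the ring
  \<open>F\<close> again, and \<open>d\<close> is the product of the pivots. The set
  \<open>I\<close> of equations may be infinite. \<open>F\<close> will be the continuous functions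
  of one variable, and later the Laurent polynomials in q^(\<lambda>/2).\<close>

lemma linear_system_generic:
  fixes M :: "'i \<Rightarrow> 'v \<Rightarrow> 'x \<Rightarrow> complex"
  assumes "finite S"
    and one: "(\<lambda>_. 1) \<in> F"
    and mult: "\<And>f g. f \<in> F \<Longrightarrow> g \<in> F \<Longrightarrow> (\<lambda>x. f x * g x) \<in> F"
    and minus: "\<And>f g. f \<in> F \<Longrightarrow> g \<in> F \<Longrightarrow> (\<lambda>x. f x - g x) \<in> F"
    and "\<And>i v. i \<in> I \<Longrightarrow> v \<in> S \<Longrightarrow> M i v \<in> F"
    and "\<And>c. (\<forall>i\<in>I. (\<Sum>v\<in>S. c v * M i v x0) = 0) \<Longrightarrow> \<forall>v\<in>S. c v = 0"
  shows "\<exists>d\<in>F. d x0 \<noteq> 0 \<and>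
    (\<forall>x. d x \<noteq> 0 \<longrightarrow> (\<forall>c. (\<forall>i\<in>I. (\<Sum>v\<in>S. c v * M i v x) = 0) \<longrightarrow> (\<forall>v\<in>S. c v = 0)))"
  using assms(1,5,6)
proof (induction S arbitrary: M rule: finite_induct)
  case empty
  then show ?case using one by (intro bexI[of _ "\<lambda>_. 1"]) auto
next
  case (insert u S)
  have "\<exists>p\<in>I. M p u x0 \<noteq> 0"
  proof (rule ccontr)
    assume "\<not> ?thesis"
    then have "\<forall>i\<in>I. (\<Sum>v\<in>insert u S. (if v = u then 1 else 0) * M i v x0) = 0"
      using insert.hyps by (auto simp: if_distrib[of "\<lambda>y. y * _"] cong: if_cong)
    from insert.prems(2)[OF this] show False by auto
  qed
  then obtain p where p: "p \<in> I" "M p u x0 \<noteq> 0" by auto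
  define M' where "M' i v x = M p u x * M i v x - M i u x * M p v x" for i v x
  have red: "(\<Sum>v\<in>S. c v * M' i v x)
      = M p u x * (\<Sum>v\<in>insert u S. c v * M i v x) - M i u x * (\<Sum>v\<in>insert u S. c v * M p v x)" for c i x
    using insert.hyps
    by (simp add: M'_def sum_distrib_left algebra_simps flip: sum_subtractf)
  have "\<exists>d\<in>F. d x0 \<noteq> 0 \<and>
    (\<forall>x. d x \<noteq> 0 \<longrightarrow> (\<forall>c. (\<forall>i\<in>I. (\<Sum>v\<in>S. c v * M' i v x) = 0) \<longrightarrow> (\<forall>v\<in>S. c v = 0)))"
  proof (rule insert.IH)
    show "M' i v \<in> F" if "i \<in> I" "v \<in> S" for i v
      unfolding M'_def using that p insert.prems(1) by (intro minus mult) auto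
    fix c assume c: "\<forall>i\<in>I. (\<Sum>v\<in>S. c v * M' i v x0) = 0"
    \<comment> \<open>The value at \<open>u\<close> is chosen to solve the pivot row;
      \<open>red\<close> then yields all other rows.\<close>
    define c' where "c' = c(u := - (\<Sum>v\<in>S. c v * M p v x0) / M p u x0)"
    have eq: "(\<Sum>v\<in>S. c' v * g v) = (\<Sum>v\<in>S. c v * g v)" for g
      using insert.hyps by (intro sum.cong) (auto simp: c'_def)
    have p0: "(\<Sum>v\<in>insert u S. c' v * M p v x0) = 0"
      using insert.hyps p by (simp add: eq) (simp add: c'_def)
    have "\<forall>i\<in>I. (\<Sum>v\<in>insert u S. c' v * M i v x0) = 0"
      using c red[of c' _ x0] p p0 by (simp add: eq)
    from insert.prems(2)[OF this] show "\<forall>v\<in>S. c v = 0"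
      using insert.hyps by (auto simp: c'_def split: if_splits)
  qed
  then obtain d where d: "d \<in> F" "d x0 \<noteq> 0"
    "\<And>x c. d x \<noteq> 0 \<Longrightarrow> \<forall>i\<in>I. (\<Sum>v\<in>S. c v * M' i v x) = 0 \<Longrightarrow> \<forall>v\<in>S. c v = 0" by blast
  show ?case
  proof (intro bexI[of _ "\<lambda>x. d x * M p u x"] conjI allI impI)
    show "(\<lambda>x. d x * M p u x) \<in> F" using d p insert.prems(1) by (intro mult) auto
    show "d x0 * M p u x0 \<noteq> 0" using d p by simp
    fix x c assume x: "d x * M p u x \<noteq> 0" and c: "\<forall>i\<in>I. (\<Sum>v\<in>insert u S. c v * M i v x) = 0"
    have S0: "\<forall>v\<in>S. c v = 0" using x c p by (intro d(3)) (auto simp: red)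
    have "(\<Sum>v\<in>insert u S. c v * M p v x) = c u * M p u x" using insert.hyps S0 by simp
    with c p x S0 show "\<forall>v\<in>insert u S. c v = 0" by auto
  qed
qed

lemma qpow_of_int_mult: "qpow h (of_int s * a) = qpow h a powi s"
proof (cases "s \<ge> 0")
  case True
  then obtain n where "s = int n" using nonneg_int_cases by blast
  then show ?thesis by (simp add: qpow_of_nat_mult)
next
  case False
  then obtain n where "s = - int n" by (intro that[of "nat (- s)"]) simp
  then show ?thesis by (simp add: qpow_of_nat_mult qpow_minus power_int_minus inverse_eq_divide)
qed

abbreviation root_vec :: "'n \<Rightarrow> 'n \<Rightarrow> real ^ 'n" where
  "root_vec a b \<equiv> axis a 1 - axis b 1"

lemma bil_cvec_root: "bil (cvec (x *\<^sub>R root_vec a b)) z = complex_of_real x * (z $ a - z $ b)"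
proof -
  have 1: "cvec (x *\<^sub>R root_vec a b) = complex_of_real x *s axis a 1 - complex_of_real x *s axis b 1"
    by (simp add: vec_eq_iff cvec_def axis_def algebra_simps)
  have 2: "bil (c *s u - d *s v) z = c * bil u z - d * bil v z" for c d and u v z :: "complex ^ 'b"
    by (simp add: bil_def sum_distrib_left left_diff_distrib sum_subtractf algebra_simps)
  show ?thesis by (simp only: 1 2 bil_axis_left) (simp add: right_diff_distrib)
qed

lemma echar_add_root:
  "echar h l (v + x *\<^sub>R root_vec a b) z = echar h l v z * qpow h (complex_of_real x * (z $ a - z $ b))"
  unfolding echar_def cvec_add bil_add_left bil_cvec_root by (simp add: add.assoc flip: qpow_add)

section \<open>Spaces of exponential sums with prescribed exponents\<close>

definition esum :: "complex \<Rightarrow> complex ^ 'n \<Rightarrow> (real ^ 'n) set \<Rightarrow> (real ^ 'n \<Rightarrow> complex) \<Rightarrow> complex ^ 'n \<Rightarrow> complex" where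
  "esum h l S c z = (\<Sum>v\<in>S. c v * echar h l v z)"

text \<open>Support and coefficients are forgotten and only a set containing the exponents is kept,
  so that sums, products and shifts need no bookkeeping.\<close>

definition ep :: "complex \<Rightarrow> complex ^ 'n \<Rightarrow> (real ^ 'n) set \<Rightarrow> (complex ^ 'n \<Rightarrow> complex) \<Rightarrow> bool" where
  "ep h l A f \<longleftrightarrow> (\<exists>S c. finite S \<and> S \<subseteq> A \<and> f = esum h l S c)"

lemma epE:
  assumes "ep h l A f"
  obtains S c where "finite S" "S \<subseteq> A" "f = esum h l S c"
  using assms unfolding ep_def by (elim exE conjE)

lemma epI: "finite S \<Longrightarrow> S \<subseteq> A \<Longrightarrow> ep h l A (esum h l S c)"
  by (auto simp: ep_def)

lemma ep_echar: "v \<in> A \<Longrightarrow> ep h l A (\<lambda>z. k * echar h l v z)"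
  unfolding ep_def by (intro exI[of _ "{v}"] exI[of _ "\<lambda>_. k"]) (auto simp: esum_def)

lemma ep_0: "ep h l A (\<lambda>_. 0)"
  unfolding ep_def by (intro exI[of _ "{}"]) (auto simp: esum_def fun_eq_iff)

lemma esum_extend:
  assumes "finite T" "S \<subseteq> T"
  shows "esum h l S c = esum h l T (\<lambda>v. if v \<in> S then c v else 0)"
  unfolding esum_def using assms by (intro ext sum.mono_neutral_cong_left) auto

lemma ep_add:
  assumes "ep h l A f" "ep h l A g"
  shows "ep h l A (\<lambda>z. f z + g z)"
proof -
  obtain S c T d where *: "finite S" "S \<subseteq> A" "f = esum h l S c" "finite T" "T \<subseteq> A" "g = esum h l T d"
    using assms unfolding ep_def by blast
  show ?thesis unfolding ep_def
  proof (intro exI conjI)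
    show "(\<lambda>z. f z + g z) = esum h l (S \<union> T)
        (\<lambda>v. (if v \<in> S then c v else 0) + (if v \<in> T then d v else 0))"
      using esum_extend[of "S \<union> T" S h l c] esum_extend[of "S \<union> T" T h l d] *
      by (auto simp: esum_def distrib_right sum.distrib)
  qed (use * in auto)
qed

lemma ep_sum: "finite I \<Longrightarrow> (\<And>i. i \<in> I \<Longrightarrow> ep h l A (f i)) \<Longrightarrow> ep h l A (\<lambda>z. \<Sum>i\<in>I. f i z)"
  by (induction I rule: finite_induct) (auto intro: ep_add ep_0)

lemma ep_scale: "ep h l A f \<Longrightarrow> ep h l A (\<lambda>z. k * f z)"
proof -
  assume "ep h l A f"
  then obtain S c where *: "finite S" "S \<subseteq> A" "f = esum h l S c" unfolding ep_def by blast
  have "(\<lambda>z. k * f z) = esum h l S (\<lambda>v. k * c v)"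
    by (auto simp: * esum_def sum_distrib_left ac_simps)
  then show ?thesis using * epI by metis
qed

lemma ep_diff: "ep h l A f \<Longrightarrow> ep h l A g \<Longrightarrow> ep h l A (\<lambda>z. f z - g z)"
  using ep_add[of h l A f "\<lambda>z. - 1 * g z"] ep_scale[of h l A g "- 1"] by simp

lemma ep_mult:
  assumes "ep h 0 A f" "ep h l B g" and AB: "\<And>u v. u \<in> A \<Longrightarrow> v \<in> B \<Longrightarrow> u + v \<in> C"
  shows "ep h l C (\<lambda>z. f z * g z)"
proof -
  obtain S c T d where *: "finite S" "S \<subseteq> A" "f = esum h 0 S c" "finite T" "T \<subseteq> B" "g = esum h l T d"
    using assms(1,2) unfolding ep_def by blast
  have "ep h l C (\<lambda>z. \<Sum>u\<in>S. \<Sum>v\<in>T. (c u * d v) * echar h l (u + v) z)"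
    using * AB by (intro ep_sum ep_echar) auto
  also have "(\<lambda>z. \<Sum>u\<in>S. \<Sum>v\<in>T. (c u * d v) * echar h l (u + v) z) = (\<lambda>z. f z * g z)"
    unfolding *(3,6) esum_def sum_product by (simp add: ac_simps flip: echar_mult)
  finally show ?thesis .
qed

lemma continuous_echar: "continuous_on UNIV (echar h l v)"
  unfolding echar_def[abs_def] qpow_def bil_def by (intro continuous_intros) auto

lemma ep_continuous: "ep h l A f \<Longrightarrow> continuous_on UNIV f"
  unfolding ep_def esum_def by (auto intro!: continuous_intros continuous_on_subset[OF continuous_echar])

text \<open>All limits are taken along real lines, punctured at the base point. This reduces
  residues and density arguments in several complex variables to one real variable.\<close>

lemma continuous_line:
  fixes f :: "complex ^ 'n \<Rightarrow> complex"
  assumes "continuous_on UNIV f"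
  shows "((\<lambda>\<tau>. f (z + \<tau> *\<^sub>R w)) \<longlongrightarrow> f z) (at (0::real))"
proof -
  have "isCont (\<lambda>\<tau>::real. f (z + \<tau> *\<^sub>R w)) 0"
    by (rule continuous_on_interior[of UNIV])
      (auto intro!: continuous_intros continuous_on_compose2[OF assms])
  then show ?thesis by (simp add: isCont_def)
qed

lemma ep_shift:
  assumes "ep h l A f"
  shows "ep h l A (\<lambda>z. f (z + w))"
proof -
  obtain S c where *: "finite S" "S \<subseteq> A" "f = esum h l S c" using assms unfolding ep_def by blast
  have "(\<lambda>z. f (z + w)) = esum h l S (\<lambda>v. c v * echar h l v w)"
    by (auto simp: * esum_def echar_add_right ac_simps)
  then show ?thesis using * epI by metis
qed

section \<open>Characters when q is not a root of unity\<close>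

locale generic_q =
  fixes h q :: complex
  assumes exp_h: "exp h = q" and not_root_of_unity: "\<And>k::nat. k \<ge> 1 \<Longrightarrow> q ^ k \<noteq> 1"
begin

lemma h_nonzero [simp]: "h \<noteq> 0"
  using exp_h not_root_of_unity[of 1] by auto

lemma qpow_1: "qpow h 1 = q"
  by (simp add: qpow_def exp_h)

lemma q_nonzero [simp]: "q \<noteq> 0"
  using exp_h exp_not_eq_zero by metis

lemma qpow_of_nat: "qpow h (of_nat k) = q ^ k"
  using qpow_of_nat_mult[of h k 1] by (simp add: qpow_1)

lemma q_power_inject: "q ^ i = q ^ j \<longleftrightarrow> i = j"
proof -
  have False if "i < j" "q ^ i = q ^ j" for i j
  proof -
    have "q ^ j = q ^ i * q ^ (j - i)" using that(1) by (simp flip: power_add)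
    with that not_root_of_unity[of "j - i"] show False by simp
  qed
  then show ?thesis by (metis linorder_neqE_nat)
qed

lemma qpow_surj: "y \<noteq> 0 \<Longrightarrow> \<exists>x. qpow h x = y"
  by (intro exI[of _ "Ln y / h"]) (simp add: qpow_def)

lemma qpow_const_1:
  assumes "\<And>x. qpow h (c * x) = 1"
  shows "c = 0"
proof (rule ccontr)
  assume "c \<noteq> 0"
  then have "qpow h (c * (1 / (h * c))) = exp 1" by (simp add: qpow_def)
  moreover have "exp (1::complex) \<noteq> 1" by (simp add: exp_eq_1)
  ultimately show False using assms by metis
qed

text \<open>For \<open>N = 2\<close> these are the translations preserving x_a^(1/2) = \<epsilon>
  x_b^(1/2), for \<open>N = 1\<close> those preserving x_a = \<zeta> x_b. Besides the vectors with
  equal coordinates at \<open>a\<close> and \<open>b\<close> the group contains periods of the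
  exponential, and these detect integrality.\<close>

definition root_group :: "nat \<Rightarrow> 'n \<Rightarrow> 'n \<Rightarrow> (complex ^ 'n) set" where
  "root_group N a b = {w. qpow h (w $ a / of_nat N) = qpow h (w $ b / of_nat N)}"

lemma root_group_0: "0 \<in> root_group N a b"
  by (simp add: root_group_def)

lemma root_group_add: "u \<in> root_group N a b \<Longrightarrow> v \<in> root_group N a b \<Longrightarrow> u + v \<in> root_group N a b"
  by (simp add: root_group_def add_divide_distrib qpow_add)

text \<open>The difference \<open>u - v\<close> is tested on three kinds of elements: multiples of
  the other axes make the other coordinates vanish, equal entries at \<open>a\<close> and
  \<open>b\<close> make these two opposite, and the period 2 \<pi> i N / h at \<open>a\<close> makes
  N times the coordinate an integer.\<close>

lemma echar_eq_on_root_group: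
  fixes u v :: "real ^ 'n"
  assumes "a \<noteq> b" "N > 0"
  shows "(\<forall>w\<in>root_group N a b. echar h l u w = echar h l v w) \<longleftrightarrow>
    (\<exists>s::int. u = v + (of_int s / of_nat N) *\<^sub>R root_vec a b)"
proof
  assume eq: "\<forall>w\<in>root_group N a b. echar h l u w = echar h l v w"
  define d where "d = u - v"
  have d: "qpow h (bil (cvec d) w) = 1" if "w \<in> root_group N a b" for w
  proof -
    have "echar h l u w = echar h l v w * qpow h (bil (cvec d) w)"
      by (simp add: echar_def d_def cvec_diff bil_def left_diff_distrib sum_subtractf flip: qpow_add)
    with eq that show ?thesis by simp
  qed
  have other: "d $ i = 0" if "i \<noteq> a" "i \<noteq> b" for i
  proof -
    have "qpow h (complex_of_real (d $ i) * x) = 1" for x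
      using d[of "axis i x"] that by (simp add: root_group_def) (simp add: axis_def)
    then show ?thesis using qpow_const_1 by fastforce
  qed
  have "qpow h (complex_of_real (d $ a + d $ b) * x) = 1" for x
  proof -
    have "axis a x + axis b x \<in> root_group N a b"
      using assms by (simp add: root_group_def axis_def)
    from d[OF this] show ?thesis by (simp add: bil_add_right algebra_simps)
  qed
  then have ab: "d $ b = - d $ a" using qpow_const_1[of "complex_of_real (d $ a + d $ b)"]
    by (simp add: complex_eq_iff)
  have "axis a (2 * of_real pi * \<i> * of_nat N / h) \<in> root_group N a b"
    using assms by (simp add: root_group_def axis_def qpow_def)
  from d[OF this] have "exp (complex_of_real (d $ a) * (2 * of_real pi * \<i> * of_nat N)) = 1"
    by (simp add: qpow_def)
  then obtain s :: int where "d $ a * (2 * pi * N) = of_int (2 * s) * pi"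
    by (auto simp: exp_eq_1)
  then have s: "d $ a = of_int s / of_nat N" using assms by (simp add: field_simps)
  have "d = (of_int s / of_nat N) *\<^sub>R root_vec a b"
    using other ab s assms by (auto simp: vec_eq_iff axis_def)
  then show "\<exists>s::int. u = v + (of_int s / of_nat N) *\<^sub>R root_vec a b"
    by (intro exI[of _ s]) (simp add: d_def algebra_simps)
next
  assume "\<exists>s::int. u = v + (of_int s / of_nat N) *\<^sub>R root_vec a b"
  then obtain s :: int where u: "u = v + (of_int s / of_nat N) *\<^sub>R root_vec a b" by auto
  show "\<forall>w\<in>root_group N a b. echar h l u w = echar h l v w"
  proof
    fix w assume "w \<in> root_group N a b"
    then have "qpow h (w $ a / of_nat N - w $ b / of_nat N) = 1"
      by (simp add: root_group_def qpow_diff)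
    then have "qpow h (of_int s * (w $ a / of_nat N - w $ b / of_nat N)) = 1"
      by (simp only: qpow_of_int_mult) simp
    then show "echar h l u w = echar h l v w"
      unfolding u echar_add_root by (simp add: diff_divide_distrib right_diff_distrib)
  qed
qed

lemma echar_eq_iff: "(\<forall>z. echar h l u z = echar h l v z) \<longleftrightarrow> u = v" for u v :: "real ^ 'n"
proof
  assume eq: "\<forall>z. echar h l u z = echar h l v z"
  show "u = v"
  proof (subst vec_eq_iff, rule allI)
    fix i
    have "qpow h (complex_of_real (u $ i - v $ i) * x) = 1" for x
    proof -
      have "echar h l u (axis i x) = echar h l v (axis i x) * qpow h (complex_of_real (u $ i - v $ i) * x)"
        by (simp add: echar_axis algebra_simps flip: qpow_add)
      with eq show ?thesis by simp
    qed
    from qpow_const_1[OF this] show "u $ i = v $ i" by (simp add: complex_eq_iff)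
  qed
qed auto

end

lemma finite_arg_max:
  fixes f :: "'a \<Rightarrow> real"
  assumes "finite M" "M \<noteq> {}"
  obtains u where "u \<in> M" "\<And>u'. u' \<in> M \<Longrightarrow> f u' \<le> f u"
proof -
  have "Max (f ` M) \<in> f ` M" using assms by (intro Max_in) auto
  then obtain u where "u \<in> M" "Max (f ` M) = f u" by auto
  then show ?thesis using assms Max_ge[of "f ` M"] by (intro that[of u]) auto
qed

text \<open>Take \<open>u\<close> of maximal norm in \<open>M\<close>, and \<open>v\<close> maximal
  on \<open>T\<close> for the inner product with \<open>u\<close>. From u' + v' = u + v the inner
  product of u' with u is at least that of u with itself, which under the norm bound forces u' = u.
  The point is that \<open>u\<close> is chosen before \<open>T\<close>: the support of \<psi>
  depends on \<lambda>, while \<open>u\<close> may not.\<close>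

lemma leading_exponent:
  fixes M :: "'a::real_inner set"
  assumes "finite M" "M \<noteq> {}"
  obtains u where "u \<in> M" "\<And>T. finite T \<Longrightarrow> T \<noteq> {} \<Longrightarrow>
    \<exists>v\<in>T. \<forall>u'\<in>M. \<forall>v'\<in>T. u' + v' = u + v \<longrightarrow> u' = u \<and> v' = v"
proof -
  obtain u where u: "u \<in> M" "\<And>u'. u' \<in> M \<Longrightarrow> norm u' \<le> norm u"
    using finite_arg_max[OF assms] by metis
  show ?thesis
  proof (rule that[OF u(1)])
    fix T :: "'a set" assume T: "finite T" "T \<noteq> {}"
    obtain v where v: "v \<in> T" "\<And>v'. v' \<in> T \<Longrightarrow> u \<bullet> v' \<le> u \<bullet> v"
      using finite_arg_max[OF T] by metis
    show "\<exists>v\<in>T. \<forall>u'\<in>M. \<forall>v'\<in>T. u' + v' = u + v \<longrightarrow> u' = u \<and> v' = v"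
    proof (intro bexI[OF _ v(1)] ballI impI)
      fix u' v' assume uv: "u' \<in> M" "v' \<in> T" "u' + v' = u + v"
      have "u \<bullet> u' + u \<bullet> v' = u \<bullet> u + u \<bullet> v" using uv(3) by (metis inner_add_right)
      then have "u \<bullet> u' \<ge> u \<bullet> u" using v(2)[OF uv(2)] by linarith
      moreover have "u' \<bullet> u' \<le> u \<bullet> u" using u(2)[OF uv(1)] by (simp add: norm_le)
      ultimately have "(u - u') \<bullet> (u - u') \<le> 0"
        by (simp add: inner_diff_left inner_diff_right inner_commute)
      then have "u' = u" by (metis inner_ge_zero inner_eq_zero_iff order_antisym right_minus_eq)
      then show "u' = u \<and> v' = v" using uv by simp
    qed
  qed
qed

context generic_q
begin

lemma esum_pair_coeff_0:
  assumes "finite S" "finite T" "\<And>z. (\<Sum>u\<in>S. \<Sum>v\<in>T. k u v * echar h l (u + v) z) = 0"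
    and "u \<in> S" "v \<in> T" "\<And>u' v'. u' \<in> S \<Longrightarrow> v' \<in> T \<Longrightarrow> u' + v' = u + v \<Longrightarrow> u' = u \<and> v' = v"
  shows "k u v = 0"
proof -
  have "(\<Sum>i | i \<in> S \<times> T \<and> (\<forall>w\<in>UNIV. echar h l (fst i + snd i) w = echar h l (fst (u, v) + snd (u, v)) w). k (fst i) (snd i)) = 0"
    using assms(1-5)
    by (intro character_classes[where ch = "\<lambda>i. echar h l (fst i + snd i)"])
      (auto simp: echar_add_right sum.cartesian_product case_prod_beta)
  moreover have "{i. i \<in> S \<times> T \<and> (\<forall>w\<in>UNIV. echar h l (fst i + snd i) w = echar h l (fst (u, v) + snd (u, v)) w)} = {(u, v)}"
    using assms(4-6) echar_eq_iff[of l] by auto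
  ultimately show ?thesis by simp
qed

text \<open>No zero divisors: a suitable product of one term of \<open>f\<close> and one of
  \<open>g\<close> has an exponent that occurs only once.\<close>

lemma ep_domain:
  assumes "ep h 0 A f" "ep h l B g" "\<And>z. f z * g z = 0" "f \<noteq> (\<lambda>_. 0)"
  shows "g z = 0"
proof (rule ccontr)
  assume gz: "g z \<noteq> 0"
  obtain S c T d where *: "finite S" "S \<subseteq> A" "f = esum h 0 S c" "finite T" "T \<subseteq> B" "g = esum h l T d"
    using assms(1,2) unfolding ep_def by blast
  define S' where "S' = {v\<in>S. c v \<noteq> 0}"
  define T' where "T' = {v\<in>T. d v \<noteq> 0}"
  have f: "f w = (\<Sum>v\<in>S'. c v * echar h 0 v w)" for w
    unfolding *(3) esum_def S'_def by (rule sum.mono_neutral_right) (auto simp: *)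
  have g: "g w = (\<Sum>v\<in>T'. d v * echar h l v w)" for w
    unfolding *(6) esum_def T'_def by (rule sum.mono_neutral_right) (auto simp: *)
  have fin: "finite S'" "finite T'" using * by (auto simp: S'_def T'_def)
  have ne: "S' \<noteq> {}" "T' \<noteq> {}" using f g gz assms(4) by auto
  obtain u where u: "u \<in> S'" "\<And>T. finite T \<Longrightarrow> T \<noteq> {} \<Longrightarrow>
    \<exists>v\<in>T. \<forall>u'\<in>S'. \<forall>v'\<in>T. u' + v' = u + v \<longrightarrow> u' = u \<and> v' = v"
    using leading_exponent[OF fin(1) ne(1)] by blast
  from u(2)[OF fin(2) ne(2)] obtain v where v: "v \<in> T'"
    "\<forall>u'\<in>S'. \<forall>v'\<in>T'. u' + v' = u + v \<longrightarrow> u' = u \<and> v' = v" by blast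
  have "(\<Sum>u\<in>S'. \<Sum>v\<in>T'. (c u * d v) * echar h l (u + v) w) = f w * g w" for w
    unfolding f g sum_product by (simp add: ac_simps flip: echar_mult)
  then have "c u * d v = 0"
    using v u(1) fin assms(3) by (intro esum_pair_coeff_0[of S' T' "\<lambda>u v. c u * d v" l]) auto
  with u(1) v(1) show False by (auto simp: S'_def T'_def)
qed

section \<open>Laurent polynomials and generic properties\<close>

definition half_lattice :: "(real ^ 'n) set" where
  "half_lattice = {v. \<forall>i. 2 * v $ i \<in> \<int>}"

lemma half_lattice_add: "u \<in> half_lattice \<Longrightarrow> v \<in> half_lattice \<Longrightarrow> u + v \<in> half_lattice"
  by (auto simp: half_lattice_def distrib_left)

lemma half_lattice_0: "0 \<in> half_lattice"
  by (auto simp: half_lattice_def)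

lemma half_lattice_axis: "(of_int s / 2) *\<^sub>R axis i 1 \<in> half_lattice"
  by (auto simp: half_lattice_def axis_def)

lemma half_lattice_root: "(of_int s / 2) *\<^sub>R root_vec a b \<in> half_lattice"
  by (auto simp: half_lattice_def axis_def)

lemma laurent_ep: "laurent h f \<longleftrightarrow> ep h 0 half_lattice f" for f :: "complex ^ 'n \<Rightarrow> complex"
proof
  define e where "e k = (\<chi> i. (of_int (k $ i) / 2 :: real))" for k :: "int ^ 'n"
  have e: "echar h 0 (e k) z = qpow h (bil (ivec k) z / 2)" for k z
    by (simp add: echar_def e_def bil_def cvec_def ivec_def sum_divide_distrib)
  have inj: "inj e" by (auto simp: inj_def e_def vec_eq_iff)
  have e_half: "e k \<in> half_lattice" for k by (simp add: half_lattice_def e_def)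
  have surj: "\<exists>k. v = e k" if "v \<in> half_lattice" for v
    using that by (intro exI[of _ "\<chi> i. \<lfloor>2 * v $ i\<rfloor>"]) (auto simp: half_lattice_def e_def vec_eq_iff)
  show "ep h 0 half_lattice f" if "laurent h f"
  proof -
    obtain S c where *: "finite (S :: (int ^ 'n) set)" "f = (\<lambda>z. \<Sum>k\<in>S. c k * qpow h (bil (ivec k) z / 2))"
      using \<open>laurent h f\<close> unfolding laurent_def by blast
    show ?thesis unfolding *(2) e[symmetric] using * e_half by (intro ep_sum ep_echar) auto
  qed
  show "laurent h f" if "ep h 0 half_lattice f"
  proof -
    obtain S c where *: "finite S" "S \<subseteq> half_lattice" "f = esum h 0 S c"
      using \<open>ep h 0 half_lattice f\<close> by (rule epE)
    define K where "K = e -` S"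
    have S: "S = e ` K" using *(2) surj unfolding K_def by fast
    have "finite K" unfolding K_def using inj * by (intro finite_vimageI)
    moreover have "f = (\<lambda>z. \<Sum>k\<in>K. c (e k) * qpow h (bil (ivec k) z / 2))"
      unfolding *(3) esum_def S by (subst sum.reindex[OF inj_on_subset[OF inj]]) (simp_all add: e)
    ultimately show ?thesis unfolding laurent_def by (metis (mono_tags))
  qed
qed

lemma laurent_mult: "laurent h f \<Longrightarrow> laurent h g \<Longrightarrow> laurent h (\<lambda>z. f z * g z)"
  unfolding laurent_ep by (rule ep_mult[where A = half_lattice and B = half_lattice]) (auto intro: half_lattice_add)

lemma laurent_diff: "laurent h f \<Longrightarrow> laurent h g \<Longrightarrow> laurent h (\<lambda>z. f z - g z)"
  unfolding laurent_ep by (rule ep_diff)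

lemma laurent_const: "laurent h (\<lambda>_. k)"
  using ep_echar[OF half_lattice_0, of h 0 k] by (simp add: laurent_ep)

lemma laurent_echar: "v \<in> half_lattice \<Longrightarrow> laurent h (echar h 0 v)"
  using ep_echar[of v half_lattice h 0 1] by (simp add: laurent_ep)

lemma laurent_prod: "finite I \<Longrightarrow> (\<And>i. i \<in> I \<Longrightarrow> laurent h (f i)) \<Longrightarrow> laurent h (\<lambda>z. \<Prod>i\<in>I. f i z)"
  by (induction I rule: finite_induct) (auto intro: laurent_mult laurent_const)

lemma laurent_mult_nonzero:
  assumes "laurent h f" "laurent h g" "f \<noteq> (\<lambda>_. 0)" "g \<noteq> (\<lambda>_. 0)"
  shows "(\<lambda>z. f z * g z) \<noteq> (\<lambda>_. 0)"
  using ep_domain[of half_lattice f 0 half_lattice g] assms unfolding laurent_ep by (metis ext)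

lemma laurent_prod_nonzero:
  "finite I \<Longrightarrow> (\<And>i. i \<in> I \<Longrightarrow> laurent h (f i)) \<Longrightarrow> (\<And>i. i \<in> I \<Longrightarrow> f i \<noteq> (\<lambda>_. 0)) \<Longrightarrow>
    (\<lambda>z. \<Prod>i\<in>I. f i z) \<noteq> (\<lambda>_. 0)"
proof (induction I rule: finite_induct)
  case empty
  then show ?case by (metis prod.empty zero_neq_one)
next
  case (insert i I)
  then show ?case
    using laurent_mult_nonzero[of "f i" "\<lambda>z. \<Prod>i\<in>I. f i z"] laurent_prod[of I f] by simp
qed

lemma generically_mono: "generically h P \<Longrightarrow> (\<And>z. P z \<Longrightarrow> R z) \<Longrightarrow> generically h R"
  unfolding generically_def by blast

lemma generically_conj:
  assumes "generically h P" "generically h R"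
  shows "generically h (\<lambda>z. P z \<and> R z)"
proof -
  obtain f g where *: "laurent h f" "f \<noteq> (\<lambda>_. 0)" "\<forall>z. f z \<noteq> 0 \<longrightarrow> P z"
    "laurent h g" "g \<noteq> (\<lambda>_. 0)" "\<forall>z. g z \<noteq> 0 \<longrightarrow> R z"
    using assms unfolding generically_def by blast
  show ?thesis unfolding generically_def
    using laurent_mult[of f g] laurent_mult_nonzero[of f g] *
    by (intro exI[of _ "\<lambda>z. f z * g z"]) auto
qed

lemma generically_True: "generically h (\<lambda>_. True)"
  unfolding generically_def using laurent_const[of 1] by (intro exI[of _ "\<lambda>_. 1"]) (auto simp: fun_eq_iff)

lemma generically_ball:
  "finite I \<Longrightarrow> (\<And>i. i \<in> I \<Longrightarrow> generically h (P i)) \<Longrightarrow> generically h (\<lambda>z. \<forall>i\<in>I. P i z)"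
proof (induction I rule: finite_induct)
  case empty
  then show ?case using generically_True by simp
next
  case (insert i I)
  then show ?case using generically_conj[of "P i" "\<lambda>z. \<forall>i\<in>I. P i z"] by simp
qed

lemma generically_ex: "generically h P \<Longrightarrow> \<exists>z. P z"
  unfolding generically_def by fastforce

lemma generically_laurent: "laurent h f \<Longrightarrow> f \<noteq> (\<lambda>_. 0) \<Longrightarrow> generically h (\<lambda>z. f z \<noteq> 0)"
  unfolding generically_def by blast

end

subsection \<open>Separated vectors\<close>

text \<open>The intervals of length \<open>m\<close> starting at the points of \<open>B\<close> do
  not overlap in their interiors and all lie between \<open>lo\<close> and
  \<open>hi\<close>.\<close>

lemma card_separated_reals:
  fixes B :: "real set"
  assumes "finite B" "m \<ge> 0" "\<And>x y. x \<in> B \<Longrightarrow> y \<in> B \<Longrightarrow> x \<noteq> y \<Longrightarrow> \<bar>x - y\<bar> \<ge> m"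
    and "\<And>x. x \<in> B \<Longrightarrow> lo \<le> x \<and> x + m \<le> hi" "lo \<le> hi"
  shows "m * card B \<le> hi - lo"
  using assms(1,3-5)
proof (induction B arbitrary: hi rule: finite_linorder_max_induct)
  case empty
  then show ?case by simp
next
  case (insert b A)
  have "m * card A \<le> b - lo"
  proof (rule insert.IH)
    show "lo \<le> x \<and> x + m \<le> b" if "x \<in> A" for x
      using insert.prems(1)[of x b] insert.prems(2)[of x] insert.hyps(2) that by fastforce
    show "lo \<le> b" using insert.prems(2)[of b] by simp
  qed (use insert.prems(1) in auto)
  moreover have "b + m \<le> hi" "b \<notin> A" using insert.prems(2)[of b] insert.hyps by auto
  ultimately show ?case using insert.hyps(1) by (simp add: algebra_simps)
qed

definition separated :: "nat \<Rightarrow> real ^ 'n \<Rightarrow> bool" where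
  "separated m v \<longleftrightarrow> (\<forall>a b. a \<noteq> b \<longrightarrow> \<bar>v $ a - v $ b\<bar> \<ge> real m)"

definition rank_below :: "('n \<Rightarrow> 'b::linorder) \<Rightarrow> 'n \<Rightarrow> nat" where
  "rank_below k i = card {j. k j < k i}"

definition rank_above :: "('n \<Rightarrow> 'b::linorder) \<Rightarrow> 'n \<Rightarrow> nat" where
  "rank_above k i = card {j. k j > k i}"

lemma rank_below_above:
  fixes k :: "'n::finite \<Rightarrow> 'b::linorder"
  assumes "inj k"
  shows "rank_below k i + rank_above k i = CARD('n) - 1"
proof -
  have U: "UNIV = insert i ({j. k j < k i} \<union> {j. k j > k i})"
    using assms by (auto simp: inj_def) (metis linorder_neqE)
  have "CARD('n) = Suc (card ({j. k j < k i} \<union> {j. k j > k i}))"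
    by (subst U, subst card_insert_disjoint) auto
  also have "card ({j. k j < k i} \<union> {j. k j > k i}) = rank_below k i + rank_above k i"
    unfolding rank_below_def rank_above_def by (rule card_Un_disjoint) auto
  finally show ?thesis by simp
qed

lemma sum_rank_below:
  fixes k :: "'n::finite \<Rightarrow> 'b::linorder"
  assumes "inj k"
  shows "(\<Sum>i\<in>UNIV. f (rank_below k i)) = (\<Sum>r<CARD('n). f r)"
proof -
  have less: "rank_below k i < rank_below k j" if "k i < k j" for i j
    unfolding rank_below_def using that by (intro psubset_card_mono) (auto intro: less_trans)
  have inj: "inj (rank_below k)"
    using less assms unfolding inj_def by (metis linorder_neqE nat_neq_iff)
  have "rank_below k i < CARD('n)" for i
    using rank_below_above[OF assms, of i] by (metis One_nat_def Suc_pred le_add1 le_imp_less_Suc zero_less_card_finite)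
  then have "rank_below k ` UNIV = {..<CARD('n)}"
    by (intro card_subset_eq) (auto simp: card_image[OF inj])
  then show ?thesis using sum.reindex[OF inj, of f] by simp
qed

text \<open>For an injective key \<open>k\<close> this is the permutation of \<rho> whose
  coordinates are ordered like the values of \<open>k\<close>. Keys are the index order, as a
  reference for the norm, and the coordinates of a vector \<open>v\<close>, which gives the
  permutation of \<rho> in the chamber of \<open>v\<close>.\<close>

definition rank_vec :: "nat \<Rightarrow> ('n \<Rightarrow> 'b::linorder) \<Rightarrow> real ^ 'n" where
  "rank_vec m k = (\<chi> i. real m / 2 * (real (rank_below k i) - real (rank_above k i)))"

lemma rank_vec_inner:
  fixes k :: "'n::finite \<Rightarrow> 'b::linorder"
  assumes "inj k"
  shows "rank_vec m k \<bullet> rank_vec m k = (\<Sum>r<CARD('n). (real m / 2 * (2 * real r - real (CARD('n) - 1)))\<^sup>2)"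
proof -
  have "real (rank_below k i) - real (rank_above k i) = 2 * real (rank_below k i) - real (CARD('n) - 1)" for i
    using rank_below_above[OF assms, of i] by linarith
  then have "rank_vec m k \<bullet> rank_vec m k
      = (\<Sum>i\<in>UNIV. (real m / 2 * (2 * real (rank_below k i) - real (CARD('n) - 1)))\<^sup>2)"
    by (simp only: rank_vec_def inner_vec_def vec_lambda_beta power2_eq_square inner_real_def)
  also have "\<dots> = (\<Sum>r<CARD('n). (real m / 2 * (2 * real r - real (CARD('n) - 1)))\<^sup>2)"
    by (rule sum_rank_below[OF assms])
  finally show ?thesis .
qed

text \<open>The difference of ranks on the left is the mean of two counts, of the coordinates in the
  half-open intervals from v_j to v_i closed at the left and at the right end. By separation each
  count times \<open>m\<close> fits into the gap.\<close>

lemma separated_gap: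
  fixes v :: "real ^ 'n"
  assumes "separated m v" "m > 0" "v $ j < v $ i"
  shows "rank_vec m (($) v) $ i - rank_vec m (($) v) $ j \<le> v $ i - v $ j"
proof -
  have sep: "\<bar>v $ a - v $ b\<bar> \<ge> real m" if "a \<noteq> b" for a b
    using assms that by (auto simp: separated_def)
  have inj: "inj (($) v)" using sep assms(2) by (force simp: inj_def)
  have sep': "real m \<le> \<bar>v $ a - v $ b\<bar>" if "v $ a \<noteq> v $ b" for a b
    using sep[of a b] that by auto
  have 1: "real m * card (($) v ` {k. v $ j \<le> v $ k \<and> v $ k < v $ i}) \<le> v $ i - v $ j"
  proof (rule card_separated_reals)
    fix x assume "x \<in> ($) v ` {k. v $ j \<le> v $ k \<and> v $ k < v $ i}"
    then obtain k where k: "x = v $ k" "v $ j \<le> v $ k" "v $ k < v $ i" by auto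
    then show "v $ j \<le> x \<and> x + real m \<le> v $ i" using sep'[of k i] by auto
  qed (use assms in \<open>auto intro: sep'\<close>)
  \<comment> \<open>The shift by \<open>m\<close> makes the intervals end, not start, at the
    coordinates, which suits the interval open at v_j.\<close>
  have 2: "real m * card ((\<lambda>k. v $ k - real m) ` {k. v $ j < v $ k \<and> v $ k \<le> v $ i}) \<le> v $ i - v $ j"
  proof (rule card_separated_reals)
    fix x assume "x \<in> (\<lambda>k. v $ k - real m) ` {k. v $ j < v $ k \<and> v $ k \<le> v $ i}"
    then obtain k where k: "x = v $ k - real m" "v $ j < v $ k" "v $ k \<le> v $ i" by auto
    then show "v $ j \<le> x \<and> x + real m \<le> v $ i" using sep'[of k j] by auto
  qed (use assms in \<open>auto intro: sep'\<close>)
  have inj': "inj (\<lambda>k. v $ k - real m)" using inj by (auto simp: inj_def)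
  have "rank_below (($) v) i = card ({k. v $ k < v $ j} \<union> {k. v $ j \<le> v $ k \<and> v $ k < v $ i})"
    unfolding rank_below_def by (rule arg_cong[of _ _ card]) (use assms(3) in auto)
  also have "\<dots> = rank_below (($) v) j + card {k. v $ j \<le> v $ k \<and> v $ k < v $ i}"
    unfolding rank_below_def by (rule card_Un_disjoint) auto
  finally have 3: "rank_below (($) v) i = rank_below (($) v) j + card {k. v $ j \<le> v $ k \<and> v $ k < v $ i}" .
  have "rank_above (($) v) j = card ({k. v $ k > v $ i} \<union> {k. v $ j < v $ k \<and> v $ k \<le> v $ i})"
    unfolding rank_above_def by (rule arg_cong[of _ _ card]) (use assms(3) in auto)
  also have "\<dots> = rank_above (($) v) i + card {k. v $ j < v $ k \<and> v $ k \<le> v $ i}"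
    unfolding rank_above_def by (rule card_Un_disjoint) auto
  finally have 4: "rank_above (($) v) j = rank_above (($) v) i + card {k. v $ j < v $ k \<and> v $ k \<le> v $ i}" .
  have "rank_vec m (($) v) $ i - rank_vec m (($) v) $ j
      = (real m * card {k. v $ j \<le> v $ k \<and> v $ k < v $ i} + real m * card {k. v $ j < v $ k \<and> v $ k \<le> v $ i}) / 2"
    by (simp add: rank_vec_def 3 4 field_simps)
  also have "\<dots> \<le> v $ i - v $ j"
    using 1 2 by (simp add: card_image[OF inj_on_subset[OF inj]] card_image[OF inj_on_subset[OF inj']])
  finally show ?thesis .
qed

text \<open>The number of coordinates below minus the number above is a sum of signs.
  Antisymmetrising in \<open>i\<close> and \<open>j\<close> leaves only differences of coordinates
  of \<open>x\<close>, the quantities bounded by \<open>separated_gap\<close>.\<close>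

lemma inner_rank_vec:
  fixes v x :: "real ^ 'n"
  shows "x \<bullet> rank_vec m (($) v) = real m / 4 * (\<Sum>i\<in>UNIV. \<Sum>j\<in>UNIV. (x $ i - x $ j) * sgn (v $ i - v $ j))"
proof -
  have sgn: "real (rank_below (($) v) i) - real (rank_above (($) v) i) = (\<Sum>j\<in>UNIV. sgn (v $ i - v $ j))" for i
  proof -
    have "(\<Sum>j\<in>UNIV. sgn (v $ i - v $ j))
        = (\<Sum>j\<in>UNIV. (if v $ j < v $ i then 1 else 0) - (if v $ j > v $ i then 1 else 0))"
      by (intro sum.cong) (auto simp: sgn_if)
    then show ?thesis by (simp add: sum_subtractf sum.If_cases rank_below_def rank_above_def)
  qed
  have swap: "(\<Sum>i\<in>UNIV. \<Sum>j\<in>UNIV. x $ j * sgn (v $ i - v $ j)) = - (\<Sum>i\<in>UNIV. \<Sum>j\<in>UNIV. x $ i * sgn (v $ i - v $ j))"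
  proof -
    have "(\<Sum>i\<in>UNIV. \<Sum>j\<in>UNIV. x $ j * sgn (v $ i - v $ j)) = (\<Sum>j\<in>UNIV. \<Sum>i\<in>UNIV. x $ j * - sgn (v $ j - v $ i))"
      by (subst sum.swap) (intro sum.cong refl, metis minus_diff_eq sgn_minus)
    then show ?thesis by (simp add: sum_negf)
  qed
  have "x \<bullet> rank_vec m (($) v) = real m / 2 * (\<Sum>i\<in>UNIV. \<Sum>j\<in>UNIV. x $ i * sgn (v $ i - v $ j))"
    by (simp add: inner_vec_def rank_vec_def sgn sum_distrib_left ac_simps)
  with swap show ?thesis by (simp add: left_diff_distrib sum_subtractf)
qed

text \<open>Among the vectors with coordinates at mutual distance at least \<open>m\<close>, the permutations of \<open>\<rho>\<close>
  are the shortest ones.\<close>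

lemma separated_extremal:
  fixes v :: "real ^ 'n" and k :: "'n \<Rightarrow> 'b::linorder"
  assumes "separated m v" "inj k" "norm v \<le> norm (rank_vec m k)"
  shows "v = rank_vec m (($) v)"
proof (cases "m = 0")
  case True
  then show ?thesis using assms(3) by (simp add: rank_vec_def vec_eq_iff zero_vec_def[symmetric])
next
  case False
  define r where "r = rank_vec m (($) v)"
  have inj: "inj (($) v)" using assms(1) False by (force simp: inj_def separated_def)
  have nr: "r \<bullet> r = rank_vec m k \<bullet> rank_vec m k"
    unfolding r_def by (simp add: rank_vec_inner[OF inj] rank_vec_inner[OF assms(2)])
  \<comment> \<open>All gaps of \<open>v\<close> are at least those of \<open>r\<close>, and both
    vectors are ordered alike. Together with |v| \<le> |r| this leaves no room for a nonzero
    \<open>v - r\<close>.\<close>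
  have "(v - r) \<bullet> r \<ge> 0"
  proof -
    have "((v - r) $ i - (v - r) $ j) * sgn (v $ i - v $ j) \<ge> 0" for i j
      using separated_gap[OF assms(1), of i j] separated_gap[OF assms(1), of j i] False
      by (auto simp: r_def sgn_if)
    then have "0 \<le> (\<Sum>i\<in>UNIV. \<Sum>j\<in>UNIV. ((v - r) $ i - (v - r) $ j) * sgn (v $ i - v $ j))"
      by (intro sum_nonneg)
    then have "0 \<le> real m / 4 * (\<Sum>i\<in>UNIV. \<Sum>j\<in>UNIV. ((v - r) $ i - (v - r) $ j) * sgn (v $ i - v $ j))"
      by (intro mult_nonneg_nonneg) auto
    then show ?thesis using inner_rank_vec[of "v - r" m v] unfolding r_def by linarith
  qed
  moreover have "v \<bullet> v \<le> r \<bullet> r" using assms(3) nr by (simp add: norm_le)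
  ultimately have "(v - r) \<bullet> (v - r) \<le> 0"
    by (simp add: inner_diff_left inner_diff_right inner_commute)
  then show ?thesis unfolding r_def[symmetric]
    by (metis inner_ge_zero inner_eq_zero_iff order_antisym right_minus_eq)
qed

lemma rho_nth:
  fixes i :: "'n :: {finite, linorder}"
  shows "rho m $ i = real m / 2 * (real (rank_above id i) - real (rank_below id i))"
proof -
  have inj: "inj_on (\<lambda>(a, b). root_vec a b :: real ^ 'n :: {finite, linorder}) {(a, b). a < b}"
  proof (rule inj_onI, clarify)
    fix a b c d assume *: "a < b" "c < d" "(root_vec a b :: real ^ 'n :: {finite, linorder}) = root_vec c d"
    then have "(root_vec a b :: real ^ 'n :: {finite, linorder}) $ a = root_vec c d $ a" "(root_vec a b :: real ^ 'n :: {finite, linorder}) $ b = root_vec c d $ b"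
      by simp_all
    with *(1,2) show "a = c \<and> b = d" by (auto simp: axis_def split: if_splits)
  qed
  have "pos_roots = (\<lambda>(a, b). root_vec a b :: real ^ 'n :: {finite, linorder}) ` {(a, b). a < b}"
    by (auto simp: pos_roots_def)
  then have "(\<Sum>\<alpha>\<in>pos_roots. real m *\<^sub>R \<alpha>) = (\<Sum>(a, b) | a < b. real m *\<^sub>R (root_vec a b :: real ^ 'n :: {finite, linorder}))"
    using sum.reindex[OF inj, of "\<lambda>\<alpha>. real m *\<^sub>R \<alpha>"] by (simp add: case_prod_beta o_def)
  then have "rho m $ i = real m / 2 * (\<Sum>(a, b) | a < b. (if a = i then 1 else 0) - (if b = i then 1 else 0))"
    by (simp add: rho_def case_prod_beta axis_def sum_distrib_left algebra_simps eq_commute[of i])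
  also have "(\<Sum>(a, b) | a < b. (if a = i then 1 else 0) - (if b = i then 1 else 0 :: real))
      = (\<Sum>(a, b) | a < b. if a = i then 1 else 0) - (\<Sum>(a, b) | a < b. if b = i then 1 else 0)"
    by (simp add: case_prod_beta sum_subtractf)
  also have "(\<Sum>(a, b) | a < b. if a = i then 1 else 0 :: real) = (\<Sum>p\<in>Pair i ` {b. i < b}. 1)"
    by (rule sum.mono_neutral_cong_right) auto
  also have "\<dots> = real (rank_above id i)"
    by (simp add: rank_above_def card_image inj_on_def)
  also have "(\<Sum>(a, b) | a < b. if b = i then 1 else 0 :: real) = (\<Sum>p\<in>(\<lambda>a. (a, i)) ` {a. a < i}. 1)"
    by (rule sum.mono_neutral_cong_right) auto
  also have "\<dots> = real (rank_below id i)"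
    by (simp add: rank_below_def card_image inj_on_def)
  finally show ?thesis .
qed

lemma norm_rho: "norm (rho m :: real ^ 'n :: {finite, linorder}) = norm (rank_vec m (id :: 'n \<Rightarrow> 'n))"
proof -
  have "rho m = - rank_vec m (id :: 'n \<Rightarrow> 'n)"
    by (simp add: vec_eq_iff rho_nth rank_vec_def algebra_simps)
  then show ?thesis by simp
qed

lemma norm_perm_vec:
  fixes v :: "real ^ 'n"
  assumes "p permutes UNIV"
  shows "norm (perm_vec p v) = norm v"
proof -
  have "perm_vec p v \<bullet> perm_vec p v = v \<bullet> v"
    unfolding inner_vec_def perm_vec_def using sum.permute[OF assms, of "\<lambda>i. v $ i * v $ i"] by (simp add: o_def)
  then show ?thesis by (simp add: norm_eq_sqrt_inner)
qed

text \<open>The orbit of \<rho> lies on a sphere, and the ball bounded by it is convex.\<close>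

lemma BA_support_norm:
  fixes v :: "real ^ 'n :: {finite, linorder}"
  shows "v \<in> BA_support m \<Longrightarrow> norm v \<le> norm (rho m :: real ^ 'n :: {finite, linorder})"
proof -
  assume "v \<in> BA_support m"
  then have "v \<in> rho_hull m" by (simp add: BA_support_def)
  moreover have "(rho_hull m :: (real ^ 'n :: {finite, linorder}) set) \<subseteq> cball 0 (norm (rho m :: real ^ 'n :: {finite, linorder}))"
    unfolding rho_hull_def by (rule hull_minimal) (auto simp: norm_perm_vec)
  ultimately show ?thesis by auto
qed

context generic_q
begin

section \<open>Solutions supported on a single root line\<close>

definition "Q = qpow h (1 / 2)"

lemma Q_square: "Q ^ 2 = q"
  unfolding Q_def using qpow_half_square[of h 1] by (simp add: qpow_1)

lemma Q_nonzero [simp]: "Q \<noteq> 0"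
  by (simp add: Q_def)

text \<open>At \<open>X = 0\<close> the second term drops out because \<open>j\<close> is at least
  1. What remains says that a polynomial of degree below \<open>2 * m\<close> vanishes at the
  \<open>2 * m\<close> nodes \<epsilon> Q^j. Triviality of the kernel then persists for small
  \<open>X\<close>, since the function \<open>d\<close> produced by elimination is
  continuous.\<close>

lemma poly_conditions_unique:
  "\<exists>\<delta>>0. \<forall>X. norm X < \<delta> \<longrightarrow> (\<forall>c :: nat \<Rightarrow> complex.
     (\<forall>j\<in>{1..m}. \<forall>\<epsilon>\<in>{1, -1}. (\<Sum>i<2*m. c i * ((\<epsilon> * Q ^ j) ^ i - X ^ j * \<epsilon> ^ j * (\<epsilon> / Q ^ j) ^ i)) = 0) \<longrightarrow>
     (\<forall>i<2*m. c i = 0))"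
proof -
  define I where "I = {1..m} \<times> {1, -1 :: complex}"
  define M where "M p i X = (snd p * Q ^ fst p) ^ i - X ^ fst p * snd p ^ fst p * (snd p / Q ^ fst p) ^ i"
    for p :: "nat \<times> complex" and i and X :: complex
  have "\<exists>d\<in>{f :: complex \<Rightarrow> complex. continuous_on UNIV f}. d (0::complex) \<noteq> 0 \<and>
    (\<forall>x. d x \<noteq> 0 \<longrightarrow> (\<forall>c. (\<forall>p\<in>I. (\<Sum>i\<in>{..<2*m}. c i * M p i x) = 0) \<longrightarrow> (\<forall>i\<in>{..<2*m}. c i = 0)))"
  proof (rule linear_system_generic)
    show "M p i \<in> {f. continuous_on UNIV f}" for p i
      unfolding M_def[abs_def] by (auto intro!: continuous_intros)
    fix c :: "nat \<Rightarrow> complex" assume c: "\<forall>p\<in>I. (\<Sum>i\<in>{..<2*m}. c i * M p i 0) = 0"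
    show "\<forall>i\<in>{..<2*m}. c i = 0"
    proof (rule ccontr)
      assume "\<not> ?thesis"
      then obtain k where k: "k < 2 * m" "c k \<noteq> 0" by auto
      define node where "node p = snd p * Q ^ fst p" for p :: "nat \<times> complex"
      have inj: "inj_on node I"
      proof (rule inj_onI)
        fix p p' assume p: "p \<in> I" "p' \<in> I" "node p = node p'"
        \<comment> \<open>Squaring removes the sign and leaves q^j, so \<open>j\<close> is recovered
          first, then \<epsilon>.\<close>
        have "node p ^ 2 = q ^ fst p" if "p \<in> I" for p
        proof -
          have "node p ^ 2 = (snd p)\<^sup>2 * (Q\<^sup>2) ^ fst p"
            by (simp add: node_def power_mult_distrib mult.commute flip: power_mult)
          with that show ?thesis by (auto simp: I_def Q_square)
        qed
        with p have "q ^ fst p = q ^ fst p'" by metis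
        then have "fst p = fst p'" by (simp add: q_power_inject)
        with p show "p = p'" by (auto simp: node_def prod_eq_iff)
      qed
      have "node ` I \<subseteq> {z. (\<Sum>i\<le>2*m-1. c i * z ^ i) = 0}"
      proof clarify
        fix j \<epsilon> assume "(j, \<epsilon>) \<in> I"
        then have "(\<Sum>i\<in>{..<2*m}. c i * M (j, \<epsilon>) i 0) = 0" "j \<ge> 1" using c by (auto simp: I_def)
        moreover have "{..<2*m} = {..2*m-1}" using k by auto
        ultimately show "(\<Sum>i\<le>2*m-1. c i * node (j, \<epsilon>) ^ i) = 0"
          by (simp add: M_def node_def power_0_left)
      qed
      moreover have "finite {z. (\<Sum>i\<le>2*m-1. c i * z ^ i) = 0} \<and> card {z. (\<Sum>i\<le>2*m-1. c i * z ^ i) = 0} \<le> 2*m-1"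
        using k by (intro polyfun_rootbound exI[of _ k]) auto
      ultimately have "card (node ` I) \<le> 2*m-1" using card_mono le_trans by blast
      moreover have "card (node ` I) = 2 * m" using inj by (simp add: card_image I_def card_cartesian_product)
      ultimately show False using k by linarith
    qed
  qed (auto intro: continuous_intros)
  then obtain d :: "complex \<Rightarrow> complex" where "d \<in> {f. continuous_on UNIV f}" and d0: "d 0 \<noteq> 0 \<and>
    (\<forall>x. d x \<noteq> 0 \<longrightarrow> (\<forall>c. (\<forall>p\<in>I. (\<Sum>i\<in>{..<2*m}. c i * M p i x) = 0) \<longrightarrow> (\<forall>i\<in>{..<2*m}. c i = 0)))"
    by (rule bexE)
  then have d: "continuous_on UNIV d" "d 0 \<noteq> 0" by auto
  have "isCont d 0" using d(1) by (simp add: continuous_on_eq_continuous_at)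
  then obtain \<delta> where \<delta>: "\<delta> > 0" "\<And>X. norm X < \<delta> \<Longrightarrow> d X \<noteq> 0"
    using continuous_at_avoid[of 0 d 0] d(2) by (metis dist_0_norm)
  show ?thesis
  proof (intro exI[of _ \<delta>] conjI allI impI)
    fix X c i
    assume *: "norm X < \<delta>" "i < 2 * m" and
      c: "\<forall>j\<in>{1..m}. \<forall>\<epsilon>\<in>{1, -1}. (\<Sum>i<2*m. c i * ((\<epsilon> * Q ^ j) ^ i - X ^ j * \<epsilon> ^ j * (\<epsilon> / Q ^ j) ^ i)) = 0"
    have "\<forall>p\<in>I. (\<Sum>i\<in>{..<2*m}. c i * M p i X) = 0" using c by (auto simp: I_def M_def)
    with d0 \<delta>(2)[OF *(1)] have "\<forall>i\<in>{..<2*m}. c i = 0" by blast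
    with * show "c i = 0" by auto
  qed (rule \<delta>(1))
qed

subsection \<open>Uniqueness of the solution for generic \<open>\<lambda>\<close>\<close>

text \<open>The coefficient of \<open>c v\<close> in one instance of the conditions, after division
  by the common factor q^(<\<lambda>,z>/2). The division makes it a Laurent polynomial in
  q^(\<lambda>/2), as elimination requires. There are infinitely many rows, since \<open>z\<close>
  runs through a hypersurface.\<close>

definition BA_row :: "'n::finite \<times> 'n \<times> nat \<times> complex \<times> (complex ^ 'n) \<Rightarrow> real ^ 'n \<Rightarrow> complex ^ 'n \<Rightarrow> complex" where
  "BA_row = (\<lambda>(a, b, j, \<epsilon>, z) v l. echar h 0 v z *
     (qpow h ((l $ a / 2 + v $ a) * of_nat j) - \<epsilon> ^ j * qpow h ((l $ b / 2 + v $ b) * of_nat j)))"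

definition BA_rows :: "nat \<Rightarrow> ('n::finite \<times> 'n \<times> nat \<times> complex \<times> (complex ^ 'n)) set" where
  "BA_rows m = {(a, b, j, \<epsilon>, z). a \<noteq> b \<and> j \<in> {1..m} \<and> \<epsilon> \<in> {1, -1} \<and>
     qpow h (z $ a / 2) = \<epsilon> * qpow h (z $ b / 2)}"

lemma BA_conditions_esum:
  "BA_conditions h m (esum h l S c) \<longleftrightarrow> (\<forall>i\<in>BA_rows m. (\<Sum>v\<in>S. c v * BA_row i v l) = 0)"
proof -
  have e: "esum h l S c (z + axis a (of_nat j))
      = (\<Sum>v\<in>S. qpow h (bil l z / 2) * (c v * (echar h 0 v z * qpow h ((l $ a / 2 + v $ a) * of_nat j))))" for a j z
    unfolding esum_def
    by (rule sum.cong[OF refl]) (simp only: echar_add_right echar_axis echar_split[of h l _ z] ac_simps)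
  have "esum h l S c (z + axis a (of_nat j)) - \<epsilon> ^ j * esum h l S c (z + axis b (of_nat j))
      = qpow h (bil l z / 2) * (\<Sum>v\<in>S. c v * BA_row (a, b, j, \<epsilon>, z) v l)" for a b j \<epsilon> z
    unfolding e sum_distrib_left sum_subtractf[symmetric] BA_row_def prod.case
    by (rule sum.cong[OF refl]) (simp only: right_diff_distrib ac_simps)
  then have "esum h l S c (z + axis a (of_nat j)) = \<epsilon> ^ j * esum h l S c (z + axis b (of_nat j))
      \<longleftrightarrow> (\<Sum>v\<in>S. c v * BA_row (a, b, j, \<epsilon>, z) v l) = 0" for a b j \<epsilon> z
    by (subst right_minus_eq[symmetric]) (simp only: mult_eq_0_iff qpow_nonzero simp_thms)
  then show ?thesis unfolding BA_conditions_def BA_rows_def by auto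
qed

lemma laurent_BA_row: "laurent h (BA_row i v)"
proof -
  obtain a b j \<epsilon> z where i: "i = (a, b, j, \<epsilon>, z)" using prod_cases5 by blast
  have lin: "qpow h ((l $ a / 2 + x) * of_nat j) = qpow h (x * of_nat j) * echar h 0 ((of_int (int j) / 2) *\<^sub>R axis a 1) l"
    for l :: "complex ^ 'a" and x a
  proof -
    have "cvec ((of_int (int j) / 2) *\<^sub>R axis a 1) = axis a (of_nat j / 2)"
      by (simp add: vec_eq_iff cvec_def axis_def)
    then show ?thesis by (simp add: echar_def algebra_simps flip: qpow_add)
  qed
  show ?thesis unfolding i BA_row_def prod.case lin
    by (intro laurent_mult laurent_diff laurent_const laurent_echar[OF half_lattice_axis])
qed

text \<open>Independence of characters splits the conditions into separate ones for each root line.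
  If the support on a line had fewer than \<open>2 * m\<close> half-steps, its coefficients would
  solve the square system of \<open>poly_conditions_unique\<close>, and the lowest of them would
  vanish. The bound \<open>small\<close> is asked for all of \<open>S\<close> because any of its
  points may turn out to be the lowest one.\<close>

lemma line_width:
  fixes v :: "real ^ 'n"
  assumes S: "finite S" and c: "BA_conditions h m (esum h l S c)" and ab: "a \<noteq> b"
    and v: "v \<in> S" "c v \<noteq> 0"
    and \<delta>: "\<forall>X. norm X < \<delta> \<longrightarrow> (\<forall>c :: nat \<Rightarrow> complex.
     (\<forall>j\<in>{1..m}. \<forall>\<epsilon>\<in>{1, -1}. (\<Sum>i<2*m. c i * ((\<epsilon> * Q ^ j) ^ i - X ^ j * \<epsilon> ^ j * (\<epsilon> / Q ^ j) ^ i)) = 0) \<longrightarrow>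
     (\<forall>i<2*m. c i = 0))"
    and small: "\<And>u. u \<in> S \<Longrightarrow> norm (qpow h ((l $ b / 2 + u $ b) - (l $ a / 2 + u $ a))) < \<delta>"
  obtains s0 s1 :: int where "s0 \<le> 0" "0 \<le> s1" "s1 - s0 \<ge> 2 * int m"
    "v + (s0 / 2) *\<^sub>R root_vec a b \<in> S" "c (v + (s0 / 2) *\<^sub>R root_vec a b) \<noteq> 0"
    "v + (s1 / 2) *\<^sub>R root_vec a b \<in> S" "c (v + (s1 / 2) *\<^sub>R root_vec a b) \<noteq> 0"
proof -
  define u where "u s = v + (of_int s / 2) *\<^sub>R root_vec a b" for s :: int
  have inj: "inj u" using ab by (auto simp: inj_def u_def vec_eq_iff axis_def split: if_splits)
  define T where "T = {s. u s \<in> S \<and> c (u s) \<noteq> 0}"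
  have finT: "finite T"
    by (rule finite_subset[OF _ finite_vimageI[OF S inj]]) (auto simp: T_def)
  have T0: "0 \<in> T" using v by (simp add: T_def u_def)
  define s0 where "s0 = Min T"
  define s1 where "s1 = Max T"
  have s0: "s0 \<in> T" and s1: "s1 \<in> T" using finT T0 by (auto simp: s0_def s1_def intro: Min_in Max_in)
  have "s1 - s0 \<ge> 2 * int m"
  proof (rule ccontr)
    assume "\<not> ?thesis"
    then have width: "s1 - s0 < 2 * int m" by simp
    then have m: "m > 0" using T0 finT by (metis Max_ge Min_le gr0I mult_zero_right of_nat_0 order_trans diff_ge_0_iff_ge linorder_not_le s0_def s1_def)
    define u0 where "u0 = u s0"
    define w where "w i = u0 + (of_nat i / 2) *\<^sub>R root_vec a b" for i :: nat
    have w: "w i = u (s0 + int i)" for i by (simp add: w_def u0_def u_def algebra_simps add_divide_distrib)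
    have injw: "inj w" by (rule injI) (use injD[OF inj] in \<open>force simp: w\<close>)
    \<comment> \<open>\<open>A\<close> scales out of every equation; only the ratio
      \<open>X\<close>, taken at the lowest exponent, enters the system.\<close>
    define A where "A = qpow h (l $ a / 2 + u0 $ a)"
    define X where "X = qpow h ((l $ b / 2 + u0 $ b) - (l $ a / 2 + u0 $ a))"
    \<comment> \<open>Points of the line outside \<open>S\<close> receive the coefficient 0, so all
      \<open>2 * m\<close> unknowns are present whatever the shape of the support.\<close>
    define c' where "c' i = (if w i \<in> S then c (w i) else 0)" for i
    have "(\<Sum>i<2*m. c' i * ((\<epsilon> * Q ^ j) ^ i - X ^ j * \<epsilon> ^ j * (\<epsilon> / Q ^ j) ^ i)) = 0"
      if j: "j \<in> {1..m}" and \<epsilon>: "\<epsilon> \<in> {1, -1}" for j \<epsilon>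
    proof -
      \<comment> \<open>\<open>axis a x0\<close> is a base point of the hypersurface x_a^(1/2) =
        \<epsilon> x_b^(1/2), which is its coset under \<open>root_group 2 a b\<close>. On that
        coset two exponents give the same character exactly if they lie on one root line in steps of
        \<alpha>/2.\<close>
      obtain y where "qpow h y = \<epsilon>" using qpow_surj[of \<epsilon>] \<epsilon> by auto
      then obtain x0 where x0: "qpow h (x0 / 2) = \<epsilon>" by (intro that[of "2 * y"]) simp
      define B where "B p = qpow h ((l $ a / 2 + p $ a) * of_nat j) - \<epsilon> ^ j * qpow h ((l $ b / 2 + p $ b) * of_nat j)"
        for p :: "real ^ 'n"
      define g where "g p = c p * echar h 0 p (axis a x0) * B p" for p
      have "(\<Sum>p\<in>S. g p * echar h 0 p z) = 0" if z: "z \<in> root_group 2 a b" for z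
      proof -
        have "qpow h ((axis a x0 + z) $ a / 2) = \<epsilon> * qpow h ((axis a x0 + z) $ b / 2)"
          using z ab x0 by (simp add: root_group_def axis_def add_divide_distrib qpow_add)
        then have "(a, b, j, \<epsilon>, axis a x0 + z) \<in> BA_rows m"
          using ab j \<epsilon> by (simp add: BA_rows_def)
        with c have "(\<Sum>p\<in>S. c p * BA_row (a, b, j, \<epsilon>, axis a x0 + z) p l) = 0"
          by (simp only: BA_conditions_esum)
        then show ?thesis by (simp add: BA_row_def g_def B_def echar_add_right ac_simps)
      qed
      then have "(\<Sum>p | p \<in> S \<and> (\<forall>z\<in>root_group 2 a b. echar h 0 p z = echar h 0 u0 z). g p) = 0"
        using s0 S by (intro character_classes) (auto simp: root_group_0 root_group_add echar_add_right T_def u0_def)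
      moreover have "(\<forall>z\<in>root_group 2 a b. echar h 0 p z = echar h 0 u0 z) \<longleftrightarrow> (\<exists>s::int. p = u s)" for p
      proof -
        have "(\<exists>s::int. p = u0 + (of_int s / 2) *\<^sub>R root_vec a b) \<longleftrightarrow> (\<exists>s::int. p = u s)"
        proof
          assume "\<exists>s::int. p = u0 + (of_int s / 2) *\<^sub>R root_vec a b"
          then obtain s :: int where "p = u0 + (of_int s / 2) *\<^sub>R root_vec a b" ..
          then have "p = u (s0 + s)" by (simp add: u0_def u_def algebra_simps add_divide_distrib)
          then show "\<exists>s::int. p = u s" ..
        next
          assume "\<exists>s::int. p = u s"
          then obtain s where "p = u s" ..
          then have "p = u0 + (of_int (s - s0) / 2) *\<^sub>R root_vec a b"
            by (simp add: u0_def u_def algebra_simps diff_divide_distrib)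
          then show "\<exists>s::int. p = u0 + (of_int s / 2) *\<^sub>R root_vec a b" by blast
        qed
        then show ?thesis using echar_eq_on_root_group[OF ab, of 2] by simp
      qed
      ultimately have "(\<Sum>p | p \<in> S \<and> (\<exists>s. p = u s). g p) = 0" by simp
      also have "(\<Sum>p | p \<in> S \<and> (\<exists>s. p = u s). g p) = (\<Sum>p | p \<in> S \<and> c p \<noteq> 0 \<and> (\<exists>s. p = u s). g p)"
        using S by (intro sum.mono_neutral_right) (auto simp: g_def)
      also have "\<dots> = (\<Sum>p\<in>w ` {..<2*m}. if p \<in> S then g p else 0)"
      proof (rule sum.mono_neutral_cong_left)
        show "{p \<in> S. c p \<noteq> 0 \<and> (\<exists>s. p = u s)} \<subseteq> w ` {..<2 * m}"
        proof clarify
          fix s assume "u s \<in> S" "c (u s) \<noteq> 0"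
          then have "s \<in> T" by (simp add: T_def)
          then have "s0 \<le> s" "s \<le> s1" using finT by (auto simp: s0_def s1_def)
          then have "u s = w (nat (s - s0))" "nat (s - s0) \<in> {..<2*m}" using width by (auto simp: w)
          then show "u s \<in> w ` {..<2*m}" by blast
        qed
      qed (auto simp: g_def w)
      also have "\<dots> = (\<Sum>i<2*m. if w i \<in> S then g (w i) else 0)"
        using injw by (subst sum.reindex) (auto intro: inj_on_subset)
      also have "\<dots> = (\<Sum>i<2*m. qpow h (u0 $ a * x0) * A ^ j * (c' i * ((\<epsilon> * Q ^ j) ^ i - X ^ j * \<epsilon> ^ j * (\<epsilon> / Q ^ j) ^ i)))"
      proof (rule sum.cong[OF refl])
        fix i
        have e: "echar h 0 (w i) (axis a x0) = qpow h (u0 $ a * x0) * \<epsilon> ^ i"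
        proof -
          have "echar h 0 (w i) (axis a x0) = qpow h (u0 $ a * x0 + of_nat i * (x0 / 2))"
            unfolding echar_axis using ab by (simp add: w_def axis_def algebra_simps)
          then show ?thesis by (simp only: qpow_add qpow_of_nat_mult x0)
        qed
        have Aw: "qpow h ((l $ a / 2 + w i $ a) * of_nat j) = A ^ j * (Q ^ j) ^ i"
        proof -
          have "(l $ a / 2 + w i $ a) * of_nat j = of_nat j * (l $ a / 2 + u0 $ a) + of_nat (j * i) * (1 / 2)"
            using ab by (simp add: w_def axis_def algebra_simps)
          then show ?thesis by (simp only: qpow_add qpow_of_nat_mult A_def Q_def power_mult)
        qed
        have Bw: "qpow h ((l $ b / 2 + w i $ b) * of_nat j) = A ^ j * X ^ j / (Q ^ j) ^ i"
        proof -
          have "(l $ b / 2 + w i $ b) * of_nat j = of_nat j * (l $ a / 2 + u0 $ a)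
              + of_nat j * ((l $ b / 2 + u0 $ b) - (l $ a / 2 + u0 $ a)) - of_nat (j * i) * (1 / 2)"
            using ab by (simp add: w_def axis_def algebra_simps)
          then show ?thesis by (simp only: qpow_add qpow_diff qpow_of_nat_mult A_def Q_def X_def power_mult)
        qed
        show "(if w i \<in> S then g (w i) else 0)
            = qpow h (u0 $ a * x0) * A ^ j * (c' i * ((\<epsilon> * Q ^ j) ^ i - X ^ j * \<epsilon> ^ j * (\<epsilon> / Q ^ j) ^ i))"
          unfolding g_def c'_def e B_def Aw Bw by (simp add: power_mult_distrib power_divide algebra_simps)
      qed
      also have "\<dots> = qpow h (u0 $ a * x0) * A ^ j * (\<Sum>i<2*m. c' i * ((\<epsilon> * Q ^ j) ^ i - X ^ j * \<epsilon> ^ j * (\<epsilon> / Q ^ j) ^ i))"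
        by (simp only: sum_distrib_left)
      finally show ?thesis by (simp add: A_def)
    qed
    moreover have "norm X < \<delta>" unfolding X_def using s0 by (intro small) (simp add: T_def u0_def)
    ultimately have "\<forall>i<2*m. c' i = 0" using \<delta> by blast
    then have "c' 0 = 0" using m by simp
    moreover have "w 0 = u s0" by (simp add: w)
    ultimately show False using s0 by (simp add: c'_def T_def)
  qed
  moreover have "s0 \<le> 0" "0 \<le> s1" using T0 finT by (auto simp: s0_def s1_def)
  ultimately show ?thesis using s0 s1 that[of s0 s1] by (simp add: T_def u_def)
qed

text \<open>A longest exponent of a solution is the endpoint of its intersection with every root line,
  because the norm is strictly convex along the line.\<close>

lemma BA_unique_generic:
  fixes S :: "(real ^ 'n) set"
  assumes "finite S" "\<And>v. v \<in> S \<Longrightarrow> \<not> separated m v"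
  shows "generically h (\<lambda>l :: complex ^ 'n. \<forall>c. BA_conditions h m (esum h l S c) \<longrightarrow> (\<forall>v\<in>S. c v = 0))"
proof -
  obtain \<delta> where \<delta>: "\<delta> > 0" "\<forall>X. norm X < \<delta> \<longrightarrow> (\<forall>c :: nat \<Rightarrow> complex.
     (\<forall>j\<in>{1..m}. \<forall>\<epsilon>\<in>{1, -1}. (\<Sum>i<2*m. c i * ((\<epsilon> * Q ^ j) ^ i - X ^ j * \<epsilon> ^ j * (\<epsilon> / Q ^ j) ^ i)) = 0) \<longrightarrow>
     (\<forall>i<2*m. c i = 0))" using poly_conditions_unique[of m] by blast
  obtain idx :: "'n \<Rightarrow> nat" where idx: "inj idx"
    using finite_imp_inj_to_nat_seg[OF finite[of "UNIV :: 'n set"]] by auto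
  \<comment> \<open>\<open>C\<close> bounds the part of \<open>X\<close> that depends on the
    exponent, uniformly in \<open>S\<close> and in the pair of indices; the summand 1 makes the
    bound strict.\<close>
  define C where "C = 1 + (\<Sum>u\<in>S. \<Sum>a\<in>UNIV. \<Sum>b\<in>UNIV. norm (qpow h (u $ b - u $ a)))"
  have C: "norm (qpow h (u $ b - u $ a)) < C" if "u \<in> S" for u a b
  proof -
    have "norm (qpow h (u $ b - u $ a)) \<le> (\<Sum>b\<in>UNIV. norm (qpow h (u $ b - u $ a)))"
      by (rule member_le_sum) auto
    also have "\<dots> \<le> (\<Sum>a\<in>UNIV. \<Sum>b\<in>UNIV. norm (qpow h (u $ b - u $ a)))"
      by (rule member_le_sum[where f = "\<lambda>a. \<Sum>b\<in>UNIV. norm (qpow h (u $ b - u $ a))"]) (auto intro!: sum_nonneg)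
    also have "\<dots> \<le> (\<Sum>u\<in>S. \<Sum>a\<in>UNIV. \<Sum>b\<in>UNIV. norm (qpow h (u $ b - u $ a)))"
      using that assms(1) by (intro member_le_sum[where f = "\<lambda>u :: real ^ 'n. \<Sum>a\<in>UNIV. \<Sum>b\<in>UNIV. norm (qpow h (u $ b - u $ a))"]) (auto intro!: sum_nonneg)
    finally show ?thesis by (simp add: C_def)
  qed
  have C0: "C > 0" unfolding C_def by (intro add_pos_nonneg sum_nonneg) auto
  \<comment> \<open>Chosen so that exp(-K) < 1/K = \<delta>/C.\<close>
  define K where "K = C / \<delta>"
  have K: "K > 0" using C0 \<delta>(1) by (simp add: K_def)
  have "exp (- K) < \<delta> / C"
  proof -
    have "K < exp K" using exp_ge_add_one_self[of K] by linarith
    then have "1 / exp K < 1 / K" using K by (intro divide_strict_left_mono) auto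
    then show ?thesis by (simp add: K_def exp_minus field_simps)
  qed
  then have KC: "exp (- K) * C < \<delta>" using C0 by (simp add: field_simps)
  \<comment> \<open>Division by \<open>h\<close> makes q^(l0_i/2) the real number exp(K idx_i).
    Distinct indices differ by at least 1, so one orientation of each root has its ratio below
    exp(-K).\<close>
  define l0 :: "complex ^ 'n" where "l0 = (\<chi> i. complex_of_real (2 * K * idx i) / h)"
  have small: "norm (qpow h ((l0 $ b / 2 + u $ b) - (l0 $ a / 2 + u $ a))) < \<delta>"
    if "u \<in> S" "idx b < idx a" for u a b
  proof -
    have "(l0 $ b / 2 + u $ b) - (l0 $ a / 2 + u $ a) = complex_of_real (K * (real (idx b) - idx a)) / h + (u $ b - u $ a)"
      by (simp add: l0_def diff_divide_distrib algebra_simps)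
    then have "norm (qpow h ((l0 $ b / 2 + u $ b) - (l0 $ a / 2 + u $ a)))
        = exp (K * (real (idx b) - idx a)) * norm (qpow h (u $ b - u $ a))"
      by (simp only: qpow_add norm_mult) (simp add: qpow_def norm_exp_eq_Re)
    also have "\<dots> \<le> exp (- K) * norm (qpow h (u $ b - u $ a))"
    proof (rule mult_right_mono)
      have "K * (real (idx b) - idx a) \<le> K * (- 1)"
        using that K by (intro mult_left_mono) auto
      then show "exp (K * (real (idx b) - idx a)) \<le> exp (- K)" by simp
    qed simp
    also have "\<dots> \<le> exp (- K) * C" using C[OF that(1)] by (intro mult_left_mono) (auto intro: less_imp_le)
    finally show ?thesis using KC by linarith
  qed
  have uniq: "\<forall>v\<in>S. c v = 0" if c: "BA_conditions h m (esum h l0 S c)" for c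
  proof (rule ccontr)
    assume "\<not> ?thesis"
    then have "finite {v\<in>S. c v \<noteq> 0}" "{v\<in>S. c v \<noteq> 0} \<noteq> {}" using assms(1) by auto
    then obtain v where "v \<in> {v\<in>S. c v \<noteq> 0}"
      and "\<And>u. u \<in> {v\<in>S. c v \<noteq> 0} \<Longrightarrow> norm u \<le> norm v"
      by (rule finite_arg_max[where f = norm]) blast
    then have v: "v \<in> S" "c v \<noteq> 0" and max: "\<And>u. u \<in> S \<Longrightarrow> c u \<noteq> 0 \<Longrightarrow> norm u \<le> norm v" by auto
    \<comment> \<open>Only the orientation with small \<open>X\<close> is available, but the claim
      is symmetric in \<open>a\<close> and \<open>b\<close>.\<close>
    have sep: "\<bar>v $ a - v $ b\<bar> \<ge> real m" if ab: "idx b < idx a" for a b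
    proof -
      have ne: "a \<noteq> b" using ab by auto
      obtain s0 s1 :: int where s: "s0 \<le> 0" "0 \<le> s1" "s1 - s0 \<ge> 2 * int m"
        "v + (s0 / 2) *\<^sub>R root_vec a b \<in> S" "c (v + (s0 / 2) *\<^sub>R root_vec a b) \<noteq> 0"
        "v + (s1 / 2) *\<^sub>R root_vec a b \<in> S" "c (v + (s1 / 2) *\<^sub>R root_vec a b) \<noteq> 0"
        using line_width[OF assms(1) c ne v \<delta>(2) small[OF _ ab]] by metis
      have step: "x * (v $ a - v $ b + x) \<le> 0" if "norm (v + x *\<^sub>R root_vec a b) \<le> norm v" for x
      proof -
        have "(v + x *\<^sub>R root_vec a b) \<bullet> (v + x *\<^sub>R root_vec a b) \<le> v \<bullet> v"
          using that by (simp add: norm_le)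
        moreover have "root_vec a b \<bullet> root_vec a b = 2" "v \<bullet> root_vec a b = v $ a - v $ b"
          using ne by (simp_all add: inner_diff_left inner_diff_right inner_axis) (simp add: axis_def)
        moreover have "(v + x *\<^sub>R r) \<bullet> (v + x *\<^sub>R r) = v \<bullet> v + 2 * x * (v \<bullet> r) + x * x * (r \<bullet> r)" for r
          by (simp add: inner_add_left inner_add_right inner_commute[of r v] distrib_left)
        ultimately have "2 * x * (v $ a - v $ b) + x * x * 2 \<le> 0" by simp
        then show ?thesis by (simp add: algebra_simps)
      qed
      have 0: "(s0 / 2) * (v $ a - v $ b + s0 / 2) \<le> 0" "(s1 / 2) * (v $ a - v $ b + s1 / 2) \<le> 0"
        using max s step by blast+
      have r: "real_of_int s1 - real_of_int s0 \<ge> 2 * real m"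
        using s(3) by linarith
      \<comment> \<open>With both signs present the two inequalities contradict each other. At an
        end of the segment the other end is no longer than \<open>v\<close>, and it is at least m
        \<alpha> away, so the coordinates of \<open>v\<close> differ by at least
        \<open>m\<close>.\<close>
      consider "s0 = 0" | "s1 = 0" | "s0 < 0" "s1 > 0" using s(1,2) by linarith
      then show ?thesis
      proof cases
        case 1
        show ?thesis
        proof (cases "s1 = 0")
          case False
          then have "v $ a - v $ b + s1 / 2 \<le> 0" using 0(2) s(2) by (simp add: mult_le_0_iff)
          with r 1 show ?thesis by simp
        qed (use 1 r in simp)
      next
        case 2
        show ?thesis
        proof (cases "s0 = 0")
          case False
          then have "v $ a - v $ b + s0 / 2 \<ge> 0" using 0(1) s(1) by (simp add: mult_le_0_iff)
          with r 2 show ?thesis by simp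
        qed (use 2 r in simp)
      next
        case 3
        then have "v $ a - v $ b + s0 / 2 \<ge> 0" "v $ a - v $ b + s1 / 2 \<le> 0"
          using 0 by (simp_all add: mult_le_0_iff)
        with 3 show ?thesis by simp
      qed
    qed
    have "separated m v" unfolding separated_def
    proof (intro allI impI)
      fix a b :: 'n assume "a \<noteq> b"
      then have "idx a < idx b \<or> idx b < idx a" using idx by (metis injD linorder_neqE_nat)
      then show "real m \<le> \<bar>v $ a - v $ b\<bar>" using sep[of a b] sep[of b a] by (auto simp: abs_minus_commute)
    qed
    with assms(2) v(1) show False by blast
  qed
  have "\<exists>d\<in>{f :: complex ^ 'n \<Rightarrow> complex. laurent h f}. d l0 \<noteq> 0 \<and>
    (\<forall>l. d l \<noteq> 0 \<longrightarrow> (\<forall>c. (\<forall>i\<in>BA_rows m. (\<Sum>v\<in>S. c v * BA_row i v l) = 0) \<longrightarrow> (\<forall>v\<in>S. c v = 0)))"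
    using assms(1) uniq
    by (intro linear_system_generic) (auto intro: laurent_const laurent_mult laurent_diff laurent_BA_row simp: BA_conditions_esum)
  then obtain d :: "complex ^ 'n \<Rightarrow> complex" where "d \<in> {f. laurent h f}" and d: "d l0 \<noteq> 0 \<and>
    (\<forall>l. d l \<noteq> 0 \<longrightarrow> (\<forall>c. (\<forall>i\<in>BA_rows m. (\<Sum>v\<in>S. c v * BA_row i v l) = 0) \<longrightarrow> (\<forall>v\<in>S. c v = 0)))"
    by (rule bexE)
  then have "laurent h d" by simp
  moreover have "d \<noteq> (\<lambda>_. 0)" using conjunct1[OF d] by metis
  ultimately show ?thesis unfolding generically_def BA_conditions_esum
    using conjunct2[OF d] by (intro exI[of _ d] conjI)
qed

end

subsection \<open>Removing poles\<close>

lemma xratio_nonzero [simp]: "xratio h z a b \<noteq> 0"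
  by (simp add: xratio_def)

lemma xratio_add: "xratio h (z + w) a b = xratio h z a b * qpow h (w $ a - w $ b)"
  by (simp add: xratio_def qpow_add qpow_diff)

lemma xratio_swap: "xratio h z b a = 1 / xratio h z a b"
  by (simp add: xratio_def)

lemma xratio_mult: "xratio h z a b * xratio h z b c = xratio h z a c"
  by (simp add: xratio_def)

lemma continuous_xratio: "continuous_on UNIV (\<lambda>z. xratio h z a b)"
  unfolding xratio_def qpow_def by (intro continuous_intros) auto

lemma continuous_xhalf_ratio: "continuous_on UNIV (\<lambda>z. xhalf_ratio h z a b)"
  unfolding xhalf_ratio_def qpow_def by (intro continuous_intros) auto

context generic_q
begin

lemma half_lattice_root_int: "of_int s *\<^sub>R root_vec a b \<in> half_lattice"
  using half_lattice_root[of "2 * s" a b] by simp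

text \<open>The condition under which exponential sums with exponents in \<open>A\<close> form a
  module over the Laurent polynomials.\<close>

definition hl_closed :: "(real ^ 'n) set \<Rightarrow> bool" where
  "hl_closed A \<longleftrightarrow> (\<forall>u\<in>half_lattice. \<forall>v\<in>A. u + v \<in> A)"

lemma ep_laurent_mult:
  "ep h 0 half_lattice f \<Longrightarrow> ep h l A g \<Longrightarrow> hl_closed A \<Longrightarrow> ep h l A (\<lambda>z. f z * g z)"
  by (erule ep_mult) (auto simp: hl_closed_def)

lemma ep_xratio: "ep h 0 half_lattice (\<lambda>z. xratio h z a b)"
  unfolding xratio_echar
  using laurent_echar[OF half_lattice_root_int[of 1]] by (simp add: laurent_ep)

lemma ep_xhalf_ratio: "ep h 0 half_lattice (\<lambda>z. xhalf_ratio h z a b)"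
  unfolding xhalf_ratio_echar
  using laurent_echar[OF half_lattice_root[of 1]] by (simp add: laurent_ep)

lemma ep_const: "ep h 0 half_lattice (\<lambda>_. k)"
  using laurent_const by (simp add: laurent_ep)

text \<open>This is the divisibility of y^s - \<zeta>^s by y - \<zeta> for y = x_a/x_b, with the
  exponents of the quotient kept inside \<open>A\<close>.\<close>

lemma echar_shift_divisible:
  assumes "hl_closed A" "v \<in> A"
  shows "\<exists>E. ep h l A E \<and> (\<forall>z. echar h l (v + of_nat s *\<^sub>R root_vec a b) z - \<zeta> ^ s * echar h l v z
    = (xratio h z a b - \<zeta>) * E z)"
proof (induction s)
  case 0
  then show ?case using ep_0 by (intro exI[of _ "\<lambda>_. 0"]) auto
next
  case (Suc s)
  then obtain E where E: "ep h l A E" "\<And>z. echar h l (v + of_nat s *\<^sub>R root_vec a b) z - \<zeta> ^ s * echar h l v z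
    = (xratio h z a b - \<zeta>) * E z" by blast
  have shift: "echar h l (v + of_nat (Suc s) *\<^sub>R root_vec a b) z = xratio h z a b * echar h l (v + of_nat s *\<^sub>R root_vec a b) z" for z
    unfolding xratio_echar echar_mult by (simp add: algebra_simps)
  show ?case
  proof (intro exI[of _ "\<lambda>z. xratio h z a b * E z + \<zeta> ^ s * echar h l v z"] conjI allI)
    show "ep h l A (\<lambda>z. xratio h z a b * E z + \<zeta> ^ s * echar h l v z)"
      by (intro ep_add ep_laurent_mult[OF ep_xratio E(1) assms(1)] ep_echar assms(2))
    fix z
    have "echar h l (v + of_nat (Suc s) *\<^sub>R root_vec a b) z - \<zeta> ^ Suc s * echar h l v z
      = xratio h z a b * (echar h l (v + of_nat s *\<^sub>R root_vec a b) z - \<zeta> ^ s * echar h l v z)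
        + (xratio h z a b - \<zeta>) * (\<zeta> ^ s * echar h l v z)"
      unfolding shift by (simp add: algebra_simps)
    then show "echar h l (v + of_nat (Suc s) *\<^sub>R root_vec a b) z - \<zeta> ^ Suc s * echar h l v z
      = (xratio h z a b - \<zeta>) * (xratio h z a b * E z + \<zeta> ^ s * echar h l v z)"
      unfolding E(2) by (simp add: algebra_simps)
  qed
qed

text \<open>If no two exponents differ by a multiple of the root, independence of characters on the subgroup
  \<open>x\<^sub>a = x\<^sub>b\<close> applies; otherwise one exponent is moved onto the other modulo \<open>x\<^sub>a / x\<^sub>b - \<zeta>\<close>.\<close>

lemma ep_divide:
  fixes G :: "complex ^ 'n \<Rightarrow> complex"
  assumes "ep h l A G" "hl_closed A" "a \<noteq> b" "\<zeta> \<noteq> 0"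
    and "\<And>z. xratio h z a b = \<zeta> \<Longrightarrow> G z = 0"
  shows "\<exists>G'. ep h l A G' \<and> (\<forall>z. G z = (xratio h z a b - \<zeta>) * G' z)"
proof -
  obtain S c where S: "finite S" "S \<subseteq> A" and G: "G = esum h l S c"
    using assms(1) by (rule epE)
  have "\<exists>G'. ep h l A G' \<and> (\<forall>z. esum h l S c z = (xratio h z a b - \<zeta>) * G' z)"
    if "finite S" "S \<subseteq> A" "\<And>z. xratio h z a b = \<zeta> \<Longrightarrow> esum h l S c z = 0" for S c
    using that
  proof (induction "card S" arbitrary: S c)
    case 0
    then show ?case using ep_0 by (intro exI[of _ "\<lambda>_. 0"]) (auto simp: esum_def)
  next
    case (Suc k)
    then obtain v where v: "v \<in> S" by fastforce
    have fin: "finite (S - {v})" "S - {v} \<subseteq> A" and card: "k = card (S - {v})"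
      using Suc v by auto
    have sum_v: "esum h l S c z = c v * echar h l v z + esum h l (S - {v}) c z" for z
      unfolding esum_def using Suc v by (subst sum.remove[of S v]) auto
    show ?case
    proof (cases "\<exists>s::int. s \<noteq> 0 \<and> v + of_int s *\<^sub>R root_vec a b \<in> S")
      case False
      obtain x0 where x0: "qpow h x0 = \<zeta>" using qpow_surj[OF assms(4)] by blast
      have "(\<Sum>u\<in>S. (c u * echar h l u (axis a x0)) * echar h l u w) = 0" if "w \<in> root_group 1 a b" for w
      proof -
        have "xratio h (axis a x0 + w) a b = \<zeta>"
          using that assms(3) x0 by (simp add: xratio_def root_group_def axis_def qpow_add)
        from Suc.prems(3)[OF this] show ?thesis by (simp add: esum_def echar_add_right ac_simps)
      qed
      then have "(\<Sum>u | u \<in> S \<and> (\<forall>w\<in>root_group 1 a b. echar h l u w = echar h l v w). c u * echar h l u (axis a x0)) = 0"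
        using Suc v by (intro character_classes) (auto simp: root_group_0 root_group_add echar_add_right)
      moreover have "{u. u \<in> S \<and> (\<forall>w\<in>root_group 1 a b. echar h l u w = echar h l v w)} = {v}"
      proof -
        have "u = v" if "u \<in> S" "\<forall>w\<in>root_group 1 a b. echar h l u w = echar h l v w" for u
        proof -
          from that(2) obtain s :: int where "u = v + (of_int s / of_nat 1) *\<^sub>R root_vec a b"
            unfolding echar_eq_on_root_group[OF assms(3) zero_less_one] ..
          then have "u = v + of_int s *\<^sub>R root_vec a b" by (simp only: of_nat_1 div_by_1)
          with that(1) False show ?thesis by (cases "s = 0") auto
        qed
        then show ?thesis using v by auto
      qed
      ultimately have "c v = 0" by simp
      then have "esum h l S c = esum h l (S - {v}) c" using sum_v by auto
      then show ?thesis using Suc.hyps(1)[OF card fin, of c] Suc.prems(3) by simp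
    next
      case True
      then obtain s :: int where s: "s \<noteq> 0" "v + of_int s *\<^sub>R root_vec a b \<in> S" by auto
      define u where "u = v + of_int s *\<^sub>R root_vec a b"
      have u: "u \<in> S - {v}"
      proof -
        have "u $ a = v $ a + of_int s" using assms(3) by (simp add: u_def axis_def)
        then have "u \<noteq> v" using s(1) by auto
        then show ?thesis using s(2) by (simp add: u_def)
      qed
      \<comment> \<open>Modulo x_a/x_b - \<zeta> the exponential of \<open>v\<close> is \<zeta>^(-s)
        times that of \<open>u\<close>. Which of the two is the upward shift of the other depends on
        the sign of \<open>s\<close>.\<close>
      have "\<exists>k E. ep h l A E \<and> (\<forall>z. echar h l v z - k * echar h l u z = (xratio h z a b - \<zeta>) * E z)"
      proof (cases "s > 0")
        case True
        obtain E where E: "ep h l A E" "\<And>z. echar h l (v + of_nat (nat s) *\<^sub>R root_vec a b) z - \<zeta> ^ nat s * echar h l v z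
          = (xratio h z a b - \<zeta>) * E z"
          using echar_shift_divisible[OF assms(2), of v l "nat s" a b \<zeta>] v Suc.prems(2) by blast
        have "echar h l v z - 1 / \<zeta> ^ nat s * echar h l u z = (xratio h z a b - \<zeta>) * (- (1 / \<zeta> ^ nat s) * E z)" for z
        proof -
          have "echar h l v z - 1 / \<zeta> ^ nat s * echar h l u z = - (1 / \<zeta> ^ nat s) * (echar h l u z - \<zeta> ^ nat s * echar h l v z)"
            using assms(4) by (simp add: field_simps)
          moreover have "echar h l u z - \<zeta> ^ nat s * echar h l v z = (xratio h z a b - \<zeta>) * E z"
            using E(2)[of z] True by (simp add: u_def)
          ultimately show ?thesis by (metis mult.left_commute)
        qed
        then show ?thesis using ep_scale[OF E(1)] by blast
      next
        case False
        obtain E where E: "ep h l A E" "\<And>z. echar h l (u + of_nat (nat (- s)) *\<^sub>R root_vec a b) z - \<zeta> ^ nat (- s) * echar h l u z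
          = (xratio h z a b - \<zeta>) * E z"
          using echar_shift_divisible[OF assms(2), of u l "nat (- s)" a b \<zeta>] u Suc.prems(2) by blast
        moreover have "u + of_nat (nat (- s)) *\<^sub>R root_vec a b = v" using False by (simp add: u_def algebra_simps)
        ultimately show ?thesis by metis
      qed
      then obtain k E where E: "ep h l A E" "\<And>z. echar h l v z - k * echar h l u z = (xratio h z a b - \<zeta>) * E z"
        by blast
      \<comment> \<open>The coefficient at \<open>v\<close> is merged into the one at
        \<open>u\<close>, which shortens the support by one.\<close>
      define c' where "c' = c(u := c u + c v * k)"
      have c': "esum h l (S - {v}) c' z = esum h l (S - {v}) c z + c v * k * echar h l u z" for z
      proof -
        have "esum h l (S - {v}) c' z = c' u * echar h l u z + (\<Sum>w\<in>S - {v} - {u}. c' w * echar h l w z)"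
          unfolding esum_def using fin u by (subst sum.remove[of "S - {v}" u]) auto
        also have "(\<Sum>w\<in>S - {v} - {u}. c' w * echar h l w z) = (\<Sum>w\<in>S - {v} - {u}. c w * echar h l w z)"
          by (rule sum.cong) (auto simp: c'_def)
        finally show ?thesis unfolding esum_def using fin u
          by (subst sum.remove[of "S - {v}" u]) (auto simp: c'_def algebra_simps)
      qed
      have eq: "esum h l S c z = esum h l (S - {v}) c' z + c v * ((xratio h z a b - \<zeta>) * E z)" for z
        unfolding sum_v c' E(2)[symmetric] by (simp add: algebra_simps)
      have "esum h l (S - {v}) c' z = 0" if "xratio h z a b = \<zeta>" for z
        using eq[of z] Suc.prems(3)[OF that] that by simp
      from Suc.hyps(1)[OF card fin this] obtain G' where
        G': "ep h l A G'" "\<And>z. esum h l (S - {v}) c' z = (xratio h z a b - \<zeta>) * G' z" by blast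
      show ?thesis
        by (intro exI[of _ "\<lambda>z. G' z + c v * E z"] conjI ep_add ep_scale E G')
          (simp add: eq G'(2) algebra_simps)
    qed
  qed
  from this[OF S, of c] assms(5) show ?thesis unfolding G by blast
qed

section \<open>Walls, and lines that cross or follow them\<close>

definition regular_point :: "complex ^ 'n \<Rightarrow> bool" where
  "regular_point z \<longleftrightarrow> (\<forall>a b. a \<noteq> b \<longrightarrow> xratio h z a b \<notin> {1, 1 / q})"

text \<open>The pair of \<open>a\<close> and \<open>b\<close> is exempt so that the point may lie on
  a wall x_a = \<zeta> x_b. Residues are computed at such points only; the rest of the wall is
  reached by continuity.\<close>

definition generic_off :: "'n \<Rightarrow> 'n \<Rightarrow> complex set \<Rightarrow> complex ^ 'n \<Rightarrow> bool" where
  "generic_off a b C z \<longleftrightarrow> (\<forall>i j. i \<noteq> j \<and> {i, j} \<noteq> {a, b} \<longrightarrow> xratio h z i j \<notin> C)"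

text \<open>Crosses the walls of the pair transversally: for distinct \<open>a\<close> and
  \<open>b\<close>, moving by \<tau> multiplies x_a/x_b by the real number exp(2\<tau>), thanks to
  the division by \<open>h\<close>.\<close>

definition root_dir :: "'n \<Rightarrow> 'n \<Rightarrow> complex ^ 'n" where
  "root_dir a b = axis a (1 / h) - axis b (1 / h)"

lemma eventually_exp_neq:
  assumes "d \<noteq> 0" "x \<noteq> 0"
  shows "eventually (\<lambda>\<tau>::real. x * exp (complex_of_real (\<tau> * d)) \<noteq> c) (at 0)"
proof (cases "x = c")
  case True
  have "x * exp (complex_of_real (\<tau> * d)) \<noteq> c" if "\<tau> \<noteq> 0" for \<tau>
  proof -
    have "exp (complex_of_real (\<tau> * d)) \<noteq> 1"
      using that assms by (simp only: exp_of_real) (simp add: complex_eq_iff)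
    then show ?thesis using True \<open>x \<noteq> 0\<close> by simp
  qed
  then show ?thesis by (simp add: eventually_at_filter)
next
  case False
  have "((\<lambda>\<tau>. x * exp (complex_of_real (\<tau> * d))) \<longlongrightarrow> x * exp (complex_of_real (0 * d))) (at 0)"
    by (intro tendsto_intros)
  then show ?thesis using False tendsto_imp_eventually_ne by fastforce
qed

lemma xratio_line:
  "xratio h (z + \<tau> *\<^sub>R w) a b = xratio h z a b * exp (complex_of_real \<tau> * (h * (w $ a - w $ b)))"
  unfolding xratio_add by (simp add: qpow_def) (simp add: scaleR_conv_of_real algebra_simps)

lemma eventually_xratio_neq:
  assumes "w $ a - w $ b = complex_of_real d / h" "d \<noteq> 0"
  shows "eventually (\<lambda>\<tau>. xratio h (z + \<tau> *\<^sub>R w) a b \<noteq> c) (at 0)"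
proof -
  have "h * (w $ a - w $ b) = complex_of_real d" using assms by simp
  then have "xratio h (z + \<tau> *\<^sub>R w) a b = xratio h z a b * exp (complex_of_real (\<tau> * d))" for \<tau>
    unfolding xratio_line by simp
  then show ?thesis using eventually_exp_neq[OF assms(2), of "xratio h z a b"] by simp
qed

lemma tendsto_xratio_line: "((\<lambda>\<tau>. xratio h (z + \<tau> *\<^sub>R w) a b) \<longlongrightarrow> xratio h z a b) (at 0)"
  by (rule continuous_line[OF continuous_xratio])

lemma tendsto_xhalf_ratio_line: "((\<lambda>\<tau>. xhalf_ratio h (z + \<tau> *\<^sub>R w) a b) \<longlongrightarrow> xhalf_ratio h z a b) (at 0)"
  by (rule continuous_line[OF continuous_xhalf_ratio])

text \<open>The coordinates move with distinct integer speeds, except that \<open>a\<close> takes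
  over the speed of \<open>b\<close>. The line therefore stays on its wall of this pair, while every
  other ratio leaves each given value at once.\<close>

lemma generic_direction:
  fixes a b :: "'n::finite"
  assumes "finite C"
  obtains w :: "complex ^ 'n" where "w $ a = w $ b" "\<And>z. eventually (\<lambda>\<tau>. generic_off a b C (z + \<tau> *\<^sub>R w)) (at 0)"
proof -
  obtain idx :: "'n \<Rightarrow> nat" where idx: "inj idx"
    using finite_imp_inj_to_nat_seg[OF finite[of "UNIV :: 'n set"]] by auto
  define e where "e i = (if i = a then idx b else idx i)" for i
  define w :: "complex ^ 'n" where "w = (\<chi> i. of_nat (e i) / h)"
  show ?thesis
  proof
    show "w $ a = w $ b" by (simp add: w_def e_def)
    fix z
    have "eventually (\<lambda>\<tau>. xratio h (z + \<tau> *\<^sub>R w) i j \<noteq> c) (at 0)" if "i \<noteq> j" "{i, j} \<noteq> {a, b}" for i j c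
    proof (rule eventually_xratio_neq)
      show "w $ i - w $ j = complex_of_real (real (e i) - real (e j)) / h"
        by (simp add: w_def diff_divide_distrib)
      show "real (e i) - real (e j) \<noteq> 0"
        using that idx by (auto simp: e_def inj_def split: if_splits)
    qed
    then have "eventually (\<lambda>\<tau>. \<forall>i. \<forall>j. \<forall>c\<in>C. i \<noteq> j \<and> {i, j} \<noteq> {a, b} \<longrightarrow> xratio h (z + \<tau> *\<^sub>R w) i j \<noteq> c) (at 0)"
      using assms by (intro eventually_all_finite eventually_ball_finite) (auto simp: eventually_const_iff intro: eventually_mono)
    then show "eventually (\<lambda>\<tau>. generic_off a b C (z + \<tau> *\<^sub>R w)) (at 0)"
      by eventually_elim (auto simp: generic_off_def)
  qed
qed

lemma eventually_regular:
  fixes z :: "complex ^ 'n"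
  assumes "a \<noteq> b" "generic_off a b {1, 1 / q} z"
  shows "eventually (\<lambda>\<tau>. regular_point (z + \<tau> *\<^sub>R root_dir a b)) (at 0)"
proof -
  have "eventually (\<lambda>\<tau>. i \<noteq> j \<longrightarrow> xratio h (z + \<tau> *\<^sub>R root_dir a b) i j \<noteq> c) (at 0)" if "c \<in> {1, 1 / q}" for i j c
  proof (cases "i \<noteq> j")
    case True
    consider "i = a" "j = b" | "i = b" "j = a" | "{i, j} \<noteq> {a, b}" by fast
    then have "eventually (\<lambda>\<tau>. xratio h (z + \<tau> *\<^sub>R root_dir a b) i j \<noteq> c) (at 0)"
    proof cases
      case 1
      then show ?thesis using assms(1)
        by (intro eventually_xratio_neq[of _ _ _ 2]) (auto simp: root_dir_def axis_def)
    next
      case 2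
      then show ?thesis using assms(1)
        by (intro eventually_xratio_neq[of _ _ _ "- 2"]) (auto simp: root_dir_def axis_def)
    next
      case 3
      then have "xratio h z i j \<noteq> c" using assms(2) True that by (auto simp: generic_off_def)
      then show ?thesis using tendsto_xratio_line tendsto_imp_eventually_ne by blast
    qed
    then show ?thesis by eventually_elim simp
  qed simp
  then have "eventually (\<lambda>\<tau>. \<forall>i. \<forall>j. \<forall>c\<in>{1, 1 / q}. i \<noteq> j \<longrightarrow> xratio h (z + \<tau> *\<^sub>R root_dir a b) i j \<noteq> c) (at 0)"
    by (intro eventually_all_finite eventually_ball_finite) auto
  then show ?thesis by eventually_elim (auto simp: regular_point_def)
qed

text \<open>The denominator is a list of factors, so poles of any order are allowed.\<close>

definition polar_factor :: "complex ^ 'n \<Rightarrow> 'n \<times> 'n \<times> complex \<Rightarrow> complex" where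
  "polar_factor z = (\<lambda>(a, b, \<zeta>). xratio h z a b - \<zeta>)"

definition polar_factors :: "('n \<times> 'n \<times> complex) set" where
  "polar_factors = {(a, b, \<zeta>). a \<noteq> b \<and> \<zeta> \<in> {1, 1 / q}}"

text \<open>The equation is asked at regular points only, since elsewhere \<open>H\<close> may
  contain divisions by zero.\<close>

definition polar :: "complex ^ 'n \<Rightarrow> (real ^ 'n) set \<Rightarrow> (complex ^ 'n \<Rightarrow> complex) \<Rightarrow> bool" where
  "polar l A H \<longleftrightarrow> (\<exists>Fs G. set Fs \<subseteq> polar_factors \<and> ep h l A G \<and>
     (\<forall>z. regular_point z \<longrightarrow> (\<Prod>f\<leftarrow>Fs. polar_factor z f) * H z = G z))"

lemma ep_polar_factors: "ep h 0 half_lattice (\<lambda>z. \<Prod>f\<leftarrow>Fs. polar_factor z f)"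
proof (induction Fs)
  case Nil
  then show ?case using ep_const by simp
next
  case (Cons f Fs)
  then show ?case
    using ep_mult[OF ep_diff[OF ep_xratio ep_const] Cons.IH, of half_lattice "fst f" "fst (snd f)" "snd (snd f)"]
    by (simp add: polar_factor_def case_prod_beta half_lattice_add)
qed

lemma polar_ep: "ep h l A G \<Longrightarrow> polar l A G"
  unfolding polar_def by (intro exI[of _ "[]"] exI[of _ G]) auto

lemma polar_add:
  assumes "polar l A H" "polar l A K" "hl_closed A"
  shows "polar l A (\<lambda>z. H z + K z)"
proof -
  obtain Fs G where F: "set Fs \<subseteq> polar_factors" "ep h l A G"
    "\<And>z. regular_point z \<Longrightarrow> (\<Prod>f\<leftarrow>Fs. polar_factor z f) * H z = G z"
    using assms(1) unfolding polar_def by blast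
  obtain Gs J where J: "set Gs \<subseteq> polar_factors" "ep h l A J"
    "\<And>z. regular_point z \<Longrightarrow> (\<Prod>f\<leftarrow>Gs. polar_factor z f) * K z = J z"
    using assms(2) unfolding polar_def by blast
  show ?thesis unfolding polar_def
  proof (intro exI[of _ "Fs @ Gs"] exI conjI allI impI)
    show "ep h l A (\<lambda>z. (\<Prod>f\<leftarrow>Gs. polar_factor z f) * G z + (\<Prod>f\<leftarrow>Fs. polar_factor z f) * J z)"
      by (intro ep_add ep_laurent_mult ep_polar_factors F J assms)
    show "(\<Prod>f\<leftarrow>Fs @ Gs. polar_factor z f) * (H z + K z)
      = (\<Prod>f\<leftarrow>Gs. polar_factor z f) * G z + (\<Prod>f\<leftarrow>Fs. polar_factor z f) * J z" if "regular_point z" for z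
      unfolding F(3)[OF that, symmetric] J(3)[OF that, symmetric] by (simp add: algebra_simps)
  qed (use F J in auto)
qed

lemma polar_mult:
  assumes "polar 0 half_lattice H" "polar l A K" "hl_closed A"
  shows "polar l A (\<lambda>z. H z * K z)"
proof -
  obtain Fs G where F: "set Fs \<subseteq> polar_factors" "ep h 0 half_lattice G"
    "\<And>z. regular_point z \<Longrightarrow> (\<Prod>f\<leftarrow>Fs. polar_factor z f) * H z = G z"
    using assms(1) unfolding polar_def by blast
  obtain Gs J where J: "set Gs \<subseteq> polar_factors" "ep h l A J"
    "\<And>z. regular_point z \<Longrightarrow> (\<Prod>f\<leftarrow>Gs. polar_factor z f) * K z = J z"
    using assms(2) unfolding polar_def by blast
  show ?thesis unfolding polar_def
  proof (intro exI[of _ "Fs @ Gs"] exI conjI allI impI)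
    show "ep h l A (\<lambda>z. G z * J z)" by (intro ep_laurent_mult F J assms)
    show "(\<Prod>f\<leftarrow>Fs @ Gs. polar_factor z f) * (H z * K z) = G z * J z" if "regular_point z" for z
      unfolding F(3)[OF that, symmetric] J(3)[OF that, symmetric] by (simp add: algebra_simps)
  qed (use F J in auto)
qed

lemma hl_closed_half_lattice: "hl_closed half_lattice"
  by (simp add: hl_closed_def half_lattice_add)

lemma polar_prod:
  "finite I \<Longrightarrow> (\<And>i. i \<in> I \<Longrightarrow> polar 0 half_lattice (f i)) \<Longrightarrow> polar 0 half_lattice (\<lambda>z. \<Prod>i\<in>I. f i z)"
  by (induction I rule: finite_induct)
    (auto intro!: polar_mult intro: polar_ep[OF ep_const] simp: hl_closed_half_lattice)

lemma polar_sum: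
  "finite I \<Longrightarrow> (\<And>i. i \<in> I \<Longrightarrow> polar l A (f i)) \<Longrightarrow> hl_closed A \<Longrightarrow> polar l A (\<lambda>z. \<Sum>i\<in>I. f i z)"
  by (induction I rule: finite_induct) (auto intro!: polar_add intro: polar_ep[OF ep_0])

lemma polar_inverse:
  fixes a b :: "'n::finite"
  assumes "a \<noteq> b"
  shows "polar 0 half_lattice (\<lambda>z. 1 / (1 - xratio h z a b))"
    and "polar 0 half_lattice (\<lambda>z. 1 / (1 - q * xratio h z a b))"
proof -
  show "polar 0 half_lattice (\<lambda>z. 1 / (1 - xratio h z a b))"
    unfolding polar_def
  proof (intro exI[of _ "[(a, b, 1)]"] exI[of _ "\<lambda>_. - 1"] conjI ep_const allI impI)
    fix z :: "complex ^ 'n" assume "regular_point z"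
    then have "xratio h z a b \<noteq> 1" using assms by (auto simp: regular_point_def)
    then show "(\<Prod>f\<leftarrow>[(a, b, 1)]. polar_factor z f) * (1 / (1 - xratio h z a b)) = - 1"
      by (simp add: polar_factor_def field_simps)
  qed (use assms in \<open>simp add: polar_factors_def\<close>)
  show "polar 0 half_lattice (\<lambda>z. 1 / (1 - q * xratio h z a b))"
    unfolding polar_def
  proof (intro exI[of _ "[(a, b, 1 / q)]"] exI[of _ "\<lambda>_. - 1 / q"] conjI ep_const allI impI)
    fix z :: "complex ^ 'n" assume "regular_point z"
    then have "xratio h z a b \<noteq> 1 / q" using assms by (auto simp: regular_point_def)
    then have "1 - q * xratio h z a b \<noteq> 0" by (auto simp: field_simps)
    then show "(\<Prod>f\<leftarrow>[(a, b, 1 / q)]. polar_factor z f) * (1 / (1 - q * xratio h z a b)) = - 1 / q"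
      by (simp add: polar_factor_def divide_simps)
  qed (use assms in \<open>simp add: polar_factors_def\<close>)
qed

definition regular_poly :: "complex ^ 'n \<Rightarrow> complex" where
  "regular_poly z = (\<Prod>(a, b, \<zeta>)\<in>polar_factors. xratio h z a b - \<zeta>)"

lemma finite_polar_factors: "finite (polar_factors :: ('n::finite \<times> 'n \<times> complex) set)"
proof -
  have "polar_factors \<subseteq> (UNIV :: 'n set) \<times> (UNIV :: 'n set) \<times> {1, 1 / q}" by (auto simp: polar_factors_def)
  then show ?thesis by (rule finite_subset) auto
qed

lemma laurent_xratio_diff: "laurent h (\<lambda>z. xratio h z a b - \<zeta>)"
  unfolding laurent_ep by (intro ep_diff ep_xratio ep_const)

lemma xratio_diff_nonzero:
  assumes "a \<noteq> b"
  shows "(\<lambda>z. xratio h z a b - \<zeta>) \<noteq> (\<lambda>_. 0)"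
proof
  assume eq: "(\<lambda>z :: complex ^ 'a. xratio h z a b - \<zeta>) = (\<lambda>_. 0)"
  have "xratio h (axis a k) a b = qpow h k" for k
    using assms by (simp add: xratio_def axis_def)
  then have "qpow h 0 = \<zeta>" "qpow h 1 = \<zeta>" using fun_cong[OF eq, of "axis a _"] by (metis right_minus_eq)+
  then show False using not_root_of_unity[of 1] by (simp add: qpow_1)
qed

lemma regular_poly:
  fixes z :: "complex ^ 'n"
  shows "laurent h (regular_poly :: complex ^ 'n \<Rightarrow> complex)" "regular_poly \<noteq> (\<lambda>_ :: complex ^ 'n. 0)"
    "regular_poly z \<noteq> 0 \<Longrightarrow> regular_point z"
proof -
  show "laurent h (regular_poly :: complex ^ 'n \<Rightarrow> complex)"
    unfolding regular_poly_def[abs_def] case_prod_beta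
    by (intro laurent_prod finite_polar_factors laurent_xratio_diff)
  show "regular_poly \<noteq> (\<lambda>_ :: complex ^ 'n. 0)"
    unfolding regular_poly_def[abs_def] case_prod_beta
    by (intro laurent_prod_nonzero finite_polar_factors laurent_xratio_diff xratio_diff_nonzero) (auto simp: polar_factors_def)
  show "regular_point z" if "regular_poly z \<noteq> 0"
  proof -
    have "\<forall>p\<in>polar_factors. (case p of (a, b, \<zeta>) \<Rightarrow> xratio h z a b - \<zeta>) \<noteq> 0"
      using that prod_zero_iff[OF finite_polar_factors, of "\<lambda>(a, b, \<zeta>). xratio h z a b - \<zeta>"]
      unfolding regular_poly_def by blast
    then show ?thesis by (fastforce simp: polar_factors_def regular_point_def)
  qed
qed

lemma generically_regular: "generically h regular_point"
  unfolding generically_def using regular_poly by blast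

lemma polar_rational:
  fixes H :: "complex ^ 'n \<Rightarrow> complex"
  assumes "polar 0 half_lattice H"
  shows "rational h H"
proof -
  obtain Fs G where F: "set Fs \<subseteq> polar_factors" "ep h 0 half_lattice G"
    "\<And>z. regular_point z \<Longrightarrow> (\<Prod>f\<leftarrow>Fs. polar_factor z f) * H z = G z"
    using assms unfolding polar_def by blast
  define R where "R z = (\<Prod>f\<leftarrow>Fs. polar_factor z f)" for z :: "complex ^ 'n"
  have R: "laurent h R" unfolding R_def[abs_def] laurent_ep by (rule ep_polar_factors)
  have "R z \<noteq> 0" if "regular_point z" for z
    using that F(1) unfolding R_def
    by (induction Fs) (auto simp: regular_point_def polar_factors_def polar_factor_def)
  moreover obtain z0 :: "complex ^ 'n" where "regular_point z0" using generically_ex[OF generically_regular] by blast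
  ultimately have R0: "R \<noteq> (\<lambda>_. 0)" by metis
  show ?thesis unfolding rational_def
  proof (intro exI conjI allI impI)
    \<comment> \<open>The common factor makes the new denominator vanish at every point that is not
      regular, where nothing is known about \<open>H\<close>.\<close>
    show "laurent h (\<lambda>z. regular_poly z * G z)" "laurent h (\<lambda>z. regular_poly z * R z)"
      using F(2) R regular_poly(1) by (auto intro: laurent_mult simp flip: laurent_ep)
    show "(\<lambda>z. regular_poly z * R z) \<noteq> (\<lambda>_. 0)"
      by (intro laurent_mult_nonzero regular_poly R R0)
    show "H z = regular_poly z * G z / (regular_poly z * R z)" if "regular_poly z * R z \<noteq> 0" for z
      using F(3)[OF regular_poly(3), of z] that by (auto simp: R_def field_simps)
  qed
qed

text \<open>One factor x_a/x_b - \<zeta> of the denominator is removed at a time. By the hypothesis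
  the numerator vanishes at generic points of the wall, by continuity on the whole wall, and
  \<open>ep_divide\<close> applies. As the hypothesis concerns \<open>H\<close> itself and the
  remaining factors are continuous, repeated factors need no separate treatment.\<close>

lemma polar_regularize:
  fixes H :: "complex ^ 'n \<Rightarrow> complex"
  assumes "polar l A H" "hl_closed A"
    and residue: "\<And>a b \<zeta> z. a \<noteq> b \<Longrightarrow> \<zeta> \<in> {1, 1 / q} \<Longrightarrow> generic_off a b {1, 1 / q} z \<Longrightarrow> xratio h z a b = \<zeta> \<Longrightarrow>
      ((\<lambda>\<tau>. (xratio h (z + \<tau> *\<^sub>R root_dir a b) a b - \<zeta>) * H (z + \<tau> *\<^sub>R root_dir a b)) \<longlongrightarrow> 0) (at 0)"
  obtains G where "ep h l A G" "\<And>z. regular_point z \<Longrightarrow> H z = G z"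
proof -
  have "\<exists>G. ep h l A G \<and> (\<forall>z. regular_point z \<longrightarrow> H z = G z)"
    if "set Fs \<subseteq> polar_factors" "ep h l A G"
      "\<And>z. regular_point z \<Longrightarrow> (\<Prod>f\<leftarrow>Fs. polar_factor z f) * H z = G z" for Fs G
    using that
  proof (induction Fs arbitrary: G)
    case Nil
    then show ?case by auto
  next
    case (Cons f Fs)
    obtain a b \<zeta> where f: "f = (a, b, \<zeta>)" "a \<noteq> b" "\<zeta> \<in> {1, 1 / q}"
      using Cons.prems(1) by (auto simp: polar_factors_def)
    define R where "R z = (\<Prod>f\<leftarrow>Fs. polar_factor z f)" for z
    have cR: "continuous_on UNIV R" unfolding R_def[abs_def] by (rule ep_continuous[OF ep_polar_factors])
    have cG: "continuous_on UNIV G" by (rule ep_continuous[OF Cons.prems(2)])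
    have G: "G z = (xratio h z a b - \<zeta>) * H z * R z" if "regular_point z" for z
      using Cons.prems(3)[OF that] by (simp add: f polar_factor_def R_def algebra_simps)
    have gen: "G z = 0" if z: "generic_off a b {1, 1 / q} z" "xratio h z a b = \<zeta>" for z
    proof -
      have "((\<lambda>\<tau>. (xratio h (z + \<tau> *\<^sub>R root_dir a b) a b - \<zeta>) * H (z + \<tau> *\<^sub>R root_dir a b) * R (z + \<tau> *\<^sub>R root_dir a b)) \<longlongrightarrow> 0 * R z) (at 0)"
        by (intro tendsto_mult residue f z continuous_line[OF cR])
      then have "((\<lambda>\<tau>. G (z + \<tau> *\<^sub>R root_dir a b)) \<longlongrightarrow> 0 * R z) (at 0)"
        by (rule Lim_transform_eventually)
          (use eventually_regular[OF f(2) z(1)] in \<open>eventually_elim, simp add: G\<close>)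
      from tendsto_unique[OF _ this continuous_line[OF cG]] show ?thesis by simp
    qed
    have "G z = 0" if z: "xratio h z a b = \<zeta>" for z
    proof -
      obtain w :: "complex ^ 'n" where w: "w $ a = w $ b"
        "\<And>z. eventually (\<lambda>\<tau>. generic_off a b {1, 1 / q} (z + \<tau> *\<^sub>R w)) (at 0)"
        by (rule generic_direction[of "{1, 1 / q}" a b]) auto
      have "eventually (\<lambda>\<tau>. G (z + \<tau> *\<^sub>R w) = 0) (at 0)"
        using w(2)[of z] by eventually_elim (rule gen, simp_all add: xratio_line w z)
      then have "((\<lambda>\<tau>. G (z + \<tau> *\<^sub>R w)) \<longlongrightarrow> 0) (at 0)"
        by (rule tendsto_eventually)
      from tendsto_unique[OF _ this continuous_line[OF cG]] show ?thesis by simp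
    qed
    moreover have "\<zeta> \<noteq> 0" using f(3) by auto
    ultimately obtain G' where G': "ep h l A G'" "\<And>z. G z = (xratio h z a b - \<zeta>) * G' z"
      using ep_divide[OF Cons.prems(2) assms(2) f(2)] by blast
    show ?case
    proof (rule Cons.IH)
      show "(\<Prod>f\<leftarrow>Fs. polar_factor z f) * H z = G' z" if "regular_point z" for z
      proof -
        have "xratio h z a b - \<zeta> \<noteq> 0" using that f by (auto simp: regular_point_def)
        moreover have "(xratio h z a b - \<zeta>) * (R z * H z) = (xratio h z a b - \<zeta>) * G' z"
          using G[OF that] G'(2)[of z] by (simp add: algebra_simps)
        ultimately show ?thesis by (simp add: R_def)
      qed
    qed (use Cons.prems G' in auto)
  qed
  with assms(1) that show ?thesis unfolding polar_def by blast
qed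

end

subsection \<open>The coefficients and their residues\<close>

lemma xhalf_ratio_square: "xhalf_ratio h z a b ^ 2 = xratio h z a b"
  by (simp add: xhalf_ratio_def xratio_def power_divide qpow_half_square)

lemma xhalf_ratio_nonzero [simp]: "xhalf_ratio h z a b \<noteq> 0"
  by (simp add: xhalf_ratio_def)

lemma BA_conditionsD:
  assumes "BA_conditions h m f" "a \<noteq> b" "\<epsilon> \<in> {1, -1}" "qpow h (z $ a / 2) = \<epsilon> * qpow h (z $ b / 2)" "j \<le> m"
  shows "f (z + axis a (of_nat j)) = \<epsilon> ^ j * f (z + axis b (of_nat j))"
proof (cases "j = 0")
  case True
  have "axis a 0 = axis b (0 :: complex)" by (simp add: axis_def vec_eq_iff)
  then show ?thesis using True by simp
next
  case False
  then have "j \<in> {1..m}" using assms(5) by simp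
  then show ?thesis using assms unfolding BA_conditions_def by blast
qed

text \<open>Sums over i < j become half of sums over ordered pairs: these are permuted by
  transpositions and do not refer to the order of the indices.\<close>

definition off_diag :: "('n \<times> 'n) set" where
  "off_diag = {(i, j). i \<noteq> j}"

lemma finite_off_diag [simp]: "finite (off_diag :: ('n::finite \<times> 'n) set)"
  by (rule finite_subset[of _ UNIV]) auto

abbreviation swp :: "'n \<Rightarrow> 'n \<Rightarrow> 'n \<Rightarrow> 'n" where
  "swp a b \<equiv> Transposition.transpose a b"

lemma swp_eq_iff: "swp a b i = swp a b j \<longleftrightarrow> i = j"
  by (metis transpose_involutory)

lemma sum_off_diag_swp:
  fixes a b :: "'n::finite"
  shows "(\<Sum>(i, j)\<in>off_diag. g (swp a b i) (swp a b j)) = (\<Sum>(i, j)\<in>off_diag. g i j)"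
proof (rule sum.reindex_bij_witness[of _ "map_prod (swp a b) (swp a b)" "map_prod (swp a b) (swp a b)"])
qed (auto simp: off_diag_def swp_eq_iff)

lemma sum_swp: "(\<Sum>i\<in>UNIV. g (swp a b i)) = (\<Sum>i\<in>UNIV. g i)" for a b :: "'n::finite"
  by (rule sum.reindex_bij_witness[of _ "swp a b" "swp a b"]) auto

lemma sum_off_diag_swp_0:
  fixes a b :: "'n::finite" and g :: "'n \<Rightarrow> 'n \<Rightarrow> complex"
  assumes "\<And>i j. i \<noteq> j \<Longrightarrow> g i j + g (swp a b i) (swp a b j) = 0"
  shows "(\<Sum>(i, j)\<in>off_diag. g i j) = 0"
proof -
  have "(\<Sum>(i, j)\<in>off_diag. g i j) + (\<Sum>(i, j)\<in>off_diag. g (swp a b i) (swp a b j)) = 0"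
    unfolding sum.distrib[symmetric] using assms by (intro sum.neutral) (auto simp: off_diag_def)
  then show ?thesis unfolding sum_off_diag_swp by simp
qed

context generic_q
begin

section \<open>Factors of a single pair, covariance and limits of the coefficients\<close>

definition pair_a :: "complex \<Rightarrow> complex \<Rightarrow> complex" where
  "pair_a t x = ((1 - t * x) * (1 - q * t * x)) / ((1 - x) * (1 - q * x))"

definition pair_c :: "complex \<Rightarrow> complex \<Rightarrow> complex" where
  "pair_c t x = (1 - t * x) / (1 - x)"

definition pair_b :: "complex \<Rightarrow> complex \<Rightarrow> complex \<Rightarrow> complex" where
  "pair_b t r r' = Q * (t - 1) * (t - q) * ((r + r') / ((1 - q * r\<^sup>2) * (1 - q * r'\<^sup>2)))"

lemma coeff_a_eq: "coeff_a h t i z = (\<Prod>j\<in>UNIV - {i}. pair_a t (xratio h z i j))"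
  by (simp add: coeff_a_def pair_a_def qpow_1)

lemma coeff_b_eq: "coeff_b h t i j z = pair_b t (xhalf_ratio h z i j) (xhalf_ratio h z j i) *
    (\<Prod>l\<in>UNIV - {i, j}. pair_c t (xratio h z i l) * pair_c t (xratio h z j l))"
  by (simp add: coeff_b_def pair_c_def pair_b_def qpow_1 Q_def xhalf_ratio_square)

lemma coeff_b_commute: "coeff_b h t i j z = coeff_b h t j i z"
  unfolding coeff_b_eq by (simp add: pair_b_def insert_commute[of i j] ac_simps)

lemma polar_coeff_a: "polar 0 half_lattice (coeff_a h t i)"
proof -
  have eq: "coeff_a h t i = (\<lambda>z. \<Prod>j\<in>UNIV - {i}. ((1 - t * xratio h z i j) * (1 - q * t * xratio h z i j)) *
      (1 / (1 - xratio h z i j) * (1 / (1 - q * xratio h z i j))))"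
    by (rule ext) (simp add: coeff_a_def qpow_1)
  show ?thesis unfolding eq
  proof (rule polar_prod)
    fix j assume j: "j \<in> UNIV - {i}"
    show "polar 0 half_lattice (\<lambda>z. ((1 - t * xratio h z i j) * (1 - q * t * xratio h z i j)) *
      (1 / (1 - xratio h z i j) * (1 / (1 - q * xratio h z i j))))"
    proof (rule polar_mult[OF polar_ep polar_mult[OF _ _ hl_closed_half_lattice] hl_closed_half_lattice])
      show "ep h 0 half_lattice (\<lambda>z. (1 - t * xratio h z i j) * (1 - q * t * xratio h z i j))"
        by (intro ep_laurent_mult ep_diff ep_const ep_scale ep_xratio hl_closed_half_lattice)
    qed (use j in \<open>auto intro: polar_inverse\<close>)
  qed simp
qed

lemma polar_coeff_b:
  assumes "i \<noteq> j"
  shows "polar 0 half_lattice (coeff_b h t i j)"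
proof -
  have eq: "coeff_b h t i j = (\<lambda>z. (Q * (t - 1) * (t - q) * (xhalf_ratio h z i j + xhalf_ratio h z j i)) *
      (1 / (1 - q * xratio h z i j) * (1 / (1 - q * xratio h z j i)) *
      (\<Prod>l\<in>UNIV - {i, j}. ((1 - t * xratio h z i l) * (1 - t * xratio h z j l)) *
      (1 / (1 - xratio h z i l) * (1 / (1 - xratio h z j l))))))"
    by (rule ext) (simp add: coeff_b_def qpow_1 Q_def)
  show ?thesis unfolding eq
  proof (rule polar_mult[OF _ polar_mult[OF _ polar_prod hl_closed_half_lattice] hl_closed_half_lattice])
    show "polar 0 half_lattice (\<lambda>z. Q * (t - 1) * (t - q) * (xhalf_ratio h z i j + xhalf_ratio h z j i))"
      by (intro polar_ep ep_scale ep_add ep_xhalf_ratio)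
    show "polar 0 half_lattice (\<lambda>z. 1 / (1 - q * xratio h z i j) * (1 / (1 - q * xratio h z j i)))"
      using assms by (intro polar_mult[OF polar_inverse(2) polar_inverse(2)] hl_closed_half_lattice) auto
    fix l assume l: "l \<in> UNIV - {i, j}"
    show "polar 0 half_lattice (\<lambda>z. ((1 - t * xratio h z i l) * (1 - t * xratio h z j l)) *
      (1 / (1 - xratio h z i l) * (1 / (1 - xratio h z j l))))"
    proof (rule polar_mult[OF polar_ep polar_mult[OF _ _ hl_closed_half_lattice] hl_closed_half_lattice])
      show "ep h 0 half_lattice (\<lambda>z. (1 - t * xratio h z i l) * (1 - t * xratio h z j l))"
        by (intro ep_laurent_mult ep_diff ep_const ep_scale ep_xratio hl_closed_half_lattice)
    qed (use l in \<open>auto intro: polar_inverse\<close>)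
  qed auto
qed

text \<open>The signs cancel in all integral powers of the ratios; only the half-integral numerator
  of \<open>coeff_b\<close> feels them. All signs 1 give invariance under the symmetric group, a
  transposition with a sign \<epsilon> gives the reflection x_a^(1/2) \<leftrightarrow> \<epsilon>
  x_b^(1/2).\<close>

lemma coeff_covariant:
  fixes z w :: "complex ^ 'n" and p :: "'n \<Rightarrow> 'n"
  assumes p: "bij p" and \<sigma>: "\<And>i. \<sigma> i \<in> {1, - 1 :: complex}"
    and w: "\<And>i. qpow h (w $ i / 2) = \<sigma> i * qpow h (z $ p i / 2)"
  shows "coeff_a h t i w = coeff_a h t (p i) z"
    and "coeff_b h t i j w = \<sigma> i * \<sigma> j * coeff_b h t (p i) (p j) z"
proof -
  have s2: "\<sigma> i * \<sigma> i = 1" "\<sigma> i \<noteq> 0" for i using \<sigma>[of i] by auto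
  have half: "xhalf_ratio h w i j = \<sigma> i * \<sigma> j * xhalf_ratio h z (p i) (p j)" for i j
    using s2[of j] by (simp add: xhalf_ratio_def w field_simps)
  have X: "xratio h w i j = xratio h z (p i) (p j)" for i j
    unfolding xhalf_ratio_square[symmetric] half power_mult_distrib
    using s2 by (simp add: power2_eq_square)
  have bij: "bij_betw p (UNIV - A) (UNIV - p ` A)" for A
    using p by (simp add: bij_betw_def inj_on_subset[OF _ subset_UNIV] image_set_diff)
  show "coeff_a h t i w = coeff_a h t (p i) z"
    unfolding coeff_a_eq X using prod.reindex_bij_betw[OF bij[of "{i}"], of "\<lambda>j. pair_a t (xratio h z (p i) j)"] by simp
  have "pair_b t (xhalf_ratio h w i j) (xhalf_ratio h w j i)
      = \<sigma> i * \<sigma> j * pair_b t (xhalf_ratio h z (p i) (p j)) (xhalf_ratio h z (p j) (p i))"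
    unfolding pair_b_def xhalf_ratio_square X unfolding half by (simp add: algebra_simps add_divide_distrib)
  moreover have "(\<Prod>l\<in>UNIV - {i, j}. pair_c t (xratio h w i l) * pair_c t (xratio h w j l))
      = (\<Prod>l\<in>UNIV - {p i, p j}. pair_c t (xratio h z (p i) l) * pair_c t (xratio h z (p j) l))"
    unfolding X
    using prod.reindex_bij_betw[OF bij[of "{i, j}"], of "\<lambda>l. pair_c t (xratio h z (p i) l) * pair_c t (xratio h z (p j) l)"] by simp
  ultimately show "coeff_b h t i j w = \<sigma> i * \<sigma> j * coeff_b h t (p i) (p j) z"
    unfolding coeff_b_eq by simp
qed

definition swp_sign :: "'n \<Rightarrow> 'n \<Rightarrow> complex \<Rightarrow> 'n \<Rightarrow> complex" where
  "swp_sign a b \<epsilon> i = (if i = a \<or> i = b then \<epsilon> else 1)"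

lemma coeff_swp:
  fixes z :: "complex ^ 'n" and x y :: complex
  assumes "a \<noteq> b" "\<epsilon> \<in> {1, -1}" "qpow h (z $ a / 2) = \<epsilon> * qpow h (z $ b / 2)"
  defines "P \<equiv> z + axis a x + axis b y" and "P' \<equiv> z + axis a y + axis b x"
  shows "coeff_a h t i P' = coeff_a h t (swp a b i) P"
    and "coeff_b h t i j P' = swp_sign a b \<epsilon> i * swp_sign a b \<epsilon> j * coeff_b h t (swp a b i) (swp a b j) P"
proof -
  have \<epsilon>: "\<epsilon> * \<epsilon> = 1" using assms(2) by auto
  have sgn: "swp_sign a b \<epsilon> i \<in> {1, -1}" for i using assms(2) by (auto simp: swp_sign_def)
  have P: "P $ c = z $ c + (if c = a then x else 0) + (if c = b then y else 0)"
    "P' $ c = z $ c + (if c = a then y else 0) + (if c = b then x else 0)" for c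
    by (auto simp: P_def P'_def axis_def)
  have w: "qpow h (P' $ c / 2) = swp_sign a b \<epsilon> c * qpow h (P $ swp a b c / 2)" for c
  proof -
    consider "c = a" | "c = b" | "c \<noteq> a" "c \<noteq> b" by auto
    then show ?thesis
    proof cases
      case 1
      then show ?thesis using assms(1,3) by (simp add: P swp_sign_def add_divide_distrib qpow_add)
    next
      case 2
      then show ?thesis using assms(1,3) \<epsilon> by (simp add: P swp_sign_def add_divide_distrib qpow_add)
    next
      case 3
      then show ?thesis by (simp add: P swp_sign_def transpose_apply_other)
    qed
  qed
  have bij: "bij (swp a b)" by simp
  show "coeff_a h t i P' = coeff_a h t (swp a b i) P"
    by (rule coeff_covariant(1)[OF bij sgn w])
  show "coeff_b h t i j P' = swp_sign a b \<epsilon> i * swp_sign a b \<epsilon> j * coeff_b h t (swp a b i) (swp a b j) P"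
    by (rule coeff_covariant(2)[OF bij sgn w])
qed

lemma one_minus_q: "x \<noteq> 1 / q \<Longrightarrow> q * x \<noteq> 1"
  by (auto simp: field_simps)

lemma tendsto_pair_a:
  "(x \<longlongrightarrow> x0) F \<Longrightarrow> x0 \<notin> {1, 1 / q} \<Longrightarrow> ((\<lambda>\<tau>. pair_a t (x \<tau>)) \<longlongrightarrow> pair_a t x0) F"
  unfolding pair_a_def by (intro tendsto_intros) (auto simp: one_minus_q)

lemma tendsto_pair_c:
  "(x \<longlongrightarrow> x0) F \<Longrightarrow> x0 \<noteq> 1 \<Longrightarrow> ((\<lambda>\<tau>. pair_c t (x \<tau>)) \<longlongrightarrow> pair_c t x0) F"
  unfolding pair_c_def by (intro tendsto_intros) auto

lemma tendsto_pair_b: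
  "(x \<longlongrightarrow> x0) F \<Longrightarrow> (y \<longlongrightarrow> y0) F \<Longrightarrow> x0\<^sup>2 \<noteq> 1 / q \<Longrightarrow> y0\<^sup>2 \<noteq> 1 / q \<Longrightarrow>
    ((\<lambda>\<tau>. pair_b t (x \<tau>) (y \<tau>)) \<longlongrightarrow> pair_b t x0 y0) F"
  unfolding pair_b_def by (intro tendsto_intros) (auto simp: one_minus_q)

lemma tendsto_coeff_a:
  assumes "\<And>j. j \<noteq> i \<Longrightarrow> xratio h z i j \<notin> {1, 1 / q}"
  shows "((\<lambda>\<tau>. coeff_a h t i (z + \<tau> *\<^sub>R w)) \<longlongrightarrow> coeff_a h t i z) (at 0)"
  unfolding coeff_a_eq using assms by (intro tendsto_prod tendsto_pair_a tendsto_xratio_line) auto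

lemma tendsto_coeff_b:
  assumes "xratio h z i j \<noteq> 1 / q" "xratio h z j i \<noteq> 1 / q"
    and "\<And>l. l \<noteq> i \<Longrightarrow> l \<noteq> j \<Longrightarrow> xratio h z i l \<noteq> 1 \<and> xratio h z j l \<noteq> 1"
  shows "((\<lambda>\<tau>. coeff_b h t i j (z + \<tau> *\<^sub>R w)) \<longlongrightarrow> coeff_b h t i j z) (at 0)"
  unfolding coeff_b_eq using assms
  by (intro tendsto_mult tendsto_prod tendsto_pair_c tendsto_pair_b tendsto_xratio_line tendsto_xhalf_ratio_line)
    (auto simp: xhalf_ratio_square)

section \<open>Residues of the coefficients along the walls\<close>

lemma eventually_xratio_root_neq:
  fixes z :: "complex ^ 'n"
  assumes "a \<noteq> b"
  shows "eventually (\<lambda>\<tau>. xratio h (z + \<tau> *\<^sub>R root_dir a b) a b \<noteq> c) (at 0)"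
  using assms by (intro eventually_xratio_neq[of _ _ _ 2]) (auto simp: root_dir_def axis_def)

lemma generic_offD:
  "generic_off a b C z \<Longrightarrow> i \<noteq> j \<Longrightarrow> {i, j} \<noteq> {a, b} \<Longrightarrow> c \<in> C \<Longrightarrow> xratio h z i j \<noteq> c"
  by (auto simp: generic_off_def)

lemma q_neq [simp]: "q \<noteq> 1" "q * q \<noteq> 1" "1 / q \<noteq> 1" "1 / q \<noteq> q" "q \<noteq> 1 / q" "1 \<noteq> 1 / q"
  using not_root_of_unity[of 1] not_root_of_unity[of 2] by (auto simp: power2_eq_square field_simps)

lemma residue_a_1:
  fixes z :: "complex ^ 'n"
  assumes ab: "a \<noteq> b" and gen: "generic_off a b {1, 1 / q} z" and X: "xratio h z a b = 1"
  obtains K where "((\<lambda>\<tau>. (xratio h (z + \<tau> *\<^sub>R root_dir a b) a b - 1) * coeff_a h t a (z + \<tau> *\<^sub>R root_dir a b))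
    \<longlongrightarrow> (1 - t) * (1 - q * t) * K) (at 0)"
proof -
  let ?P = "\<lambda>\<tau>. z + \<tau> *\<^sub>R root_dir a b"
  define R where "R z = (\<Prod>j\<in>UNIV - {a} - {b}. pair_a t (xratio h z a j))" for z :: "complex ^ 'n"
  have "coeff_a h t a z = pair_a t (xratio h z a b) * R z" for z
    unfolding coeff_a_eq R_def using ab by (subst prod.remove[of _ b]) auto
  moreover have R: "((\<lambda>\<tau>. R (?P \<tau>)) \<longlongrightarrow> R z) (at 0)"
    unfolding R_def
    by (intro tendsto_prod tendsto_pair_a tendsto_xratio_line) (use gen in \<open>auto simp: generic_off_def doubleton_eq_iff\<close>)
  moreover have "((\<lambda>\<tau>. (xratio h (?P \<tau>) a b - 1) * pair_a t (xratio h (?P \<tau>) a b)) \<longlongrightarrow> - ((1 - t * 1) * (1 - q * t * 1)) / (1 - q * 1)) (at 0)"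
  proof (rule Lim_transform_eventually)
    show "((\<lambda>\<tau>. - ((1 - t * xratio h (?P \<tau>) a b) * (1 - q * t * xratio h (?P \<tau>) a b)) / (1 - q * xratio h (?P \<tau>) a b))
        \<longlongrightarrow> - ((1 - t * 1) * (1 - q * t * 1)) / (1 - q * 1)) (at 0)"
      by (intro tendsto_intros tendsto_xratio_line[of z _ a b, unfolded X]) auto
    show "eventually (\<lambda>\<tau>. - ((1 - t * xratio h (?P \<tau>) a b) * (1 - q * t * xratio h (?P \<tau>) a b)) / (1 - q * xratio h (?P \<tau>) a b)
        = (xratio h (?P \<tau>) a b - 1) * pair_a t (xratio h (?P \<tau>) a b)) (at 0)"
      using eventually_xratio_root_neq[OF ab, of z 1]
    proof eventually_elim
      case (elim \<tau>)
      have "- u / v = (x - 1) * (u / ((1 - x) * v))" if "x \<noteq> 1" for u v x :: complex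
        using that by (cases "v = 0") (simp_all add: field_simps)
      from this[OF elim] show ?case by (simp add: pair_a_def)
    qed
  qed
  ultimately have "((\<lambda>\<tau>. ((xratio h (?P \<tau>) a b - 1) * pair_a t (xratio h (?P \<tau>) a b)) * R (?P \<tau>))
      \<longlongrightarrow> - ((1 - t * 1) * (1 - q * t * 1)) / (1 - q * 1) * R z) (at 0)"
    by (intro tendsto_mult)
  moreover have "- ((1 - t * 1) * (1 - q * t * 1)) / (1 - q * 1) * R z = (1 - t) * (1 - q * t) * (- R z / (1 - q))"
    by simp
  ultimately show ?thesis
    using that[of "- R z / (1 - q)"] \<open>\<And>z. coeff_a h t a z = pair_a t (xratio h z a b) * R z\<close> by (simp add: mult.assoc)
qed

text \<open>Here the factor t - 1 covers m = 0, when there is no condition with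
  \<open>j = 1\<close>.\<close>

lemma residue_b_1:
  fixes z :: "complex ^ 'n"
  assumes ab: "a \<noteq> b" and gen: "generic_off a b {1, 1 / q} z" and X: "xratio h z a b = 1"
    and l: "l \<noteq> a" "l \<noteq> b"
  obtains K where "((\<lambda>\<tau>. (xratio h (z + \<tau> *\<^sub>R root_dir a b) a b - 1) * coeff_b h t a l (z + \<tau> *\<^sub>R root_dir a b))
    \<longlongrightarrow> (t - 1) * K) (at 0)"
proof -
  let ?P = "\<lambda>\<tau>. z + \<tau> *\<^sub>R root_dir a b"
  define R where "R z = (\<Prod>k\<in>UNIV - {a, l} - {b}. pair_c t (xratio h z a k) * pair_c t (xratio h z l k))" for z :: "complex ^ 'n"
  define B where "B z = pair_b t (xhalf_ratio h z a l) (xhalf_ratio h z l a)" for z :: "complex ^ 'n"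
  have eq: "coeff_b h t a l z = pair_c t (xratio h z a b) * (pair_c t (xratio h z l b) * B z * R z)" for z
    unfolding coeff_b_eq R_def B_def using ab l by (subst prod.remove[of _ b]) auto
  have R: "((\<lambda>\<tau>. R (?P \<tau>)) \<longlongrightarrow> R z) (at 0)"
    unfolding R_def
    by (intro tendsto_prod tendsto_mult tendsto_pair_c tendsto_xratio_line) (use l gen in \<open>auto simp: generic_off_def doubleton_eq_iff\<close>)
  have B: "((\<lambda>\<tau>. B (?P \<tau>)) \<longlongrightarrow> B z) (at 0)"
    unfolding B_def using l gen
    by (intro tendsto_pair_b tendsto_xhalf_ratio_line) (auto simp: generic_off_def doubleton_eq_iff xhalf_ratio_square)
  have C: "((\<lambda>\<tau>. pair_c t (xratio h (?P \<tau>) l b)) \<longlongrightarrow> pair_c t (xratio h z l b)) (at 0)"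
    using l gen by (intro tendsto_pair_c tendsto_xratio_line) (auto simp: generic_off_def doubleton_eq_iff)
  have "((\<lambda>\<tau>. (xratio h (?P \<tau>) a b - 1) * pair_c t (xratio h (?P \<tau>) a b)) \<longlongrightarrow> - (1 - t * 1)) (at 0)"
  proof (rule Lim_transform_eventually)
    show "((\<lambda>\<tau>. - (1 - t * xratio h (?P \<tau>) a b)) \<longlongrightarrow> - (1 - t * 1)) (at 0)"
      by (intro tendsto_intros tendsto_xratio_line[of z _ a b, unfolded X])
    show "eventually (\<lambda>\<tau>. - (1 - t * xratio h (?P \<tau>) a b)
        = (xratio h (?P \<tau>) a b - 1) * pair_c t (xratio h (?P \<tau>) a b)) (at 0)"
      using eventually_xratio_root_neq[OF ab, of z 1]
      by eventually_elim (simp add: pair_c_def divide_simps, simp add: algebra_simps)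
  qed
  then have "((\<lambda>\<tau>. (xratio h (?P \<tau>) a b - 1) * pair_c t (xratio h (?P \<tau>) a b) * (pair_c t (xratio h (?P \<tau>) l b) * B (?P \<tau>) * R (?P \<tau>)))
      \<longlongrightarrow> - (1 - t * 1) * (pair_c t (xratio h z l b) * B z * R z)) (at 0)"
    by (intro tendsto_mult R B C)
  then show ?thesis using that[of "pair_c t (xratio h z l b) * B z * R z"] by (simp add: eq mult.assoc)
qed

text \<open>On this wall the poles of T_a^2 and T_a T_b must cancel against each other, so their
  residues are expressed by one constant \<open>K\<close>. Their ratio -\<epsilon> is what the
  condition with \<open>j = 1\<close> requires.\<close>

lemma residue_q:
  fixes z :: "complex ^ 'n"
  assumes ab: "a \<noteq> b" and gen: "generic_off a b {1, 1 / q} z" and \<epsilon>: "\<epsilon> \<in> {1, -1}"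
    and r: "xhalf_ratio h z a b = \<epsilon> / Q"
  obtains K where "((\<lambda>\<tau>. (xratio h (z + \<tau> *\<^sub>R root_dir a b) a b - 1 / q) * coeff_a h t a (z + \<tau> *\<^sub>R root_dir a b))
      \<longlongrightarrow> (t - 1) * K) (at 0)"
    "((\<lambda>\<tau>. (xratio h (z + \<tau> *\<^sub>R root_dir a b) a b - 1 / q) * coeff_b h t a b (z + \<tau> *\<^sub>R root_dir a b))
      \<longlongrightarrow> - \<epsilon> * ((t - 1) * K)) (at 0)"
proof -
  let ?P = "\<lambda>\<tau>. z + \<tau> *\<^sub>R root_dir a b"
  have e2: "\<epsilon> * \<epsilon> = 1" using \<epsilon> by auto
  have X: "xratio h z a b = 1 / q"
    unfolding xhalf_ratio_square[symmetric] r using e2 by (simp add: power_divide power2_eq_square[of \<epsilon>] Q_square)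
  have r': "xhalf_ratio h z b a = \<epsilon> * Q"
  proof -
    have "xhalf_ratio h z b a = 1 / xhalf_ratio h z a b" by (simp add: xhalf_ratio_def)
    then show ?thesis using r \<epsilon> by auto
  qed
  define R where "R z = (\<Prod>j\<in>UNIV - {a} - {b}. pair_a t (xratio h z a j))" for z :: "complex ^ 'n"
  define R' where "R' z = (\<Prod>l\<in>UNIV - {a, b}. pair_c t (xratio h z a l) * pair_c t (xratio h z b l))" for z :: "complex ^ 'n"
  have eq: "coeff_a h t a z = pair_a t (xratio h z a b) * R z" for z
    unfolding coeff_a_eq R_def using ab by (subst prod.remove[of _ b]) auto
  have eq': "coeff_b h t a b z = pair_b t (xhalf_ratio h z a b) (xhalf_ratio h z b a) * R' z" for z
    unfolding coeff_b_eq R'_def ..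
  \<comment> \<open>Since x_b/x_l = q x_a/x_l on the wall, the factors of \<open>coeff_b\<close> at
    x_a/x_l and x_b/x_l multiply to that of \<open>coeff_a\<close> at x_a/x_l.\<close>
  have RR': "R' z = R z"
  proof -
    have "xratio h z b l = q * xratio h z a l" for l
      using xratio_mult[of h z b a l] xratio_swap[of h z b a] X by (simp add: field_simps)
    moreover have "UNIV - {a, b} = UNIV - {a} - {b}" by auto
    ultimately show ?thesis unfolding R_def R'_def by (simp add: pair_a_def pair_c_def ac_simps)
  qed
  have R: "((\<lambda>\<tau>. R (?P \<tau>)) \<longlongrightarrow> R z) (at 0)"
    unfolding R_def
    by (intro tendsto_prod tendsto_pair_a tendsto_xratio_line) (use gen in \<open>auto simp: generic_off_def doubleton_eq_iff\<close>)
  have R': "((\<lambda>\<tau>. R' (?P \<tau>)) \<longlongrightarrow> R z) (at 0)"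
    unfolding RR'[symmetric] unfolding R'_def
    by (intro tendsto_prod tendsto_mult tendsto_pair_c tendsto_xratio_line) (use gen in \<open>auto simp: generic_off_def doubleton_eq_iff\<close>)
  have canc: "(x - 1 / q) * (u / (v * (1 - q * x))) = - (1 / q) * (u / v)" if "x \<noteq> 1 / q" for u v x
  proof -
    have "1 - q * x \<noteq> 0" using that by (auto simp: field_simps)
    moreover have "x - 1 / q = - (1 / q) * (1 - q * x)" by (simp add: field_simps)
    ultimately show ?thesis by simp
  qed
  have ev: "eventually (\<lambda>\<tau>. xratio h (?P \<tau>) a b \<noteq> 1 / q) (at 0)"
    by (rule eventually_xratio_root_neq[OF ab])
  have tX: "((\<lambda>\<tau>. xratio h (?P \<tau>) a b) \<longlongrightarrow> 1 / q) (at 0)"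
    using tendsto_xratio_line[of z _ a b] X by simp
  have a: "((\<lambda>\<tau>. (xratio h (?P \<tau>) a b - 1 / q) * pair_a t (xratio h (?P \<tau>) a b))
      \<longlongrightarrow> - (1 / q) * (((1 - t * (1 / q)) * (1 - q * t * (1 / q))) / (1 - 1 / q))) (at 0)"
  proof (rule Lim_transform_eventually)
    show "((\<lambda>\<tau>. - (1 / q) * (((1 - t * xratio h (?P \<tau>) a b) * (1 - q * t * xratio h (?P \<tau>) a b)) / (1 - xratio h (?P \<tau>) a b)))
        \<longlongrightarrow> - (1 / q) * (((1 - t * (1 / q)) * (1 - q * t * (1 / q))) / (1 - 1 / q))) (at 0)"
      by (intro tendsto_intros tX) auto
    show "eventually (\<lambda>\<tau>. - (1 / q) * (((1 - t * xratio h (?P \<tau>) a b) * (1 - q * t * xratio h (?P \<tau>) a b)) / (1 - xratio h (?P \<tau>) a b))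
        = (xratio h (?P \<tau>) a b - 1 / q) * pair_a t (xratio h (?P \<tau>) a b)) (at 0)"
      using ev
    proof eventually_elim
      case (elim \<tau>)
      show ?case unfolding pair_a_def canc[OF elim] ..
    qed
  qed
  have b: "((\<lambda>\<tau>. (xratio h (?P \<tau>) a b - 1 / q) * pair_b t (xhalf_ratio h (?P \<tau>) a b) (xhalf_ratio h (?P \<tau>) b a))
      \<longlongrightarrow> Q * (t - 1) * (t - q) * (- (1 / q) * ((\<epsilon> / Q + \<epsilon> * Q) / (1 - q * (\<epsilon> * Q)\<^sup>2)))) (at 0)"
  proof (rule Lim_transform_eventually)
    show "((\<lambda>\<tau>. Q * (t - 1) * (t - q) * (- (1 / q) * ((xhalf_ratio h (?P \<tau>) a b + xhalf_ratio h (?P \<tau>) b a) / (1 - q * (xhalf_ratio h (?P \<tau>) b a)\<^sup>2))))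
        \<longlongrightarrow> Q * (t - 1) * (t - q) * (- (1 / q) * ((\<epsilon> / Q + \<epsilon> * Q) / (1 - q * (\<epsilon> * Q)\<^sup>2)))) (at 0)"
      using e2 by (intro tendsto_intros tendsto_xhalf_ratio_line[of z _ a b, unfolded r] tendsto_xhalf_ratio_line[of z _ b a, unfolded r'])
        (simp add: power_mult_distrib Q_square power2_eq_square[of \<epsilon>])
    show "eventually (\<lambda>\<tau>. Q * (t - 1) * (t - q) * (- (1 / q) * ((xhalf_ratio h (?P \<tau>) a b + xhalf_ratio h (?P \<tau>) b a) / (1 - q * (xhalf_ratio h (?P \<tau>) b a)\<^sup>2)))
        = (xratio h (?P \<tau>) a b - 1 / q) * pair_b t (xhalf_ratio h (?P \<tau>) a b) (xhalf_ratio h (?P \<tau>) b a)) (at 0)"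
      using ev
    proof eventually_elim
      case (elim \<tau>)
      show ?case unfolding pair_b_def xhalf_ratio_square canc[OF elim, symmetric] by (simp add: ac_simps)
    qed
  qed
  define K where "K = (t - q) / (q * (1 - q)) * R z"
  have A1: "- (1 / q) * (((1 - t * (1 / q)) * (1 - q * t * (1 / q))) / (1 - 1 / q)) * R z = (t - 1) * K"
  proof -
    have "- (1 / q) * (((1 - t * (1 / q)) * (1 - q * t * (1 / q))) / (1 - 1 / q)) = (t - 1) * ((t - q) / (q * (1 - q)))"
      by (simp add: divide_simps) (simp add: algebra_simps)
    then show ?thesis by (simp add: K_def)
  qed
  have B1: "Q * (t - 1) * (t - q) * (- (1 / q) * ((\<epsilon> / Q + \<epsilon> * Q) / (1 - q * (\<epsilon> * Q)\<^sup>2))) * R z = - \<epsilon> * ((t - 1) * K)"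
  proof -
    have "(\<epsilon> * Q)\<^sup>2 = q" using e2 by (simp add: power_mult_distrib Q_square power2_eq_square[of \<epsilon>])
    moreover have "Q * (\<epsilon> / Q + \<epsilon> * Q) = \<epsilon> * (1 + q)"
      using Q_square by (simp add: field_simps power2_eq_square)
    \<comment> \<open>The factor 1 + q in the numerator of \<open>coeff_b\<close> cancels here,
      leaving the constant found for \<open>coeff_a\<close>.\<close>
    moreover have "(1 + q) / (1 - q * q) = 1 / (1 - q)"
    proof -
      have *: "1 - q * q = (1 + q) * (1 - q)" by (simp add: algebra_simps)
      then have "1 + q \<noteq> 0" using q_neq(2) by auto
      then show ?thesis unfolding * by simp
    qed
    ultimately have "Q * ((\<epsilon> / Q + \<epsilon> * Q) / (1 - q * (\<epsilon> * Q)\<^sup>2)) = \<epsilon> * (1 / (1 - q))"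
      by (metis (no_types, lifting) times_divide_eq_right)
    moreover have "Q * (t - 1) * (t - q) * (- (1 / q) * ((\<epsilon> / Q + \<epsilon> * Q) / (1 - q * (\<epsilon> * Q)\<^sup>2))) * R z
        = (t - 1) * (t - q) * (- (1 / q)) * (Q * ((\<epsilon> / Q + \<epsilon> * Q) / (1 - q * (\<epsilon> * Q)\<^sup>2))) * R z"
      by (simp only: ac_simps)
    ultimately show ?thesis by (simp add: K_def)
  qed
  show ?thesis
  proof (rule that[of K])
    show "((\<lambda>\<tau>. (xratio h (?P \<tau>) a b - 1 / q) * coeff_a h t a (?P \<tau>)) \<longlongrightarrow> (t - 1) * K) (at 0)"
      using tendsto_mult[OF a R] unfolding A1 by (simp only: eq mult.assoc)
    show "((\<lambda>\<tau>. (xratio h (?P \<tau>) a b - 1 / q) * coeff_b h t a b (?P \<tau>)) \<longlongrightarrow> - \<epsilon> * ((t - 1) * K)) (at 0)"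
      using tendsto_mult[OF b R'] unfolding B1 by (simp only: eq' mult.assoc)
  qed
qed

subsection \<open>Regularity of \<open>D f\<close>\<close>

definition twisted_op :: "complex \<Rightarrow> (complex ^ 'n \<Rightarrow> complex) \<Rightarrow> complex ^ 'n \<Rightarrow> complex" where
  "twisted_op t f z = (\<Sum>i\<in>UNIV. coeff_a h t i z * f (z + axis i 2)) +
     (\<Sum>(i, j)\<in>off_diag. coeff_b h t i j z * f (z + (axis i 1 + axis j 1))) / 2"

lemma polar_twisted_op:
  assumes "ep h l A f" "hl_closed A"
  shows "polar l A (twisted_op t f)"
proof -
  have "polar l A (\<lambda>z. coeff_a h t i z * f (z + axis i 2))" for i
    using assms by (intro polar_mult[OF polar_coeff_a] polar_ep ep_shift)
  moreover have "polar l A (\<lambda>z. coeff_b h t (fst p) (snd p) z * f (z + (axis (fst p) 1 + axis (snd p) 1)))"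
    if "p \<in> off_diag" for p
    using assms that by (intro polar_mult[OF polar_coeff_b] polar_ep ep_shift) (auto simp: off_diag_def)
  ultimately have "polar l A (\<lambda>z. (\<Sum>i\<in>UNIV. coeff_a h t i z * f (z + axis i 2)) +
      (1 / 2) * (\<Sum>p\<in>off_diag. coeff_b h t (fst p) (snd p) z * f (z + (axis (fst p) 1 + axis (snd p) 1))))"
    using assms(2)
    by (intro polar_add polar_sum polar_mult[OF polar_ep[OF ep_const]]) auto
  then show ?thesis by (simp add: twisted_op_def[abs_def] case_prod_beta)
qed

lemma tendsto_twisted_op:
  fixes P :: "real \<Rightarrow> complex ^ 'n"
  assumes "\<And>i. ((\<lambda>\<tau>. r \<tau> * coeff_a h t i (P \<tau>)) \<longlongrightarrow> A i) F"
    and "\<And>i j. i \<noteq> j \<Longrightarrow> ((\<lambda>\<tau>. r \<tau> * coeff_b h t i j (P \<tau>)) \<longlongrightarrow> B i j) F"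
    and "\<And>w. ((\<lambda>\<tau>. f (P \<tau> + w)) \<longlongrightarrow> f (z + w)) F"
  shows "((\<lambda>\<tau>. r \<tau> * twisted_op t f (P \<tau>)) \<longlongrightarrow> (\<Sum>i\<in>UNIV. A i * f (z + axis i 2)) +
     (\<Sum>(i, j)\<in>off_diag. B i j * f (z + (axis i 1 + axis j 1))) / 2) F"
proof -
  have "((\<lambda>\<tau>. (\<Sum>i\<in>UNIV. (r \<tau> * coeff_a h t i (P \<tau>)) * f (P \<tau> + axis i 2)) +
     (\<Sum>p\<in>off_diag. (r \<tau> * coeff_b h t (fst p) (snd p) (P \<tau>)) * f (P \<tau> + (axis (fst p) 1 + axis (snd p) 1))) / 2)
     \<longlongrightarrow> (\<Sum>i\<in>UNIV. A i * f (z + axis i 2)) +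
     (\<Sum>p\<in>off_diag. B (fst p) (snd p) * f (z + (axis (fst p) 1 + axis (snd p) 1))) / 2) F"
    by (intro tendsto_add tendsto_divide tendsto_sum tendsto_mult[OF assms(1)] tendsto_mult[OF assms(2)] assms(3))
      (auto simp: off_diag_def)
  then show ?thesis
    by (simp add: twisted_op_def case_prod_beta distrib_left sum_distrib_left mult.assoc)
qed

lemma line_shift: "(z + \<tau> *\<^sub>R w) + v = (z + v) + \<tau> *\<^sub>R w" for z w v :: "complex ^ 'n"
  by (simp add: algebra_simps)

lemma root_dir_line: "z + \<tau> *\<^sub>R root_dir a b = z + axis a (of_real \<tau> / h) + axis b (- of_real \<tau> / h)"
  by (auto simp: vec_eq_iff root_dir_def axis_def) (auto simp: scaleR_conv_of_real)

lemma at_0_minus: "filterlim uminus (at 0) (at (0::real))"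
  by (auto simp: filterlim_at intro!: tendsto_eq_intros eventually_at_filter[THEN iffD2])

lemma tendsto_minus_at_0: "(f \<longlongrightarrow> L) (at (0::real)) \<Longrightarrow> ((\<lambda>\<tau>. f (- \<tau>)) \<longlongrightarrow> L) (at 0)"
  by (rule filterlim_compose[OF _ at_0_minus])

lemma half_ratio_sign:
  fixes z :: "complex ^ 'n"
  assumes "xratio h z a b = c\<^sup>2" "c \<noteq> 0"
  obtains \<epsilon> where "\<epsilon> \<in> {1, -1}" "xhalf_ratio h z a b = \<epsilon> * c"
proof -
  have "xhalf_ratio h z a b = c \<or> xhalf_ratio h z a b = - c"
    using assms(1) unfolding xhalf_ratio_square[symmetric] by (simp only: power2_eq_iff)
  then show ?thesis using that[of 1] that[of "-1"] by auto
qed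

lemma t_factor_m:
  assumes "t = 1 / q ^ m"
  shows "q ^ m * t = 1" "m = 0 \<Longrightarrow> t = 1" "m = 1 \<Longrightarrow> q * t = 1"
  using assms by auto

text \<open>The residues at \<open>x\<^sub>a = x\<^sub>b\<close> cancel in pairs exchanged by the reflection \<open>x\<^sub>a\<^sup>1\<^sup>/\<^sup>2 \<leftrightarrow> \<epsilon> x\<^sub>b\<^sup>1\<^sup>/\<^sup>2\<close>.\<close>

lemma twisted_op_residue_1:
  fixes z :: "complex ^ 'n"
  assumes t: "t = 1 / q ^ m" and f: "BA_conditions h m f" and cont: "continuous_on UNIV f"
    and ab: "a \<noteq> b" and gen: "generic_off a b {1, 1 / q} z" and X: "xratio h z a b = 1"
  shows "((\<lambda>\<tau>. (xratio h (z + \<tau> *\<^sub>R root_dir a b) a b - 1) * twisted_op t f (z + \<tau> *\<^sub>R root_dir a b)) \<longlongrightarrow> 0) (at 0)"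
proof -
  let ?P = "\<lambda>\<tau>. z + \<tau> *\<^sub>R root_dir a b"
  obtain \<epsilon> where \<epsilon>: "\<epsilon> \<in> {1, -1}" "xhalf_ratio h z a b = \<epsilon> * 1"
    by (rule half_ratio_sign[of z a b 1]) (use X in auto)
  then have half: "qpow h (z $ a / 2) = \<epsilon> * qpow h (z $ b / 2)"
    by (simp add: xhalf_ratio_def field_simps)
  have e2: "\<epsilon> * \<epsilon> = 1" using \<epsilon> by auto
  define r where "r \<tau> = xratio h (?P \<tau>) a b - 1" for \<tau>
  have r0: "(r \<longlongrightarrow> 0) (at 0)"
    unfolding r_def[abs_def] using tendsto_diff[OF tendsto_xratio_line[of z _ a b] tendsto_const[of 1]] X by simp
  \<comment> \<open>On this line x_a/x_b = exp(2\<tau>), so reversing \<tau> inverts the ratio. This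
    gives the reflected coefficient the opposite residue, up to its sign factor.\<close>
  have r_neg: "r \<tau> = - xratio h (?P \<tau>) a b * r (- \<tau>)" for \<tau>
  proof -
    have "xratio h (?P \<tau>) a b * xratio h (?P (- \<tau>)) a b = 1"
      unfolding xratio_line X by (simp flip: exp_add)
    then show ?thesis by (simp add: r_def algebra_simps)
  qed
  have swap_a: "coeff_a h t i (?P \<tau>) = coeff_a h t (swp a b i) (?P (- \<tau>))" for i \<tau>
    unfolding root_dir_line using coeff_swp(1)[OF ab \<epsilon>(1) half, of _ i "of_real \<tau> / h" "- of_real \<tau> / h"] by simp
  have swap_b: "coeff_b h t i j (?P \<tau>) = swp_sign a b \<epsilon> i * swp_sign a b \<epsilon> j * coeff_b h t (swp a b i) (swp a b j) (?P (- \<tau>))" for i j \<tau>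
    unfolding root_dir_line using coeff_swp(2)[OF ab \<epsilon>(1) half, of _ i j "of_real \<tau> / h" "- of_real \<tau> / h"] by simp
  have flip: "((\<lambda>\<tau>. r \<tau> * g (?P (- \<tau>))) \<longlongrightarrow> - L) (at 0)" if "((\<lambda>\<tau>. r \<tau> * g (?P \<tau>)) \<longlongrightarrow> L) (at 0)" for g L
  proof -
    have "((\<lambda>\<tau>. - xratio h (?P \<tau>) a b * (r (- \<tau>) * g (?P (- \<tau>)))) \<longlongrightarrow> - 1 * L) (at 0)"
      by (intro tendsto_mult tendsto_minus tendsto_xratio_line[of z _ a b, unfolded X] tendsto_minus_at_0[OF that])
    moreover have "r \<tau> * g (?P (- \<tau>)) = - xratio h (?P \<tau>) a b * (r (- \<tau>) * g (?P (- \<tau>)))" for \<tau>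
      by (subst r_neg) (simp only: mult.assoc)
    ultimately show ?thesis by (simp only: mult_minus1)
  qed
  obtain K where K: "((\<lambda>\<tau>. r \<tau> * coeff_a h t a (?P \<tau>)) \<longlongrightarrow> (1 - t) * (1 - q * t) * K) (at 0)"
    unfolding r_def by (rule residue_a_1[OF ab gen X])
  define La where "La = (1 - t) * (1 - q * t) * K"
  have "\<forall>l. \<exists>K. l \<noteq> a \<and> l \<noteq> b \<longrightarrow> ((\<lambda>\<tau>. r \<tau> * coeff_b h t a l (?P \<tau>)) \<longlongrightarrow> (t - 1) * K) (at 0)"
  proof
    fix l
    show "\<exists>K. l \<noteq> a \<and> l \<noteq> b \<longrightarrow> ((\<lambda>\<tau>. r \<tau> * coeff_b h t a l (?P \<tau>)) \<longlongrightarrow> (t - 1) * K) (at 0)"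
    proof (cases "l \<noteq> a \<and> l \<noteq> b")
      case True
      then obtain K where "((\<lambda>\<tau>. r \<tau> * coeff_b h t a l (?P \<tau>)) \<longlongrightarrow> (t - 1) * K) (at 0)"
        unfolding r_def by (elim conjE) (rule residue_b_1[OF ab gen X])
      then show ?thesis by blast
    qed blast
  qed
  from choice[OF this] obtain K' where K': "\<And>l. l \<noteq> a \<Longrightarrow> l \<noteq> b \<Longrightarrow> ((\<lambda>\<tau>. r \<tau> * coeff_b h t a l (?P \<tau>)) \<longlongrightarrow> (t - 1) * K' l) (at 0)"
    by blast
  define L where "L l = (t - 1) * K' l" for l
  define A where "A i = (if i = a then La else if i = b then - La else 0)" for i
  \<comment> \<open>Residues of T_a T_l and T_b T_l in both orders of the indices; T_a T_b itself
    has no pole at x_a = x_b.\<close>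
  define B where "B i j = (if i = a \<and> j \<noteq> b then L j else if i = b \<and> j \<noteq> a then - \<epsilon> * L j
      else if j = a \<and> i \<noteq> b then L i else if j = b \<and> i \<noteq> a then - \<epsilon> * L i else 0)" for i j
  have lim_a: "((\<lambda>\<tau>. r \<tau> * coeff_a h t i (?P \<tau>)) \<longlongrightarrow> A i) (at 0)" for i
  proof -
    consider "i = a" | "i = b" | "i \<noteq> a" "i \<noteq> b" by auto
    then show ?thesis
    proof cases
      case 1
      then show ?thesis using K by (simp add: A_def La_def)
    next
      case 2
      have "((\<lambda>\<tau>. r \<tau> * coeff_a h t b (?P \<tau>)) \<longlongrightarrow> - La) (at 0)"
        unfolding swap_a[of b] using flip[OF K] by (simp add: La_def)
      then show ?thesis using 2 ab by (simp add: A_def)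
    next
      case 3
      have "((\<lambda>\<tau>. r \<tau> * coeff_a h t i (?P \<tau>)) \<longlongrightarrow> 0 * coeff_a h t i z) (at 0)"
        by (intro tendsto_mult r0 tendsto_coeff_a) (use 3 gen in \<open>auto simp: generic_off_def doubleton_eq_iff\<close>)
      then show ?thesis using 3 by (simp add: A_def)
    qed
  qed
  have lim_b1: "((\<lambda>\<tau>. r \<tau> * coeff_b h t i j (?P \<tau>)) \<longlongrightarrow> B i j) (at 0)" if "i = a \<or> i = b" "j \<noteq> a" "j \<noteq> b" for i j
  proof (cases "i = a")
    case True
    then show ?thesis using K'[of j] that by (simp add: B_def L_def)
  next
    case False
    then have i: "i = b" using that by simp
    have "((\<lambda>\<tau>. \<epsilon> * (r \<tau> * coeff_b h t a j (?P (- \<tau>)))) \<longlongrightarrow> \<epsilon> * - L j) (at 0)"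
      by (intro tendsto_mult tendsto_const flip) (use K' that in \<open>simp add: L_def\<close>)
    moreover have "coeff_b h t b j (?P \<tau>) = \<epsilon> * coeff_b h t a j (?P (- \<tau>))" for \<tau>
      using swap_b[of b j \<tau>] that ab by (simp add: swp_sign_def transpose_apply_other)
    ultimately show ?thesis using i that ab by (simp add: B_def mult.left_commute)
  qed
  have B_comm: "B i j = B j i" if "i \<noteq> j" for i j using that ab by (auto simp: B_def)
  have lim_b: "((\<lambda>\<tau>. r \<tau> * coeff_b h t i j (?P \<tau>)) \<longlongrightarrow> B i j) (at 0)" if ij: "i \<noteq> j" for i j
  proof -
    consider "i = a \<or> i = b" "j \<noteq> a" "j \<noteq> b" | "j = a \<or> j = b" "i \<noteq> a" "i \<noteq> b"
      | "i \<noteq> a" "i \<noteq> b" "j \<noteq> a" "j \<noteq> b" | "{i, j} = {a, b}" using ij by auto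
    then show ?thesis
    proof cases
      case 1
      then show ?thesis by (rule lim_b1)
    next
      case 2
      then show ?thesis using lim_b1[of j i] B_comm[OF ij] coeff_b_commute[of t i j] by simp
    next
      case 3
      have "((\<lambda>\<tau>. r \<tau> * coeff_b h t i j (?P \<tau>)) \<longlongrightarrow> 0 * coeff_b h t i j z) (at 0)"
        by (intro tendsto_mult r0 tendsto_coeff_b) (use 3 ij gen in \<open>auto simp: generic_off_def doubleton_eq_iff\<close>)
      then show ?thesis using 3 by (simp add: B_def)
    next
      case 4
      have Xba: "xratio h z b a = 1" using X xratio_swap[of h z b a] by simp
      have "((\<lambda>\<tau>. r \<tau> * coeff_b h t i j (?P \<tau>)) \<longlongrightarrow> 0 * coeff_b h t i j z) (at 0)"
      proof (intro tendsto_mult r0 tendsto_coeff_b)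
        show "xratio h z i j \<noteq> 1 / q" "xratio h z j i \<noteq> 1 / q"
          using 4 X Xba by (auto simp only: doubleton_eq_iff q_neq)
        fix l assume l: "l \<noteq> i" "l \<noteq> j"
        then have "{i, l} \<noteq> {a, b}" "{j, l} \<noteq> {a, b}" using 4 by (auto simp: doubleton_eq_iff)
        then show "xratio h z i l \<noteq> 1 \<and> xratio h z j l \<noteq> 1"
          using generic_offD[OF gen, of i l 1] generic_offD[OF gen, of j l 1] l by auto
      qed
      moreover have "B i j = 0"
      proof -
        have "i = a \<and> j = b \<or> i = b \<and> j = a" using 4 by (simp only: doubleton_eq_iff)
        with ab show ?thesis unfolding B_def by (elim disjE conjE) simp_all
      qed
      ultimately show ?thesis by simp
    qed
  qed
  have "((\<lambda>\<tau>. r \<tau> * twisted_op t f (?P \<tau>)) \<longlongrightarrow> (\<Sum>i\<in>UNIV. A i * f (z + axis i 2)) +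
     (\<Sum>(i, j)\<in>off_diag. B i j * f (z + (axis i 1 + axis j 1))) / 2) (at 0)"
    by (intro tendsto_twisted_op lim_a lim_b) (simp_all add: line_shift continuous_line[OF cont])
  moreover have "(\<Sum>i\<in>UNIV. A i * f (z + axis i 2)) = 0"
  proof -
    have "(\<Sum>i\<in>UNIV. A i * f (z + axis i 2)) = (\<Sum>i\<in>{a, b}. A i * f (z + axis i 2))"
      by (rule sum.mono_neutral_right) (auto simp: A_def)
    also have "\<dots> = La * (f (z + axis a 2) - f (z + axis b 2))"
      using ab by (simp add: A_def algebra_simps)
    also have "\<dots> = 0"
    proof (cases "m \<ge> 2")
      case True
      then show ?thesis using BA_conditionsD[OF f ab \<epsilon>(1) half, of 2] e2 by (simp add: power2_eq_square)
    next
      case False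
      then consider "m = 0" | "m = 1" by linarith
      then have "La = 0" by cases (use t_factor_m[OF t] in \<open>auto simp: La_def\<close>)
      then show ?thesis by simp
    qed
    finally show ?thesis .
  qed
  moreover have "(\<Sum>(i, j)\<in>off_diag. B i j * f (z + (axis i 1 + axis j 1))) = 0"
  proof (rule sum_off_diag_swp_0[where a = a and b = b])
    fix i j :: 'n assume ij: "i \<noteq> j"
    have pair: "L l * (f (z + (axis a 1 + axis l 1)) - \<epsilon> * f (z + (axis b 1 + axis l 1))) = 0"
      if l: "l \<noteq> a" "l \<noteq> b" for l
    proof (cases "m = 0")
      case True
      then show ?thesis using t_factor_m[OF t] by (simp add: L_def)
    next
      case False
      have "f ((z + axis l 1) + axis a (of_nat 1)) = \<epsilon> ^ 1 * f ((z + axis l 1) + axis b (of_nat 1))"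
        by (rule BA_conditionsD[OF f ab \<epsilon>(1)]) (use half l False in \<open>auto simp: axis_def\<close>)
      then show ?thesis by (simp add: ac_simps)
    qed
    consider "i = a \<or> i = b" "j \<noteq> a" "j \<noteq> b" | "j = a \<or> j = b" "i \<noteq> a" "i \<noteq> b"
      | "i \<noteq> a" "i \<noteq> b" "j \<noteq> a" "j \<noteq> b" | "{i, j} = {a, b}" using ij by auto
    then show "B i j * f (z + (axis i 1 + axis j 1)) + B (swp a b i) (swp a b j) * f (z + (axis (swp a b i) 1 + axis (swp a b j) 1)) = 0"
    proof cases
      case 1
      then show ?thesis using pair[of j] ab by (auto simp: B_def transpose_apply_other algebra_simps)
    next
      case 2
      then show ?thesis using pair[of i] ab by (auto simp: B_def transpose_apply_other algebra_simps)
    next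
      case 3
      then show ?thesis by (simp add: B_def transpose_apply_other)
    next
      case 4
      then have "i = a \<and> j = b \<or> i = b \<and> j = a" by (simp only: doubleton_eq_iff)
      with ab show ?thesis unfolding B_def by (elim disjE conjE) simp_all
    qed
  qed
  ultimately show ?thesis by (simp add: r_def)
qed

text \<open>Only T_a^2 and T_a T_b have a pole on this wall. By the ratio of their residues, what
  must vanish is a multiple of f(z + 2e_a) - \<epsilon> f(z + e_a + e_b). This is the condition with
  \<open>j = 1\<close> at z + e_a, where x_a^(1/2) = \<epsilon> x_b^(1/2); for m = 0 the residues
  are 0.\<close>

lemma twisted_op_residue_q:
  fixes z :: "complex ^ 'n"
  assumes t: "t = 1 / q ^ m" and f: "BA_conditions h m f" and cont: "continuous_on UNIV f"
    and ab: "a \<noteq> b" and gen: "generic_off a b {1, 1 / q} z" and X: "xratio h z a b = 1 / q"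
  shows "((\<lambda>\<tau>. (xratio h (z + \<tau> *\<^sub>R root_dir a b) a b - 1 / q) * twisted_op t f (z + \<tau> *\<^sub>R root_dir a b)) \<longlongrightarrow> 0) (at 0)"
proof -
  let ?P = "\<lambda>\<tau>. z + \<tau> *\<^sub>R root_dir a b"
  have sq: "1 / q = (1 / Q)\<^sup>2" by (simp add: power_divide Q_square)
  obtain \<epsilon> where \<epsilon>: "\<epsilon> \<in> {1, -1}" "xhalf_ratio h z a b = \<epsilon> * (1 / Q)"
    by (rule half_ratio_sign[of z a b "1 / Q"]) (use X sq in auto)
  then have e: "xhalf_ratio h z a b = \<epsilon> / Q" by simp
  define r where "r \<tau> = xratio h (?P \<tau>) a b - 1 / q" for \<tau>
  have r0: "(r \<longlongrightarrow> 0) (at 0)"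
    unfolding r_def[abs_def] using tendsto_diff[OF tendsto_xratio_line[of z _ a b] tendsto_const[of "1 / q"]] X by simp
  obtain K where K: "((\<lambda>\<tau>. r \<tau> * coeff_a h t a (?P \<tau>)) \<longlongrightarrow> (t - 1) * K) (at 0)"
    "((\<lambda>\<tau>. r \<tau> * coeff_b h t a b (?P \<tau>)) \<longlongrightarrow> - \<epsilon> * ((t - 1) * K)) (at 0)"
    unfolding r_def by (rule residue_q[OF ab gen \<epsilon>(1) e])
  have Xba: "xratio h z b a = q" using X xratio_swap[of h z b a] by simp
  define A where "A i = (if i = a then (t - 1) * K else 0)" for i
  define B where "B i j = (if {i, j} = {a, b} then - \<epsilon> * ((t - 1) * K) else 0)" for i j
  have lim_a: "((\<lambda>\<tau>. r \<tau> * coeff_a h t i (?P \<tau>)) \<longlongrightarrow> A i) (at 0)" for i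
  proof (cases "i = a")
    case True
    then show ?thesis using K by (simp add: A_def)
  next
    case False
    have "((\<lambda>\<tau>. r \<tau> * coeff_a h t i (?P \<tau>)) \<longlongrightarrow> 0 * coeff_a h t i z) (at 0)"
    proof (intro tendsto_mult r0 tendsto_coeff_a)
      fix j assume "j \<noteq> i"
      then show "xratio h z i j \<notin> {1, 1 / q}"
        using False gen Xba by (cases "i = b \<and> j = a") (auto simp: generic_off_def doubleton_eq_iff)
    qed
    then show ?thesis using False by (simp add: A_def)
  qed
  have lim_b: "((\<lambda>\<tau>. r \<tau> * coeff_b h t i j (?P \<tau>)) \<longlongrightarrow> B i j) (at 0)" if ij: "i \<noteq> j" for i j
  proof (cases "{i, j} = {a, b}")
    case True
    then show ?thesis using K coeff_b_commute[of t b a] by (auto simp: B_def doubleton_eq_iff)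
  next
    case False
    have "((\<lambda>\<tau>. r \<tau> * coeff_b h t i j (?P \<tau>)) \<longlongrightarrow> 0 * coeff_b h t i j z) (at 0)"
    proof (intro tendsto_mult r0 tendsto_coeff_b)
      show "xratio h z i j \<noteq> 1 / q" "xratio h z j i \<noteq> 1 / q"
        using False ij gen by (auto simp: generic_off_def insert_commute)
      have "xratio h z k l \<noteq> 1" if "k \<noteq> l" for k l
      proof (cases "{k, l} = {a, b}")
        case True
        then show ?thesis using X Xba by (auto simp: doubleton_eq_iff)
      qed (use gen that in \<open>auto simp: generic_off_def\<close>)
      then show "xratio h z i l \<noteq> 1 \<and> xratio h z j l \<noteq> 1" if "l \<noteq> i" "l \<noteq> j" for l using that by auto
    qed
    then show ?thesis using False by (simp add: B_def)
  qed
  have lim: "((\<lambda>\<tau>. r \<tau> * twisted_op t f (?P \<tau>)) \<longlongrightarrow> (\<Sum>i\<in>UNIV. A i * f (z + axis i 2)) +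
     (\<Sum>(i, j)\<in>off_diag. B i j * f (z + (axis i 1 + axis j 1))) / 2) (at 0)"
    by (intro tendsto_twisted_op lim_a lim_b) (simp_all add: line_shift continuous_line[OF cont])
  have sum_a: "(\<Sum>i\<in>UNIV. A i * f (z + axis i 2)) = (t - 1) * K * f (z + axis a 2)"
    by (simp add: A_def if_distrib[of "\<lambda>x. x * _"] cong: if_cong)
  have "(\<Sum>(i, j)\<in>off_diag. B i j * f (z + (axis i 1 + axis j 1)))
      = (\<Sum>(i, j)\<in>{(a, b), (b, a)}. - \<epsilon> * ((t - 1) * K) * f (z + (axis i 1 + axis j 1)))"
    using ab by (intro sum.mono_neutral_cong_right) (auto simp: B_def off_diag_def doubleton_eq_iff split: if_splits)
  also have "\<dots> = 2 * (- \<epsilon> * ((t - 1) * K) * f (z + (axis a 1 + axis b 1)))"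
    using ab by (simp add: add.commute[of "axis a 1"])
  finally have sum_b: "(\<Sum>(i, j)\<in>off_diag. B i j * f (z + (axis i 1 + axis j 1)))
      = 2 * (- \<epsilon> * ((t - 1) * K) * f (z + (axis a 1 + axis b 1)))" .
  have "(t - 1) * K * f (z + axis a 2) - \<epsilon> * ((t - 1) * K) * f (z + (axis a 1 + axis b 1)) = 0"
  proof (cases "m = 0")
    case True
    then show ?thesis using t by simp
  next
    case False
    have "f ((z + axis a 1) + axis a (of_nat 1)) = \<epsilon> ^ 1 * f ((z + axis a 1) + axis b (of_nat 1))"
    proof (rule BA_conditionsD[OF f ab \<epsilon>(1)])
      have "qpow h (z $ a / 2) * Q = \<epsilon> * qpow h (z $ b / 2)"
        using e by (simp add: xhalf_ratio_def field_simps)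
      then show "qpow h ((z + axis a 1) $ a / 2) = \<epsilon> * qpow h ((z + axis a 1) $ b / 2)"
        using ab by (simp add: axis_def add_divide_distrib qpow_add Q_def)
    qed (use False in simp)
    moreover have "axis a 1 + axis a 1 = (axis a 2 :: complex ^ 'n)" by (simp add: axis_def vec_eq_iff)
    ultimately show ?thesis by (simp add: add.assoc)
  qed
  then have "(t - 1) * K * f (z + axis a 2) + 2 * (- \<epsilon> * ((t - 1) * K) * f (z + (axis a 1 + axis b 1))) / 2 = 0"
    by simp
  with lim show ?thesis unfolding sum_a sum_b by (simp only: r_def)
qed

lemma twisted_op_regular:
  assumes "t = 1 / q ^ m" "BA_conditions h m f" "ep h l A f" "hl_closed A"
  obtains G where "ep h l A G" "\<And>z. regular_point z \<Longrightarrow> twisted_op t f z = G z"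
proof (rule polar_regularize[OF polar_twisted_op[OF assms(3,4), of t] assms(4)])
  fix a b \<zeta> and z :: "complex ^ 'a"
  assume "a \<noteq> b" "\<zeta> \<in> {1, 1 / q}" "generic_off a b {1, 1 / q} z" "xratio h z a b = \<zeta>"
  then show "((\<lambda>\<tau>. (xratio h (z + \<tau> *\<^sub>R root_dir a b) a b - \<zeta>) * twisted_op t f (z + \<tau> *\<^sub>R root_dir a b)) \<longlongrightarrow> 0) (at 0)"
    using twisted_op_residue_1[OF assms(1,2) ep_continuous[OF assms(3)]]
      twisted_op_residue_q[OF assms(1,2) ep_continuous[OF assms(3)]] by auto
qed (rule that)

end

subsection \<open>The conditions for \<open>D f\<close>\<close>

lemma axis_plus: "axis a x + axis a y = (axis a (x + y) :: complex ^ 'n)"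
  by (simp add: axis_def vec_eq_iff)

lemma bil_scaleR_right: "bil u (\<tau> *\<^sub>R w) = complex_of_real \<tau> * bil u w"
  by (simp add: bil_def sum_distrib_left scaleR_conv_of_real[where 'a = complex] ac_simps)

lemma exp_difference_quotient:
  "((\<lambda>\<tau>. (exp (complex_of_real \<tau> * k) - 1) / complex_of_real \<tau>) \<longlongrightarrow> k) (at 0)"
proof -
  have "((\<lambda>s. exp (s * k)) has_field_derivative k) (at 0)"
    by (auto intro!: derivative_eq_intros)
  then have "((\<lambda>s. (exp (s * k) - 1) / s) \<longlongrightarrow> k) (at (0::complex))"
    unfolding DERIV_def by simp
  moreover have "filterlim complex_of_real (at 0) (at 0)"
    by (auto simp: filterlim_at intro!: tendsto_eq_intros eventually_at_filter[THEN iffD2])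
  ultimately show ?thesis by (rule filterlim_compose)
qed

text \<open>Needed where a simple pole of a coefficient meets a bracket that vanishes to first
  order.\<close>

lemma ep_line_derivative:
  assumes "ep h l A f"
  shows "\<exists>d. ((\<lambda>\<tau>. (f (z + \<tau> *\<^sub>R w) - f z) / complex_of_real \<tau>) \<longlongrightarrow> d) (at 0)"
proof -
  obtain S c where *: "finite S" "S \<subseteq> A" "f = esum h l S c" using assms by (rule epE)
  define k where "k v = h * (bil l w / 2 + bil (cvec v) w)" for v
  have eq: "(f (z + \<tau> *\<^sub>R w) - f z) / complex_of_real \<tau>
      = (\<Sum>v\<in>S. c v * echar h l v z * ((exp (complex_of_real \<tau> * k v) - 1) / complex_of_real \<tau>))" for \<tau>
  proof -
    have "echar h l v (z + \<tau> *\<^sub>R w) = echar h l v z * exp (complex_of_real \<tau> * k v)" for v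
      unfolding echar_add_right by (simp add: echar_def qpow_def bil_scaleR_right k_def algebra_simps)
    then show ?thesis
      by (simp add: * esum_def sum_divide_distrib algebra_simps diff_divide_distrib flip: sum_subtractf)
  qed
  show ?thesis unfolding eq
    by (intro exI[of _ "\<Sum>v\<in>S. c v * echar h l v z * k v"]
      tendsto_sum tendsto_mult tendsto_const exp_difference_quotient)
qed

context generic_q
begin

text \<open>D f at the mirror point \<open>P'\<close> is written with the coefficients at
  \<open>P\<close>. In the difference of the two values every coefficient then multiplies a bracket
  of two values of \<open>f\<close>, to which the conditions can be applied.\<close>

lemma twisted_op_swp:
  fixes z :: "complex ^ 'n" and x y :: complex
  assumes "a \<noteq> b" "\<epsilon> \<in> {1, -1}" "qpow h (z $ a / 2) = \<epsilon> * qpow h (z $ b / 2)"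
  defines "P \<equiv> z + axis a x + axis b y" and "P' \<equiv> z + axis a y + axis b x"
  shows "twisted_op t f P' = (\<Sum>i\<in>UNIV. coeff_a h t i P * f (P' + axis (swp a b i) 2)) +
     (\<Sum>(i, j)\<in>off_diag. coeff_b h t i j P *
       (swp_sign a b \<epsilon> i * swp_sign a b \<epsilon> j * f (P' + (axis (swp a b i) 1 + axis (swp a b j) 1)))) / 2"
proof -
  have sgn: "swp_sign a b \<epsilon> (swp a b i) = swp_sign a b \<epsilon> i" for i
    by (auto simp: swp_sign_def Transposition.transpose_def)
  have cov_a: "coeff_a h t i P' = coeff_a h t (swp a b i) P" for i
    unfolding P_def P'_def by (rule coeff_swp(1)[OF assms(1-3)])
  have cov_b: "coeff_b h t i j P' = swp_sign a b \<epsilon> i * swp_sign a b \<epsilon> j * coeff_b h t (swp a b i) (swp a b j) P" for i j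
    unfolding P_def P'_def by (rule coeff_swp(2)[OF assms(1-3)])
  have 1: "(\<Sum>i\<in>UNIV. coeff_a h t i P' * f (P' + axis i 2)) = (\<Sum>i\<in>UNIV. coeff_a h t i P * f (P' + axis (swp a b i) 2))"
    using sum_swp[of "\<lambda>i. coeff_a h t i P * f (P' + axis (swp a b i) 2)" a b]
    by (simp only: cov_a transpose_involutory)
  have 2: "(\<Sum>(i, j)\<in>off_diag. coeff_b h t i j P' * f (P' + (axis i 1 + axis j 1)))
     = (\<Sum>(i, j)\<in>off_diag. coeff_b h t i j P *
       (swp_sign a b \<epsilon> i * swp_sign a b \<epsilon> j * f (P' + (axis (swp a b i) 1 + axis (swp a b j) 1))))"
    using sum_off_diag_swp[of "\<lambda>i j. coeff_b h t i j P *
       (swp_sign a b \<epsilon> i * swp_sign a b \<epsilon> j * f (P' + (axis (swp a b i) 1 + axis (swp a b j) 1)))" a b]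
    by (simp only: cov_b sgn transpose_involutory ac_simps)
  show ?thesis unfolding twisted_op_def 1 2 ..
qed

lemma coeff_a_zero:
  "j \<noteq> i \<Longrightarrow> pair_a t (xratio h z i j) = 0 \<Longrightarrow> coeff_a h t i z = 0"
  unfolding coeff_a_eq by (auto intro!: prod_zero)

lemma coeff_b_zero:
  "l \<noteq> i \<Longrightarrow> l \<noteq> j \<Longrightarrow> pair_c t (xratio h z i l) = 0 \<Longrightarrow> coeff_b h t i j z = 0"
  unfolding coeff_b_eq by (auto intro!: prod_zero)

text \<open>The only coefficients singular at \<open>z + j e\<^sub>a\<close> are those of \<open>T\<^sub>b\<^sup>2\<close> and \<open>T\<^sub>a T\<^sub>b\<close> for \<open>j = 1\<close>. The brackets
  they multiply are \<open>- \<epsilon> \<phi>(-\<tau>)\<close> and \<open>\<phi>(\<tau>)\<close> with \<open>\<phi>(0) = 0\<close>, and their residues have ratio \<open>- \<epsilon>\<close>.\<close>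

lemma twisted_op_singular_pair:
  fixes z :: "complex ^ 'n"
  assumes ab: "a \<noteq> b" and \<epsilon>: "\<epsilon> \<in> {1, -1}" and half: "qpow h (z $ a / 2) = \<epsilon> * qpow h (z $ b / 2)"
    and f: "ep h l A f" and gen: "generic_off a b {1, 1 / q} (z + axis a 1)"
    and f0: "f (z + axis a 1 + axis b 1 + axis a 1) = \<epsilon> * f (z + axis a 1 + axis b 1 + axis b 1)"
  defines "P \<equiv> \<lambda>\<tau>. (z + axis a 1) + \<tau> *\<^sub>R root_dir a b" and "P' \<equiv> \<lambda>\<tau>. (z + axis b 1) + (- \<tau>) *\<^sub>R root_dir a b"
  shows "((\<lambda>\<tau>. coeff_a h t b (P \<tau>) * (f (P \<tau> + axis b 2) - \<epsilon> * f (P' \<tau> + axis a 2)) +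
    coeff_b h t a b (P \<tau>) * (f (P \<tau> + (axis a 1 + axis b 1)) - \<epsilon> * f (P' \<tau> + (axis b 1 + axis a 1)))) \<longlongrightarrow> 0) (at 0)"
proof -
  have e2: "\<epsilon> * \<epsilon> = 1" using \<epsilon> by auto
  \<comment> \<open>All four shifted points lie near y + e_a or y + e_b, so both brackets come from
    one function \<phi>.\<close>
  define y where "y = z + axis a 1 + axis b 1"
  define \<phi> where "\<phi> \<tau> = f (y + axis a 1 + \<tau> *\<^sub>R root_dir a b) - \<epsilon> * f (y + axis b 1 + (- \<tau>) *\<^sub>R root_dir a b)" for \<tau>
  have ax: "axis c 2 = axis c 1 + (axis c 1 :: complex ^ 'n)" for c by (simp add: axis_plus)
  have B1: "f (P \<tau> + (axis a 1 + axis b 1)) - \<epsilon> * f (P' \<tau> + (axis b 1 + axis a 1)) = \<phi> \<tau>" for \<tau>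
  proof -
    have "P \<tau> + (axis a 1 + axis b 1) = y + axis a 1 + \<tau> *\<^sub>R root_dir a b"
      "P' \<tau> + (axis b 1 + axis a 1) = y + axis b 1 + (- \<tau>) *\<^sub>R root_dir a b"
      by (simp_all add: P_def P'_def y_def algebra_simps)
    then show ?thesis by (simp only: \<phi>_def)
  qed
  have B2: "f (P \<tau> + axis b 2) - \<epsilon> * f (P' \<tau> + axis a 2) = - \<epsilon> * \<phi> (- \<tau>)" for \<tau>
  proof -
    have "P \<tau> + axis b 2 = y + axis b 1 + \<tau> *\<^sub>R root_dir a b"
      "P' \<tau> + axis a 2 = y + axis a 1 + (- \<tau>) *\<^sub>R root_dir a b"
      by (simp_all add: P_def P'_def y_def ax algebra_simps)
    moreover have "- \<epsilon> * (u - \<epsilon> * v) = v - \<epsilon> * u" for u v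
      using e2 by (simp add: right_diff_distrib flip: mult.assoc)
    ultimately show ?thesis by (simp add: \<phi>_def)
  qed
  have \<phi>0: "\<phi> 0 = 0" using f0 by (simp add: \<phi>_def y_def)
  obtain d1 where d1: "((\<lambda>\<tau>. (f (y + axis a 1 + \<tau> *\<^sub>R root_dir a b) - f (y + axis a 1)) / complex_of_real \<tau>) \<longlongrightarrow> d1) (at 0)"
    using ep_line_derivative[OF f] by blast
  obtain d2 where d2: "((\<lambda>\<tau>. (f (y + axis b 1 + \<tau> *\<^sub>R root_dir a b) - f (y + axis b 1)) / complex_of_real \<tau>) \<longlongrightarrow> d2) (at 0)"
    using ep_line_derivative[OF f] by blast
  define d where "d = d1 + \<epsilon> * d2"
  have d: "((\<lambda>\<tau>. \<phi> \<tau> / complex_of_real \<tau>) \<longlongrightarrow> d) (at 0)"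
  proof -
    have "((\<lambda>\<tau>. (f (y + axis a 1 + \<tau> *\<^sub>R root_dir a b) - f (y + axis a 1)) / complex_of_real \<tau> +
      \<epsilon> * ((f (y + axis b 1 + (- \<tau>) *\<^sub>R root_dir a b) - f (y + axis b 1)) / complex_of_real (- \<tau>))) \<longlongrightarrow> d1 + \<epsilon> * d2) (at 0)"
      by (intro tendsto_add tendsto_mult d1 tendsto_const tendsto_minus_at_0[OF d2])
    moreover have "\<phi> \<tau> / complex_of_real \<tau> = (f (y + axis a 1 + \<tau> *\<^sub>R root_dir a b) - f (y + axis a 1)) / complex_of_real \<tau> +
      \<epsilon> * ((f (y + axis b 1 + (- \<tau>) *\<^sub>R root_dir a b) - f (y + axis b 1)) / complex_of_real (- \<tau>))" for \<tau>
    proof -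
      have "\<phi> \<tau> = (f (y + axis a 1 + \<tau> *\<^sub>R root_dir a b) - f (y + axis a 1))
          - \<epsilon> * (f (y + axis b 1 + (- \<tau>) *\<^sub>R root_dir a b) - f (y + axis b 1))"
        using \<phi>0 by (simp add: \<phi>_def algebra_simps)
      moreover have "(u - \<epsilon> * v) / complex_of_real \<tau> = u / complex_of_real \<tau> + \<epsilon> * (v / complex_of_real (- \<tau>))" for u v
        by (simp add: diff_divide_distrib)
      ultimately show ?thesis by (simp only:)
    qed
    ultimately show ?thesis by (simp add: d_def)
  qed
  have d': "((\<lambda>\<tau>. - \<epsilon> * \<phi> (- \<tau>) / complex_of_real \<tau>) \<longlongrightarrow> \<epsilon> * d) (at 0)"
    using tendsto_mult[OF tendsto_const[of \<epsilon>] tendsto_minus_at_0[OF d]] by simp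
  have Xab: "xratio h z a b = 1"
    unfolding xhalf_ratio_square[symmetric] using half e2 by (simp add: xhalf_ratio_def power2_eq_square)
  have r1: "xhalf_ratio h (z + axis a 1) b a = \<epsilon> / Q"
  proof -
    have "qpow h ((z + axis a 1) $ a / 2) = qpow h (z $ a / 2) * Q" "(z + axis a 1) $ b = z $ b"
      using ab by (simp_all add: axis_def add_divide_distrib qpow_add Q_def)
    then show ?thesis using half e2 \<epsilon> by (auto simp: xhalf_ratio_def)
  qed
  have gen': "generic_off b a {1, 1 / q} (z + axis a 1)"
    using gen by (simp add: generic_off_def insert_commute)
  define r where "r \<tau> = xratio h (P \<tau>) b a - 1 / q" for \<tau>
  \<comment> \<open>At z + e_a the ratio x_b/x_a equals 1/q, so \<open>residue_q\<close> is applied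
    with \<open>a\<close> and \<open>b\<close> exchanged and the line is then run backwards.\<close>
  have P_ba: "P \<tau> = (z + axis a 1) + (- \<tau>) *\<^sub>R root_dir b a" for \<tau>
    by (simp add: P_def root_dir_def algebra_simps)
  obtain K where K: "((\<lambda>\<tau>. r \<tau> * coeff_a h t b (P \<tau>)) \<longlongrightarrow> (t - 1) * K) (at 0)"
      "((\<lambda>\<tau>. r \<tau> * coeff_b h t b a (P \<tau>)) \<longlongrightarrow> - \<epsilon> * ((t - 1) * K)) (at 0)"
  proof (rule residue_q[OF ab[symmetric] gen' \<epsilon> r1, where t = t])
    fix K assume *: "((\<lambda>\<tau>. (xratio h (z + axis a 1 + \<tau> *\<^sub>R root_dir b a) b a - 1 / q) * coeff_a h t b (z + axis a 1 + \<tau> *\<^sub>R root_dir b a)) \<longlongrightarrow> (t - 1) * K) (at 0)"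
      "((\<lambda>\<tau>. (xratio h (z + axis a 1 + \<tau> *\<^sub>R root_dir b a) b a - 1 / q) * coeff_b h t b a (z + axis a 1 + \<tau> *\<^sub>R root_dir b a)) \<longlongrightarrow> - \<epsilon> * ((t - 1) * K)) (at 0)"
    show thesis
      using that[of K] tendsto_minus_at_0[OF *(1)] tendsto_minus_at_0[OF *(2)] unfolding r_def P_ba by simp
  qed
  have Xz1: "xratio h (z + axis a 1) b a = 1 / q"
    unfolding xhalf_ratio_square[symmetric] r1 using e2 by (simp add: power_divide power2_eq_square[of \<epsilon>] Q_square)
  have r_eq: "r \<tau> = (1 / q) * (exp (complex_of_real \<tau> * - 2) - 1)" for \<tau>
  proof -
    have hd: "h * (root_dir a b $ b - root_dir a b $ a) = - 2" using ab by (simp add: root_dir_def axis_def)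
    show ?thesis unfolding r_def P_def xratio_line Xz1 hd by (simp add: algebra_simps)
  qed
  have "((\<lambda>\<tau>. r \<tau> / complex_of_real \<tau>) \<longlongrightarrow> (1 / q) * - 2) (at 0)"
    unfolding r_eq times_divide_eq_right[symmetric] by (intro tendsto_mult tendsto_const exp_difference_quotient)
  then have rinv: "((\<lambda>\<tau>. 1 / (r \<tau> / complex_of_real \<tau>)) \<longlongrightarrow> 1 / ((1 / q) * - 2)) (at 0)"
    by (intro tendsto_divide tendsto_const) simp_all
  \<comment> \<open>Both terms are written as residue times difference quotient, divided by the
    quotient of \<open>r\<close> and \<tau>. The slopes are \<epsilon> d and d, the residues are in
    the ratio -\<epsilon>, and the limits cancel.\<close>
  have "((\<lambda>\<tau>. (r \<tau> * coeff_a h t b (P \<tau>)) * (- \<epsilon> * \<phi> (- \<tau>) / complex_of_real \<tau>) * (1 / (r \<tau> / complex_of_real \<tau>)) +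
      (r \<tau> * coeff_b h t b a (P \<tau>)) * (\<phi> \<tau> / complex_of_real \<tau>) * (1 / (r \<tau> / complex_of_real \<tau>)))
      \<longlongrightarrow> ((t - 1) * K) * (\<epsilon> * d) * (1 / ((1 / q) * - 2)) + (- \<epsilon> * ((t - 1) * K)) * d * (1 / ((1 / q) * - 2))) (at 0)"
    by (intro tendsto_add tendsto_mult K d d' rinv)
  then have lim: "((\<lambda>\<tau>. (r \<tau> * coeff_a h t b (P \<tau>)) * (- \<epsilon> * \<phi> (- \<tau>) / complex_of_real \<tau>) * (1 / (r \<tau> / complex_of_real \<tau>)) +
      (r \<tau> * coeff_b h t b a (P \<tau>)) * (\<phi> \<tau> / complex_of_real \<tau>) * (1 / (r \<tau> / complex_of_real \<tau>))) \<longlongrightarrow> 0) (at 0)"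
    by (simp add: algebra_simps)
  have ev0: "eventually (\<lambda>\<tau>. \<tau> \<noteq> (0::real)) (at 0)" by (simp add: eventually_at_filter)
  have evr: "eventually (\<lambda>\<tau>. r \<tau> \<noteq> 0) (at 0)"
  proof -
    have "eventually (\<lambda>\<tau>. 1 * exp (complex_of_real (\<tau> * - 2)) \<noteq> 1) (at 0)"
      by (rule eventually_exp_neq) auto
    then show ?thesis by eventually_elim (simp add: r_eq)
  qed
  show ?thesis
  proof (rule Lim_transform_eventually[OF lim])
    show "eventually (\<lambda>\<tau>. (r \<tau> * coeff_a h t b (P \<tau>)) * (- \<epsilon> * \<phi> (- \<tau>) / complex_of_real \<tau>) * (1 / (r \<tau> / complex_of_real \<tau>)) +
      (r \<tau> * coeff_b h t b a (P \<tau>)) * (\<phi> \<tau> / complex_of_real \<tau>) * (1 / (r \<tau> / complex_of_real \<tau>))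
      = coeff_a h t b (P \<tau>) * (f (P \<tau> + axis b 2) - \<epsilon> * f (P' \<tau> + axis a 2)) +
    coeff_b h t a b (P \<tau>) * (f (P \<tau> + (axis a 1 + axis b 1)) - \<epsilon> * f (P' \<tau> + (axis b 1 + axis a 1)))) (at 0)"
      using ev0 evr
    proof eventually_elim
      case (elim \<tau>)
      have "(r \<tau> * u) * (v / complex_of_real \<tau>) * (1 / (r \<tau> / complex_of_real \<tau>)) = u * v" for u v
        using elim by simp
      then show ?case unfolding B1 B2 coeff_b_commute[of t a b] by simp
    qed
  qed
qed

text \<open>The brackets at \<tau> = 0 are conditions on \<open>f\<close> with shifts between j - 2
  and j + 2. When the shift exceeds \<open>m\<close>, the coefficient vanishes instead, because
  x_a/x_b = q^j at z + j e_a and t = q^(-m). For \<open>j = 1\<close> the terms of T_b^2 and T_a T_b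
  are singular and are treated together.\<close>

lemma twisted_op_conditions_generic:
  fixes f G :: "complex ^ 'n \<Rightarrow> complex"
  assumes t: "t = 1 / q ^ m" and f: "BA_conditions h m f" and ep_f: "ep h l A f" and ep_G: "ep h l' B G"
    and G: "\<And>z. regular_point z \<Longrightarrow> twisted_op t f z = G z"
    and j: "j \<in> {1..m}" and ab: "a \<noteq> b" and \<epsilon>: "\<epsilon> \<in> {1, -1}"
    and half: "qpow h (z $ a / 2) = \<epsilon> * qpow h (z $ b / 2)"
    and gen1: "generic_off a b {1, 1 / q} (z + axis a (of_nat j))"
    and gen2: "generic_off a b {1, 1 / q} (z + axis b (of_nat j))"
  shows "G (z + axis a (of_nat j)) = \<epsilon> ^ j * G (z + axis b (of_nat j))"
proof -
  define z1 where "z1 = z + axis a (of_nat j)"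
  define z2 where "z2 = z + axis b (of_nat j)"
  define P where "P \<tau> = z1 + \<tau> *\<^sub>R root_dir a b" for \<tau>
  define P' where "P' \<tau> = z2 + (- \<tau>) *\<^sub>R root_dir a b" for \<tau>
  have e2: "\<epsilon> * \<epsilon> = 1" using \<epsilon> by auto
  have j1: "j \<ge> 1" "j \<le> m" using j by auto
  have X: "xratio h z a b = 1"
    unfolding xhalf_ratio_square[symmetric] using half e2 by (simp add: xhalf_ratio_def power2_eq_square)
  have Xab: "xratio h z1 a b = q ^ j" unfolding z1_def xratio_add X using ab by (simp add: axis_def qpow_of_nat)
  then have Xba: "xratio h z1 b a = 1 / q ^ j" using xratio_swap[of h z1 b a] by simp
  have qj: "q ^ j \<noteq> 1" using q_power_inject[of j 0] j1 by simp
  have Xab': "xratio h z1 a b \<notin> {1, 1 / q}"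
  proof -
    have "q ^ Suc j \<noteq> 1" using q_power_inject[of "Suc j" 0] by simp
    then show ?thesis using qj by (auto simp: Xab field_simps)
  qed
  have Xba1: "xratio h z1 b a \<noteq> 1" using qj by (simp add: Xba)
  have Xba': "xratio h z1 b a \<noteq> 1 / q" if "j \<noteq> 1"
    using that q_power_inject[of j 1] by (simp add: Xba)
  have X1: "xratio h z1 k i \<noteq> 1" if "k \<noteq> i" for k i
  proof (cases "{k, i} = {a, b}")
    case True
    then have "k = a \<and> i = b \<or> k = b \<and> i = a" by (simp only: doubleton_eq_iff)
    then show ?thesis using Xab' Xba1 by auto
  next
    case False
    then show ?thesis using generic_offD[OF gen1 that, of 1] by (simp add: z1_def)
  qed
  have Xq: "xratio h z1 k i \<noteq> 1 / q" if "k \<noteq> i" "(k, i) \<noteq> (b, a)" for k i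
  proof (cases "{k, i} = {a, b}")
    case True
    then have "k = a \<and> i = b \<or> k = b \<and> i = a" by (simp only: doubleton_eq_iff)
    then show ?thesis using Xab' that by auto
  next
    case False
    then show ?thesis using generic_offD[OF gen1 that(1), of "1 / q"] by (simp add: z1_def)
  qed
  have Xq': "xratio h z1 k i \<noteq> 1 / q" if "k \<noteq> i" "(k, i) \<noteq> (b, a) \<or> j \<noteq> 1" for k i
    using Xq[OF that(1)] Xba' that(2) by (cases "(k, i) = (b, a)") auto
  have bc: "f (z + w + axis a (of_nat k)) = \<epsilon> ^ k * f (z + w + axis b (of_nat k))"
    if "w $ a = w $ b" "k \<le> m" for w k
    by (rule BA_conditionsD[OF f ab \<epsilon> _ that(2)]) (simp add: add_divide_distrib qpow_add half that)
  define Fa where "Fa i \<tau> = f (P \<tau> + axis i 2) - \<epsilon> ^ j * f (P' \<tau> + axis (swp a b i) 2)" for i \<tau>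
  define Fb where "Fb i k \<tau> = f (P \<tau> + (axis i 1 + axis k 1)) -
    \<epsilon> ^ j * (swp_sign a b \<epsilon> i * swp_sign a b \<epsilon> k * f (P' \<tau> + (axis (swp a b i) 1 + axis (swp a b k) 1)))" for i k \<tau>
  have cont: "continuous_on UNIV f" by (rule ep_continuous[OF ep_f])
  have P0: "((\<lambda>\<tau>. f (P \<tau> + w)) \<longlongrightarrow> f (z1 + w)) (at 0)" for w
    unfolding P_def line_shift by (rule continuous_line[OF cont])
  have P'0: "((\<lambda>\<tau>. f (P' \<tau> + w)) \<longlongrightarrow> f (z2 + w)) (at 0)" for w
    unfolding P'_def line_shift by (rule tendsto_minus_at_0[OF continuous_line[OF cont]])
  have Fa: "(Fa i \<longlongrightarrow> Fa i 0) (at 0)" for i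
    unfolding Fa_def[abs_def] by (intro tendsto_diff tendsto_mult tendsto_const)
      (use P0 P'0 in \<open>simp_all add: P_def P'_def\<close>)
  have Fb: "(Fb i k \<longlongrightarrow> Fb i k 0) (at 0)" for i k
    unfolding Fb_def[abs_def] by (intro tendsto_diff tendsto_mult tendsto_const)
      (use P0 P'0 in \<open>simp_all add: P_def P'_def\<close>)
  have ax2: "axis c 2 = axis c 1 + (axis c 1 :: complex ^ 'n)" for c by (simp add: axis_plus)
  have axj: "axis c (of_nat (Suc k)) = axis c (of_nat k) + (axis c 1 :: complex ^ 'n)" for c k
    by (simp add: axis_plus add.commute)
  have lim_a: "((\<lambda>\<tau>. coeff_a h t i (P \<tau>)) \<longlongrightarrow> coeff_a h t i z1) (at 0)" if "i \<noteq> b \<or> j \<noteq> 1" for i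
    unfolding P_def
  proof (rule tendsto_coeff_a)
    fix k assume "k \<noteq> i"
    then show "xratio h z1 i k \<notin> {1, 1 / q}" using X1[of i k] Xq'[of i k] that by auto
  qed
  have lim_b: "((\<lambda>\<tau>. coeff_b h t i k (P \<tau>)) \<longlongrightarrow> coeff_b h t i k z1) (at 0)"
    if "i \<noteq> k" "{i, k} \<noteq> {a, b} \<or> j \<noteq> 1" for i k
    unfolding P_def
  proof (rule tendsto_coeff_b)
    have "(i, k) \<noteq> (b, a) \<or> j \<noteq> 1" "(k, i) \<noteq> (b, a) \<or> j \<noteq> 1" using that(2) by auto
    then show "xratio h z1 i k \<noteq> 1 / q" "xratio h z1 k i \<noteq> 1 / q" using Xq'[of i k] Xq'[of k i] that(1) by blast+
    fix l assume "l \<noteq> i" "l \<noteq> k"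
    then show "xratio h z1 i l \<noteq> 1 \<and> xratio h z1 k l \<noteq> 1" using X1[of i l] X1[of k l] by simp
  qed
  have qt: "q ^ m * t = 1" using t by simp
  have term_a: "((\<lambda>\<tau>. coeff_a h t i (P \<tau>) * Fa i \<tau>) \<longlongrightarrow> 0) (at 0)" if i: "i \<noteq> b \<or> j \<noteq> 1" for i
  proof -
    have "coeff_a h t i z1 * Fa i 0 = 0"
    proof -
      consider "i = a" "j + 2 \<le> m" | "i = a" "m < j + 2" | "i = b" "j \<ge> 2" | "i \<noteq> a" "i \<noteq> b"
        using i j1 by linarith
      then show ?thesis
      proof cases
        case 1
        have "f (z1 + axis a 2) = \<epsilon> ^ j * f (z2 + axis b 2)"
        proof -
          have "z + 0 + axis c (of_nat (j + 2)) = z + axis c (of_nat j) + axis c 2" for c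
            by (simp add: add.assoc axis_plus add.commute)
          moreover have "\<epsilon> ^ (j + 2) = \<epsilon> ^ j" using e2 by (simp add: power_add power2_eq_square)
          ultimately show ?thesis
            using bc[of 0 "j + 2"] 1(2)
            by (simp only: z1_def z2_def zero_index simp_thms True_implies_equals)
        qed
        then show ?thesis using 1 ab by (simp add: Fa_def P_def P'_def)
      next
        case 2
        \<comment> \<open>The two numerator factors 1 - t x and 1 - q t x of \<open>coeff_a\<close>,
          at x = q^j, cover these two values of \<open>m\<close>.\<close>
        then have "m = j \<or> m = Suc j" using j1 by linarith
        then have "t * q ^ j = 1 \<or> q * t * q ^ j = 1" using qt by (auto simp: ac_simps)
        then have "pair_a t (xratio h z1 a b) = 0" by (auto simp: pair_a_def Xab)
        then show ?thesis using coeff_a_zero[of b a t z1] ab 2 by simp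
      next
        case 3
        then obtain k where k: "j = Suc (Suc k)" by (metis Suc_le_D numeral_2_eq_2 Suc_le_mono)
        have "f (z1 + axis b 2) = \<epsilon> ^ k * f (z2 + axis a 2)"
        proof -
          \<comment> \<open>Both points are z + 2e_a + 2e_b, moved by j - 2 in the direction
            \<open>a\<close> or \<open>b\<close>.\<close>
          have ej: "axis c (of_nat j) = axis c (of_nat k) + (axis c 2 :: complex ^ 'n)" for c
            by (simp add: k axis_plus add.commute)
          have "f (z + (axis a 2 + axis b 2) + axis a (of_nat k)) = \<epsilon> ^ k * f (z + (axis a 2 + axis b 2) + axis b (of_nat k))"
            using ab j1 k by (intro bc) (auto simp: axis_def)
          then show ?thesis by (simp add: z1_def z2_def ej ac_simps)
        qed
        moreover have "\<epsilon> ^ j = \<epsilon> ^ k" using e2 by (simp add: k flip: mult.assoc)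
        ultimately show ?thesis using 3 ab by (simp add: Fa_def P_def P'_def)
      next
        case 4
        have "f (z1 + axis i 2) = \<epsilon> ^ j * f (z2 + axis i 2)"
        proof -
          have "f (z + axis i 2 + axis a (of_nat j)) = \<epsilon> ^ j * f (z + axis i 2 + axis b (of_nat j))"
            using 4 j1 by (intro bc) (auto simp: axis_def)
          then show ?thesis by (simp add: z1_def z2_def ac_simps)
        qed
        then show ?thesis using 4 by (simp add: Fa_def P_def P'_def transpose_apply_other)
      qed
    qed
    then show ?thesis using tendsto_mult[OF lim_a[OF i] Fa[of i]] by (simp only:)
  qed
  have term_b: "((\<lambda>\<tau>. coeff_b h t i k (P \<tau>) * Fb i k \<tau>) \<longlongrightarrow> 0) (at 0)"
    if ik: "i \<noteq> k" "{i, k} \<noteq> {a, b} \<or> j \<noteq> 1" for i k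
  proof -
    \<comment> \<open>The shift is j + 1. It is admissible unless j = m, and then the factor 1 - t
      x_a/x_b of the coefficient vanishes.\<close>
    have al: "coeff_b h t a k z1 * (f (z1 + (axis a 1 + axis k 1)) - \<epsilon> ^ j * (\<epsilon> * f (z2 + (axis b 1 + axis k 1)))) = 0"
      if "k \<noteq> a" "k \<noteq> b" for k
    proof (cases "j = m")
      case True
      then have "pair_c t (xratio h z1 a b) = 0" using qt by (simp add: pair_c_def Xab ac_simps)
      then show ?thesis using coeff_b_zero[of b a k t z1] ab that by simp
    next
      case False
      then have "f (z + axis k 1 + axis a (of_nat (Suc j))) = \<epsilon> ^ Suc j * f (z + axis k 1 + axis b (of_nat (Suc j)))"
        using that j1 by (intro bc) (auto simp: axis_def)
      moreover have "z + axis k 1 + axis c (of_nat (Suc j)) = z + axis c (of_nat j) + (axis c 1 + axis k 1)" for c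
        by (simp only: axj ac_simps)
      ultimately show ?thesis by (simp only: z1_def z2_def) simp
    qed
    \<comment> \<open>Both points are z + e_a + e_b + e_k, moved by j - 1, so the bracket vanishes
      without help from the coefficient.\<close>
    have bl: "f (z1 + (axis b 1 + axis k 1)) - \<epsilon> ^ j * (\<epsilon> * f (z2 + (axis a 1 + axis k 1))) = 0"
      if "k \<noteq> a" "k \<noteq> b" for k
    proof -
      obtain j' where j': "j = Suc j'" using j1 by (cases j) auto
      have "f (z + (axis a 1 + axis b 1 + axis k 1) + axis a (of_nat j')) = \<epsilon> ^ j' * f (z + (axis a 1 + axis b 1 + axis k 1) + axis b (of_nat j'))"
        using that j1 ab j' by (intro bc) (auto simp: axis_def)
      moreover have "\<epsilon> ^ j * (\<epsilon> * u) = \<epsilon> ^ j' * u" for u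
      proof -
        have "\<epsilon> ^ j * (\<epsilon> * u) = (\<epsilon> * \<epsilon>) * (\<epsilon> ^ j' * u)" by (simp only: j' power_Suc ac_simps)
        then show ?thesis using e2 by simp
      qed
      moreover have "z + (axis a 1 + axis b 1 + axis k 1) + axis a (of_nat j') = z1 + (axis b 1 + axis k 1)"
        "z + (axis a 1 + axis b 1 + axis k 1) + axis b (of_nat j') = z2 + (axis a 1 + axis k 1)"
        by (simp_all only: z1_def z2_def j' axj ac_simps)
      ultimately show ?thesis by (simp only:) simp
    qed
    have sym: "Fb i k 0 = Fb k i 0" for i k by (simp add: Fb_def ac_simps)
    have ak: "coeff_b h t i k z1 * Fb i k 0 = 0" if "i = a \<or> i = b" "k \<noteq> a" "k \<noteq> b" for i k
      using al[of k] bl[of k] that ab by (auto simp: Fb_def P_def P'_def swp_sign_def transpose_apply_other)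
    have "coeff_b h t i k z1 * Fb i k 0 = 0"
    proof -
      consider "i = a \<or> i = b" "k \<noteq> a" "k \<noteq> b" | "k = a \<or> k = b" "i \<noteq> a" "i \<noteq> b"
        | "i \<noteq> a" "i \<noteq> b" "k \<noteq> a" "k \<noteq> b" | "i = a \<and> k = b \<or> i = b \<and> k = a" using ik(1) by auto
      then show ?thesis
      proof cases
        case 1
        then show ?thesis by (rule ak)
      next
        case 2
        then show ?thesis using ak[of k i] sym[of i k] coeff_b_commute[of t i k] by simp
      next
        case 3
        then have "f (z + (axis i 1 + axis k 1) + axis a (of_nat j)) = \<epsilon> ^ j * f (z + (axis i 1 + axis k 1) + axis b (of_nat j))"
          using j1 by (intro bc) (auto simp: axis_def)
        then show ?thesis using 3
          by (simp add: Fb_def P_def P'_def swp_sign_def transpose_apply_other z1_def z2_def ac_simps)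
      next
        case 4
        have "f (z + (axis a 1 + axis b 1) + axis a (of_nat j)) = \<epsilon> ^ j * f (z + (axis a 1 + axis b 1) + axis b (of_nat j))"
          using j1 ab by (intro bc) (auto simp: axis_def)
        then have "Fb a b 0 = 0"
          using ab e2 by (simp add: Fb_def P_def P'_def swp_sign_def z1_def z2_def ac_simps)
        then show ?thesis using 4 sym[of a b] by auto
      qed
    qed
    then show ?thesis using tendsto_mult[OF lim_b[OF ik] Fb[of i k]] by (simp only:)
  qed
  \<comment> \<open>For j = 1 the two products need not converge separately; for j > 1 each tends to
    0.\<close>
  have pair: "((\<lambda>\<tau>. coeff_a h t b (P \<tau>) * Fa b \<tau> + coeff_b h t a b (P \<tau>) * Fb a b \<tau>) \<longlongrightarrow> 0) (at 0)"
  proof (cases "j = 1")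
    case True
    have Fb1: "Fb a b \<tau> = f (P \<tau> + (axis a 1 + axis b 1)) - \<epsilon> * f (P' \<tau> + (axis b 1 + axis a 1))" for \<tau>
      using e2 ab by (simp add: Fb_def True swp_sign_def)
    have Fa1: "Fa b \<tau> = f (P \<tau> + axis b 2) - \<epsilon> * f (P' \<tau> + axis a 2)" for \<tau>
      using ab by (simp add: Fa_def True)
    show ?thesis unfolding Fa1 Fb1 P_def P'_def z1_def z2_def True of_nat_1
    proof (rule twisted_op_singular_pair[OF ab \<epsilon> half ep_f])
      show "generic_off a b {1, 1 / q} (z + axis a 1)" using gen1 True by simp
      show "f (z + axis a 1 + axis b 1 + axis a 1) = \<epsilon> * f (z + axis a 1 + axis b 1 + axis b 1)"
        using bc[of "axis a 1 + axis b 1" 1] ab j1 by (simp add: axis_def ac_simps)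
    qed
  next
    case False
    then show ?thesis using tendsto_add[OF term_a[of b] term_b[of a b]] ab by simp
  qed
  have expand: "twisted_op t f (P \<tau>) - \<epsilon> ^ j * twisted_op t f (P' \<tau>)
      = (\<Sum>i\<in>UNIV - {b}. coeff_a h t i (P \<tau>) * Fa i \<tau>)
        + (\<Sum>(i, k)\<in>off_diag - {(a, b), (b, a)}. coeff_b h t i k (P \<tau>) * Fb i k \<tau>) / 2
        + (coeff_a h t b (P \<tau>) * Fa b \<tau> + coeff_b h t a b (P \<tau>) * Fb a b \<tau>)" for \<tau>
  proof -
    have "P \<tau> = z + axis a (of_nat j + of_real \<tau> / h) + axis b (- of_real \<tau> / h)"
      "P' \<tau> = z + axis a (- of_real \<tau> / h) + axis b (of_nat j + of_real \<tau> / h)"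
      unfolding P_def P'_def root_dir_line z1_def z2_def axis_plus[symmetric] by (simp_all add: ac_simps)
    then have sw: "twisted_op t f (P' \<tau>) = (\<Sum>i\<in>UNIV. coeff_a h t i (P \<tau>) * f (P' \<tau> + axis (swp a b i) 2)) +
      (\<Sum>(i, k)\<in>off_diag. coeff_b h t i k (P \<tau>) *
       (swp_sign a b \<epsilon> i * swp_sign a b \<epsilon> k * f (P' \<tau> + (axis (swp a b i) 1 + axis (swp a b k) 1)))) / 2"
      using twisted_op_swp[OF ab \<epsilon> half, of t f "- of_real \<tau> / h" "of_nat j + of_real \<tau> / h"] by simp
    have "twisted_op t f (P \<tau>) - \<epsilon> ^ j * twisted_op t f (P' \<tau>)
      = (\<Sum>i\<in>UNIV. coeff_a h t i (P \<tau>) * Fa i \<tau>) + (\<Sum>p\<in>off_diag. coeff_b h t (fst p) (snd p) (P \<tau>) * Fb (fst p) (snd p) \<tau>) / 2"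
      unfolding sw unfolding twisted_op_def Fa_def Fb_def
      by (simp add: case_prod_beta sum_distrib_left right_diff_distrib sum_subtractf diff_divide_distrib ac_simps)
        (simp add: ring_distribs sum_distrib_left ac_simps)
    moreover have "(\<Sum>i\<in>UNIV. coeff_a h t i (P \<tau>) * Fa i \<tau>)
        = coeff_a h t b (P \<tau>) * Fa b \<tau> + (\<Sum>i\<in>UNIV - {b}. coeff_a h t i (P \<tau>) * Fa i \<tau>)"
      by (subst sum.remove[of _ b]) auto
    moreover have "(\<Sum>p\<in>off_diag. coeff_b h t (fst p) (snd p) (P \<tau>) * Fb (fst p) (snd p) \<tau>)
        = (\<Sum>p\<in>off_diag - {(a, b), (b, a)}. coeff_b h t (fst p) (snd p) (P \<tau>) * Fb (fst p) (snd p) \<tau>)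
        + 2 * (coeff_b h t a b (P \<tau>) * Fb a b \<tau>)"
    proof -
      have "Fb b a \<tau> = Fb a b \<tau>" by (simp add: Fb_def ac_simps)
      moreover have "{(a, b), (b, a)} \<subseteq> off_diag" using ab by (auto simp: off_diag_def)
      ultimately show ?thesis using ab coeff_b_commute[of t b a "P \<tau>"]
        by (subst sum.subset_diff[of "{(a, b), (b, a)}"]) auto
    qed
    ultimately show ?thesis by (simp add: case_prod_beta add_divide_distrib)
  qed
  have lim0: "((\<lambda>\<tau>. twisted_op t f (P \<tau>) - \<epsilon> ^ j * twisted_op t f (P' \<tau>)) \<longlongrightarrow> 0) (at 0)"
  proof -
    have "((\<lambda>\<tau>. (\<Sum>i\<in>UNIV - {b}. coeff_a h t i (P \<tau>) * Fa i \<tau>)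
        + (\<Sum>p\<in>off_diag - {(a, b), (b, a)}. coeff_b h t (fst p) (snd p) (P \<tau>) * Fb (fst p) (snd p) \<tau>) / 2
        + (coeff_a h t b (P \<tau>) * Fa b \<tau> + coeff_b h t a b (P \<tau>) * Fb a b \<tau>))
        \<longlongrightarrow> (\<Sum>i\<in>UNIV - {b}. 0) + (\<Sum>p\<in>off_diag - {(a, b), (b, a)}. 0) / 2 + 0) (at 0)"
    proof (intro tendsto_add tendsto_sum tendsto_divide tendsto_const pair term_a term_b)
      fix p :: "'n \<times> 'n" assume "p \<in> off_diag - {(a, b), (b, a)}"
      then show "fst p \<noteq> snd p" "{fst p, snd p} \<noteq> {a, b} \<or> j \<noteq> 1"
        by (auto simp: off_diag_def doubleton_eq_iff prod_eq_iff)
    qed auto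
    then show ?thesis unfolding expand by (simp add: case_prod_beta)
  qed
  have evP: "eventually (\<lambda>\<tau>. regular_point (P \<tau>)) (at 0)"
    unfolding P_def z1_def by (rule eventually_regular[OF ab gen1])
  have evP': "eventually (\<lambda>\<tau>. regular_point (P' \<tau>)) (at 0)"
    unfolding P'_def z2_def
    by (rule eventually_compose_filterlim[OF eventually_regular[OF ab gen2] at_0_minus])
  have "((\<lambda>\<tau>. G (P \<tau>) - \<epsilon> ^ j * G (P' \<tau>)) \<longlongrightarrow> 0) (at 0)"
    by (rule Lim_transform_eventually[OF lim0]) (use evP evP' in \<open>eventually_elim, simp add: G\<close>)
  moreover have "((\<lambda>\<tau>. G (P \<tau>) - \<epsilon> ^ j * G (P' \<tau>)) \<longlongrightarrow> G z1 - \<epsilon> ^ j * G z2) (at 0)"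
    unfolding P_def P'_def
    by (intro tendsto_diff tendsto_mult tendsto_const continuous_line ep_continuous[OF ep_G]
        tendsto_minus_at_0[where f = "\<lambda>\<tau>. G (z2 + \<tau> *\<^sub>R root_dir a b)"])
  ultimately have "G z1 - \<epsilon> ^ j * G z2 = 0" using tendsto_unique[of "at (0::real)"] by (metis at_neq_bot)
  then show ?thesis by (simp add: z1_def z2_def)
qed

text \<open>Genericity is removed by moving \<open>z\<close> along a direction with equal entries at
  \<open>a\<close> and \<open>b\<close>: this preserves the relation between x_a^(1/2) and
  x_b^(1/2), and both sides are continuous.\<close>

lemma twisted_op_conditions:
  fixes f G :: "complex ^ 'n \<Rightarrow> complex"
  assumes "t = 1 / q ^ m" "BA_conditions h m f" "ep h l A f" "ep h l' B G"
    and "\<And>z. regular_point z \<Longrightarrow> twisted_op t f z = G z"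
  shows "BA_conditions h m G"
  unfolding BA_conditions_def
proof (intro ballI allI impI)
  fix j a b \<epsilon> and z :: "complex ^ 'n"
  assume j: "j \<in> {1..m}" and \<epsilon>: "\<epsilon> \<in> {1, -1 :: complex}" and ab: "a \<noteq> b" and half: "qpow h (z $ a / 2) = \<epsilon> * qpow h (z $ b / 2)"
  \<comment> \<open>A shift by j e_k multiplies a ratio by 1, q^j or q^(-j). Avoiding
    \<open>C\<close> at \<open>z\<close> thus makes both shifted points avoid 1 and 1/q.\<close>
  define C where "C = (\<lambda>(c, d). c / d) ` ({1, 1 / q} \<times> {1, q ^ j, 1 / q ^ j})"
  have finC: "finite C" by (simp add: C_def)
  have shift: "generic_off a b {1, 1 / q} (z + axis k (of_nat j))" if "generic_off a b C z" for z and k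
    unfolding generic_off_def
  proof (intro allI impI)
    fix i i' :: 'n assume i: "i \<noteq> i' \<and> {i, i'} \<noteq> {a, b}"
    obtain d where d: "d \<in> {1, q ^ j, 1 / q ^ j}" "xratio h (z + axis k (of_nat j)) i i' = xratio h z i i' * d"
    proof -
      have "qpow h ((axis k (of_nat j) :: complex ^ 'n) $ i - axis k (of_nat j) $ i') \<in> {1, q ^ j, 1 / q ^ j}"
        by (auto simp: axis_def qpow_of_nat qpow_minus)
      then show ?thesis using that xratio_add by blast
    qed
    then have "d \<noteq> 0" by auto
    show "xratio h (z + axis k (of_nat j)) i i' \<notin> {1, 1 / q}"
    proof
      assume "xratio h (z + axis k (of_nat j)) i i' \<in> {1, 1 / q}"
      then have "xratio h z i i' \<in> C"
        unfolding C_def d(2) using d(1) \<open>d \<noteq> 0\<close> by (intro image_eqI[of _ _ "(xratio h z i i' * d, d)"]) auto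
      then show False using \<open>generic_off a b C z\<close> i by (auto simp: generic_off_def)
    qed
  qed
  obtain w :: "complex ^ 'n" where w: "w $ a = w $ b" "\<And>z. eventually (\<lambda>\<tau>. generic_off a b C (z + \<tau> *\<^sub>R w)) (at 0)"
    by (rule generic_direction[OF finC, of a b]) blast
  define F where "F z = G (z + axis a (of_nat j)) - \<epsilon> ^ j * G (z + axis b (of_nat j))" for z
  have "continuous_on UNIV F"
    unfolding F_def[abs_def] by (intro continuous_intros ep_continuous[OF ep_shift[OF assms(4)]])
  then have "((\<lambda>\<tau>. F (z + \<tau> *\<^sub>R w)) \<longlongrightarrow> F z) (at 0)" by (rule continuous_line)
  moreover have "eventually (\<lambda>\<tau>. F (z + \<tau> *\<^sub>R w) = 0) (at 0)"
    using w(2)[of z]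
  proof eventually_elim
    case (elim \<tau>)
    have "qpow h ((z + \<tau> *\<^sub>R w) $ a / 2) = \<epsilon> * qpow h ((z + \<tau> *\<^sub>R w) $ b / 2)"
      by (simp add: w(1) add_divide_distrib qpow_add half)
    from twisted_op_conditions_generic[OF assms(1-5) j ab \<epsilon> this shift[OF elim] shift[OF elim]]
    show ?case by (simp add: F_def)
  qed
  then have "((\<lambda>\<tau>. F (z + \<tau> *\<^sub>R w)) \<longlongrightarrow> 0) (at 0)" by (rule tendsto_eventually)
  ultimately have "F z = 0" using tendsto_unique[of "at (0::real)"] by (metis at_neq_bot)
  then show "G (z + axis a (of_nat j)) = \<epsilon> ^ j * G (z + axis b (of_nat j))" by (simp add: F_def)
qed

end

subsection \<open>Asymptotics and the eigenvalue\<close>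

lemma inner_less_of_norm_le:
  fixes u v :: "'a::real_inner"
  assumes "norm u \<le> norm v" "u \<noteq> v"
  shows "u \<bullet> v < v \<bullet> v"
proof -
  have "0 < (u - v) \<bullet> (u - v)" using assms(2) by simp
  moreover have "u \<bullet> u \<le> v \<bullet> v" using assms(1) by (simp add: norm_le)
  ultimately show ?thesis by (simp add: inner_diff_left inner_diff_right inner_commute)
qed

lemma exp_neg_at_top:
  assumes "s < 0"
  shows "((\<lambda>\<tau>. exp (complex_of_real (\<tau> * s))) \<longlongrightarrow> 0) at_top"
proof -
  have "filterlim (\<lambda>\<tau>. s * \<tau>) at_bot at_top"
    by (rule filterlim_tendsto_neg_mult_at_bot[OF tendsto_const assms filterlim_ident])
  then have "filterlim (\<lambda>\<tau>. \<tau> * s) at_bot at_top" by (simp only: mult.commute)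
  then have "((\<lambda>\<tau>. exp (\<tau> * s)) \<longlongrightarrow> 0) at_top" by (rule filterlim_compose[OF exp_at_bot])
  from tendsto_of_real[OF this, where 'a = complex] show ?thesis by (simp only: exp_of_real of_real_0)
qed

lemma rank_vec_norm_eq:
  fixes k :: "'n::finite \<Rightarrow> 'b::linorder" and k' :: "'n \<Rightarrow> 'c::linorder"
  assumes "inj k" "inj k'"
  shows "norm (rank_vec m k) = norm (rank_vec m k')"
  by (simp add: norm_eq_sqrt_inner rank_vec_inner[OF assms(1)] rank_vec_inner[OF assms(2)])

text \<open>For m = 0 the vector is 0 and its coordinates coincide, hence the premise in the second
  claim.\<close>

lemma separated_rank_vec:
  fixes v :: "real ^ 'n" and k :: "'n \<Rightarrow> 'b::linorder"
  assumes "separated m v" "inj k" "norm v \<le> norm (rank_vec m k)"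
  shows "norm v = norm (rank_vec m k)" and "m > 0 \<Longrightarrow> inj (($) v)"
    and "v $ i = real m / 2 * (real (rank_below (($) v) i) - real (rank_above (($) v) i))"
proof -
  have v: "v = rank_vec m (($) v)" by (rule separated_extremal[OF assms])
  show "v $ i = real m / 2 * (real (rank_below (($) v) i) - real (rank_above (($) v) i))"
    by (subst v) (simp add: rank_vec_def)
  show inj: "inj (($) v)" if "m > 0" using assms(1) that by (force simp: inj_def separated_def)
  show "norm v = norm (rank_vec m k)"
  proof (cases "m = 0")
    case True
    then have "rank_vec m k = (0 :: real ^ 'n)" by (simp add: rank_vec_def vec_eq_iff)
    then show ?thesis using assms(3) by simp
  next
    case False
    then show ?thesis using rank_vec_norm_eq[OF inj assms(2), of m] v by simp
  qed
qed

context generic_q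
begin

text \<open>With the division by \<open>h\<close> the exponent u grows along the ray exactly like
  exp(\<tau> <u,v>), so real inner products decide which term dominates.\<close>

definition ray :: "real ^ 'n \<Rightarrow> complex ^ 'n" where
  "ray v = (\<chi> i. complex_of_real (v $ i) / h)"

lemma bil_ray: "bil u (ray v) = bil u (cvec v) / h"
  by (simp add: bil_def ray_def cvec_def sum_divide_distrib)

lemma xratio_ray: "xratio h (z + \<tau> *\<^sub>R ray v) a b = xratio h z a b * exp (complex_of_real (\<tau> * (v $ a - v $ b)))"
  unfolding xratio_line by (simp add: ray_def right_diff_distrib diff_divide_distrib)

lemma xratio_ray_tendsto_0:
  "v $ a < v $ b \<Longrightarrow> ((\<lambda>\<tau>. xratio h (z + \<tau> *\<^sub>R ray v) a b) \<longlongrightarrow> 0) at_top"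
  unfolding xratio_ray using tendsto_mult[OF tendsto_const exp_neg_at_top[of "v $ a - v $ b"]] by simp

text \<open>The exponential factor compensates the growth of the exponent \<open>v\<close>. Every
  other exponent of norm at most |v| has a smaller inner product with \<open>v\<close> and decays;
  if \<open>v\<close> is absent, the limit is 0.\<close>

lemma esum_ray_tendsto:
  fixes v :: "real ^ 'n"
  assumes "finite S" "\<And>u. u \<in> S \<Longrightarrow> norm u \<le> norm v"
  shows "((\<lambda>\<tau>. exp (- (complex_of_real \<tau> * (bil l (cvec v) / 2 + of_real (v \<bullet> v)))) * esum h l S c ((z + \<tau> *\<^sub>R ray v) + w))
    \<longlongrightarrow> (if v \<in> S then c v else 0) * echar h l v (z + w)) at_top"
proof -
  have eq: "exp (- (complex_of_real \<tau> * (bil l (cvec v) / 2 + of_real (v \<bullet> v)))) * echar h l u ((z + \<tau> *\<^sub>R ray v) + w)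
      = echar h l u (z + w) * exp (complex_of_real (\<tau> * (u \<bullet> v - v \<bullet> v)))" for u \<tau>
  proof -
    have "echar h l u ((z + \<tau> *\<^sub>R ray v) + w) = echar h l u (z + w) * exp (complex_of_real \<tau> * (bil l (cvec v) / 2 + of_real (u \<bullet> v)))"
      unfolding line_shift echar_add_right
      by (simp add: echar_def qpow_def bil_scaleR_right bil_ray bil_cvec algebra_simps)
    then show ?thesis by (simp add: algebra_simps flip: exp_add)
  qed
  have "((\<lambda>\<tau>. \<Sum>u\<in>S. c u * (echar h l u (z + w) * exp (complex_of_real (\<tau> * (u \<bullet> v - v \<bullet> v)))))
      \<longlongrightarrow> (\<Sum>u\<in>S. c u * (echar h l u (z + w) * (if u = v then 1 else 0)))) at_top"
  proof (intro tendsto_sum tendsto_mult tendsto_const)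
    fix u assume u: "u \<in> S"
    show "((\<lambda>\<tau>. exp (complex_of_real (\<tau> * (u \<bullet> v - v \<bullet> v)))) \<longlongrightarrow> (if u = v then 1 else 0)) at_top"
    proof (cases "u = v")
      case False
      then show ?thesis using exp_neg_at_top[of "u \<bullet> v - v \<bullet> v"] inner_less_of_norm_le[OF assms(2)[OF u]] by simp
    qed simp
  qed
  moreover have "(\<Sum>u\<in>S. c u * (echar h l u (z + w) * (if u = v then 1 else 0))) = (if v \<in> S then c v else 0) * echar h l v (z + w)"
    using assms(1) by (simp add: if_distrib[of "\<lambda>x. _ * x"] cong: if_cong)
  moreover have "exp (- (complex_of_real \<tau> * (bil l (cvec v) / 2 + of_real (v \<bullet> v)))) * esum h l S c ((z + \<tau> *\<^sub>R ray v) + w)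
      = (\<Sum>u\<in>S. c u * (echar h l u (z + w) * exp (complex_of_real (\<tau> * (u \<bullet> v - v \<bullet> v)))))" for \<tau>
    unfolding esum_def sum_distrib_left eq[symmetric] by (rule sum.cong) (simp_all only: ac_simps)
  ultimately show ?thesis by simp
qed

section \<open>Limits of the coefficients along rays\<close>

lemma pair_a_inverse: "x \<noteq> 0 \<Longrightarrow> pair_a t x = ((1 / x - t) * (1 / x - q * t)) / ((1 / x - 1) * (1 / x - q))"
proof -
  assume x: "x \<noteq> 0"
  have "1 - s * x = x * (1 / x - s)" for s using x by (simp add: field_simps)
  then show ?thesis using x by (simp add: pair_a_def mult.assoc[symmetric]) (simp add: field_simps)
qed

lemma pair_c_inverse: "x \<noteq> 0 \<Longrightarrow> pair_c t x = (1 / x - t) / (1 / x - 1)"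
proof -
  assume x: "x \<noteq> 0"
  have "1 - s * x = x * (1 / x - s)" for s using x by (simp add: field_simps)
  from this[of t] this[of 1] show ?thesis using x by (simp add: pair_c_def)
qed

lemma pair_a_ray:
  "((\<lambda>\<tau>. pair_a t (xratio h (z + \<tau> *\<^sub>R ray v) a b)) \<longlongrightarrow>
    (if v $ b < v $ a then t\<^sup>2 else if v $ a < v $ b then 1 else pair_a t (xratio h z a b))) at_top"
proof -
  consider "v $ b < v $ a" | "v $ a < v $ b" | "v $ a = v $ b" by linarith
  then show ?thesis
  proof cases
    case 1
    have "((\<lambda>\<tau>. ((xratio h (z + \<tau> *\<^sub>R ray v) b a - t) * (xratio h (z + \<tau> *\<^sub>R ray v) b a - q * t)) /
      ((xratio h (z + \<tau> *\<^sub>R ray v) b a - 1) * (xratio h (z + \<tau> *\<^sub>R ray v) b a - q))) \<longlongrightarrow> ((0 - t) * (0 - q * t)) / ((0 - 1) * (0 - q))) at_top"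
      by (intro tendsto_intros xratio_ray_tendsto_0[OF 1]) simp
    then show ?thesis using 1
      by (simp add: pair_a_inverse power2_eq_square flip: xratio_swap)
  next
    case 2
    have "((\<lambda>\<tau>. pair_a t (xratio h (z + \<tau> *\<^sub>R ray v) a b)) \<longlongrightarrow> pair_a t 0) at_top"
      by (intro tendsto_pair_a xratio_ray_tendsto_0[OF 2]) auto
    then show ?thesis using 2 by (simp add: pair_a_def)
  next
    case 3
    then show ?thesis by (simp add: xratio_ray)
  qed
qed

text \<open>Convergence is enough: wherever the limit of \<open>coeff_b\<close> is evaluated, the
  other factor \<open>pair_b\<close> makes it 0.\<close>

lemma pair_c_ray:
  "\<exists>L. ((\<lambda>\<tau>. pair_c t (xratio h (z + \<tau> *\<^sub>R ray v) a b)) \<longlongrightarrow> L) at_top"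
proof -
  consider "v $ b < v $ a" | "v $ a < v $ b" | "v $ a = v $ b" by linarith
  then show ?thesis
  proof cases
    case 1
    have "((\<lambda>\<tau>. (xratio h (z + \<tau> *\<^sub>R ray v) b a - t) / (xratio h (z + \<tau> *\<^sub>R ray v) b a - 1)) \<longlongrightarrow> (0 - t) / (0 - 1)) at_top"
      by (intro tendsto_intros xratio_ray_tendsto_0[OF 1]) simp
    then show ?thesis by (auto simp: pair_c_inverse simp flip: xratio_swap)
  next
    case 2
    have "((\<lambda>\<tau>. pair_c t (xratio h (z + \<tau> *\<^sub>R ray v) a b)) \<longlongrightarrow> pair_c t 0) at_top"
      by (intro tendsto_pair_c xratio_ray_tendsto_0[OF 2]) auto
    then show ?thesis by blast
  next
    case 3
    then show ?thesis by (auto simp: xratio_ray)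
  qed
qed

lemma xhalf_ratio_ray:
  "xhalf_ratio h (z + \<tau> *\<^sub>R ray v) a b = xhalf_ratio h z a b * exp (complex_of_real (\<tau> * ((v $ a - v $ b) / 2)))"
proof -
  have "h * ((\<tau> *\<^sub>R ray v) $ c / 2) = complex_of_real (\<tau> * v $ c / 2)" for c
    by (simp add: ray_def scaleR_conv_of_real[where 'a = complex])
  then have "qpow h ((z + \<tau> *\<^sub>R ray v) $ c / 2) = qpow h (z $ c / 2) * exp (complex_of_real (\<tau> * v $ c / 2))" for c
    unfolding vector_add_component add_divide_distrib qpow_add by (simp only: qpow_def)
  then show ?thesis
    by (simp add: xhalf_ratio_def right_diff_distrib diff_divide_distrib exp_diff)
qed

text \<open>For distinct coordinates the numerator grows like the square root of a ratio and the
  denominator like the ratio itself.\<close>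

lemma pair_b_ray:
  "((\<lambda>\<tau>. pair_b t (xhalf_ratio h (z + \<tau> *\<^sub>R ray v) a b) (xhalf_ratio h (z + \<tau> *\<^sub>R ray v) b a)) \<longlongrightarrow>
    (if v $ a = v $ b then pair_b t (xhalf_ratio h z a b) (xhalf_ratio h z b a) else 0)) at_top"
proof -
  have less: "((\<lambda>\<tau>. pair_b t (xhalf_ratio h (z + \<tau> *\<^sub>R ray v) a b) (xhalf_ratio h (z + \<tau> *\<^sub>R ray v) b a)) \<longlongrightarrow> 0) at_top"
    if "v $ a < v $ b" for a b
  proof -
    define r where "r \<tau> = xhalf_ratio h (z + \<tau> *\<^sub>R ray v) a b" for \<tau>
    have r0: "(r \<longlongrightarrow> 0) at_top"
      unfolding r_def[abs_def] xhalf_ratio_ray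
      using tendsto_mult[OF tendsto_const exp_neg_at_top[of "(v $ a - v $ b) / 2"]] that by simp
    have "((\<lambda>\<tau>. Q * (t - 1) * (t - q) * ((r \<tau> * (r \<tau>)\<^sup>2 + r \<tau>) / ((1 - q * (r \<tau>)\<^sup>2) * ((r \<tau>)\<^sup>2 - q))))
      \<longlongrightarrow> Q * (t - 1) * (t - q) * ((0 * 0\<^sup>2 + 0) / ((1 - q * 0\<^sup>2) * (0\<^sup>2 - q)))) at_top"
      by (intro tendsto_intros r0) simp
    moreover have "pair_b t (r \<tau>) (1 / r \<tau>) = Q * (t - 1) * (t - q) * ((r \<tau> * (r \<tau>)\<^sup>2 + r \<tau>) / ((1 - q * (r \<tau>)\<^sup>2) * ((r \<tau>)\<^sup>2 - q)))" for \<tau>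
    proof -
      have rn: "r \<tau> \<noteq> 0" by (simp add: r_def)
      have "r \<tau> + 1 / r \<tau> = (r \<tau> * (r \<tau>)\<^sup>2 + r \<tau>) / (r \<tau>)\<^sup>2"
        using rn by (simp add: field_simps power2_eq_square)
      moreover have "1 - q * (1 / r \<tau>)\<^sup>2 = ((r \<tau>)\<^sup>2 - q) / (r \<tau>)\<^sup>2"
        using rn by (simp add: field_simps power2_eq_square)
      ultimately show ?thesis using rn by (simp add: pair_b_def)
    qed
    moreover have "xhalf_ratio h (z + \<tau> *\<^sub>R ray v) b a = 1 / r \<tau>" for \<tau>
      by (simp add: r_def xhalf_ratio_def)
    ultimately show ?thesis by (simp add: r_def)
  qed
  have comm: "pair_b t x y = pair_b t y x" for x y by (simp add: pair_b_def ac_simps)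
  consider "v $ b < v $ a" | "v $ a < v $ b" | "v $ a = v $ b" by linarith
  then show ?thesis
  proof cases
    case 1
    then show ?thesis using less[OF 1] by (simp add: comm)
  next
    case 2
    then show ?thesis using less[OF 2] by simp
  next
    case 3
    then show ?thesis by (simp add: xhalf_ratio_ray)
  qed
qed

lemma coeff_a_ray:
  "((\<lambda>\<tau>. coeff_a h t i (z + \<tau> *\<^sub>R ray v)) \<longlongrightarrow> (\<Prod>j\<in>UNIV - {i}.
    if v $ j < v $ i then t\<^sup>2 else if v $ i < v $ j then 1 else pair_a t (xratio h z i j))) at_top"
  unfolding coeff_a_eq by (intro tendsto_prod pair_a_ray)

text \<open>The two cases with limit 0 serve a separated \<open>v\<close>: its coordinates are
  distinct if m > 0, and t = 1 if m = 0.\<close>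

lemma coeff_b_ray:
  "\<exists>L. ((\<lambda>\<tau>. coeff_b h t i j (z + \<tau> *\<^sub>R ray v)) \<longlongrightarrow> L) at_top \<and> (v $ i \<noteq> v $ j \<or> t = 1 \<longrightarrow> L = 0)"
proof -
  obtain C where C: "\<And>a b. ((\<lambda>\<tau>. pair_c t (xratio h (z + \<tau> *\<^sub>R ray v) a b)) \<longlongrightarrow> C a b) at_top"
    using pair_c_ray[of t z v] by metis
  have "((\<lambda>\<tau>. coeff_b h t i j (z + \<tau> *\<^sub>R ray v)) \<longlongrightarrow>
     (if v $ i = v $ j then pair_b t (xhalf_ratio h z i j) (xhalf_ratio h z j i) else 0) *
     (\<Prod>l\<in>UNIV - {i, j}. C i l * C j l)) at_top"
    unfolding coeff_b_eq by (intro tendsto_mult tendsto_prod pair_b_ray C)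
  then show ?thesis by (intro exI conjI) (auto simp: pair_b_def)
qed

lemma eventually_regular_ray:
  assumes "regular_point z"
  shows "eventually (\<lambda>\<tau>. regular_point (z + \<tau> *\<^sub>R ray v)) at_top"
proof -
  have "eventually (\<lambda>\<tau>. i \<noteq> j \<longrightarrow> xratio h (z + \<tau> *\<^sub>R ray v) i j \<noteq> c) at_top" if c: "c \<in> {1, 1 / q}" for i j c
  proof (cases "i \<noteq> j")
    case True
    have c0: "c \<noteq> 0" using c by auto
    consider "v $ j < v $ i" | "v $ i < v $ j" | "v $ i = v $ j" by linarith
    then have "eventually (\<lambda>\<tau>. xratio h (z + \<tau> *\<^sub>R ray v) i j \<noteq> c) at_top"
    proof cases
      case 1
      have "eventually (\<lambda>\<tau>. xratio h (z + \<tau> *\<^sub>R ray v) j i \<noteq> 1 / c) at_top"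
        by (rule tendsto_imp_eventually_ne[OF xratio_ray_tendsto_0[OF 1]]) (use c0 in auto)
      then show ?thesis by eventually_elim (auto simp: xratio_swap[of h _ j i])
    next
      case 2
      show ?thesis by (rule tendsto_imp_eventually_ne[OF xratio_ray_tendsto_0[OF 2]]) (use c0 in auto)
    next
      case 3
      then show ?thesis using assms c True by (auto simp: xratio_ray regular_point_def)
    qed
    then show ?thesis by eventually_elim simp
  qed simp
  then have "eventually (\<lambda>\<tau>. \<forall>i. \<forall>j. \<forall>c\<in>{1, 1 / q}. i \<noteq> j \<longrightarrow> xratio h (z + \<tau> *\<^sub>R ray v) i j \<noteq> c) at_top"
    by (intro eventually_all_finite eventually_ball_finite) auto
  then show ?thesis by eventually_elim (auto simp: regular_point_def)
qed

lemma twisted_op_ray: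
  fixes z :: "complex ^ 'n"
  assumes A: "\<And>i. ((\<lambda>\<tau>. coeff_a h t i (P \<tau>)) \<longlongrightarrow> A i) F"
    and B: "\<And>i j. i \<noteq> j \<Longrightarrow> ((\<lambda>\<tau>. coeff_b h t i j (P \<tau>)) \<longlongrightarrow> B i j) F"
    and f: "\<And>w. ((\<lambda>\<tau>. e \<tau> * f (P \<tau> + w)) \<longlongrightarrow> \<phi> w) F"
  shows "((\<lambda>\<tau>. e \<tau> * twisted_op t f (P \<tau>)) \<longlongrightarrow> (\<Sum>i\<in>UNIV. A i * \<phi> (axis i 2)) +
     (\<Sum>(i, j)\<in>off_diag. B i j * \<phi> (axis i 1 + axis j 1)) / 2) F"
proof -
  have "((\<lambda>\<tau>. (\<Sum>i\<in>UNIV. coeff_a h t i (P \<tau>) * (e \<tau> * f (P \<tau> + axis i 2))) +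
     (\<Sum>p\<in>off_diag. coeff_b h t (fst p) (snd p) (P \<tau>) * (e \<tau> * f (P \<tau> + (axis (fst p) 1 + axis (snd p) 1)))) / 2)
     \<longlongrightarrow> (\<Sum>i\<in>UNIV. A i * \<phi> (axis i 2)) +
     (\<Sum>p\<in>off_diag. B (fst p) (snd p) * \<phi> (axis (fst p) 1 + axis (snd p) 1)) / 2) F"
    by (intro tendsto_add tendsto_divide tendsto_sum tendsto_mult[OF A] tendsto_mult[OF B] f)
      (auto simp: off_diag_def)
  then show ?thesis
    by (simp add: twisted_op_def case_prod_beta distrib_left sum_distrib_left mult.left_commute)
qed

text \<open>Origin of the factor t^(n-1). With L coordinates below v_i and U above it, the product
  tends to t^(2L) = q^(-2mL), while 2 v_i = m(L - U); together this is q^(-m(L+U)), where L + U = n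
  - 1 for every \<open>i\<close>. For m = 0 all coordinates are 0 and all factors are 1 at a regular
  point.\<close>

lemma separated_leading_coeff:
  fixes v :: "real ^ 'n" and k :: "'n \<Rightarrow> 'b::linorder"
  assumes t: "t = 1 / q ^ m" and v: "separated m v" "inj k" "norm v \<le> norm (rank_vec m k)"
    and z: "regular_point z"
  shows "(\<Prod>j\<in>UNIV - {i}. if v $ j < v $ i then t\<^sup>2 else if v $ i < v $ j then 1 else pair_a t (xratio h z i j))
      * qpow h (complex_of_real (2 * v $ i)) = t ^ (CARD('n) - 1)"
proof (cases "m = 0")
  case True
  have "pair_a 1 x = 1" if "x \<notin> {1, 1 / q}" for x
    using that by (auto simp: pair_a_def one_minus_q)
  moreover have "v $ j = 0" for j using True separated_rank_vec(3)[OF v, of j] by simp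
  ultimately show ?thesis using True z
    by (auto simp: t regular_point_def intro!: prod.neutral)
next
  case False
  let ?L = "rank_below (($) v) i" and ?U = "rank_above (($) v) i"
  have inj: "inj (($) v)" using separated_rank_vec(2)[OF v] False by simp
  have "(\<Prod>j\<in>UNIV - {i}. if v $ j < v $ i then t\<^sup>2 else if v $ i < v $ j then 1 else pair_a t (xratio h z i j))
      = (\<Prod>j\<in>{j. v $ j < v $ i}. t\<^sup>2)"
    using inj by (intro prod.mono_neutral_cong_right) (auto simp: inj_def)
  then have 1: "(\<Prod>j\<in>UNIV - {i}. if v $ j < v $ i then t\<^sup>2 else if v $ i < v $ j then 1 else pair_a t (xratio h z i j))
      = 1 / (q ^ (m * ?L) * q ^ (m * ?L))"
    by (simp add: rank_below_def t power_divide power2_eq_square power_mult_distrib flip: power_mult)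
  have "complex_of_real (2 * v $ i) = of_nat (m * ?L) - of_nat (m * ?U)"
    unfolding separated_rank_vec(3)[OF v, of i] by (simp add: algebra_simps)
  then have 2: "qpow h (complex_of_real (2 * v $ i)) = q ^ (m * ?L) / q ^ (m * ?U)"
    by (simp only: qpow_diff qpow_of_nat)
  have "t ^ (CARD('n) - 1) = 1 / (q ^ (m * ?L) * q ^ (m * ?U))"
    using rank_below_above[OF inj, of i, symmetric]
    by (simp add: t power_add power_divide flip: power_mult)
  then show ?thesis unfolding 1 2 by simp
qed

text \<open>Asymptotics along the real rays \<open>z\<^sub>0 + \<tau> v / h\<close> give the support and the leading coefficients
  of \<open>D f\<close>; then \<open>D f - e f\<close> has no exponent among the permutations of \<open>\<rho>\<close>.\<close>

lemma twisted_op_eigenfunction: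
  fixes S :: "(real ^ 'n) set" and l :: "complex ^ 'n" and k :: "'n \<Rightarrow> 'b::linorder"
  assumes t: "t = 1 / q ^ m" and k: "inj k"
    and S: "finite S" "\<And>u. u \<in> S \<Longrightarrow> norm u \<le> norm (rank_vec m k)"
    and f: "BA_conditions h m (esum h l S c)"
    and \<Lambda>: "finite \<Lambda>" "\<And>s u. s \<in> S \<Longrightarrow> u \<in> half_lattice \<Longrightarrow> norm (u + s) \<le> norm (rank_vec m k) \<Longrightarrow> \<not> separated m (u + s) \<Longrightarrow> u + s \<in> \<Lambda>"
    and uniq: "\<And>c. BA_conditions h m (esum h l \<Lambda> c) \<Longrightarrow> \<forall>v\<in>\<Lambda>. c v = 0"
    and z: "regular_point z"
  shows "twisted_op t (esum h l S c) z = t ^ (CARD('n) - 1) * orbitsum1 h l * esum h l S c z"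
proof -
  define f where "f = esum h l S c"
  define e where "e = t ^ (CARD('n) - 1) * orbitsum1 h l"
  define R where "R = norm (rank_vec m k)"
  \<comment> \<open>The union of the half-lattice cosets that meet \<open>S\<close>, on which
    multiplication by Laurent polynomials is possible.\<close>
  define A where "A = {u + s | u s. u \<in> half_lattice \<and> s \<in> S}"
  have hl: "hl_closed A" unfolding hl_closed_def
  proof (intro ballI)
    fix u v :: "real ^ 'n" assume u: "u \<in> half_lattice" and "v \<in> A"
    then obtain u' s where *: "v = u' + s" "u' \<in> half_lattice" "s \<in> S" by (auto simp: A_def)
    then have "u + v = (u + u') + s" "u + u' \<in> half_lattice" using u by (auto intro: half_lattice_add simp: add.assoc)
    then show "u + v \<in> A" using * unfolding A_def by blast
  qed
  have SA: "S \<subseteq> A"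
  proof
    fix s assume "s \<in> S"
    then have "s = 0 + s" "(0 :: real ^ 'n) \<in> half_lattice" by (simp_all add: half_lattice_0)
    then show "s \<in> A" using \<open>s \<in> S\<close> unfolding A_def by blast
  qed
  have ep_f: "ep h l A f" unfolding f_def by (rule epI[OF S(1) SA])
  obtain G where G: "ep h l A G" "\<And>z. regular_point z \<Longrightarrow> twisted_op t f z = G z"
    using twisted_op_regular[OF t f[folded f_def] ep_f hl] by blast
  have BG: "BA_conditions h m G"
    by (rule twisted_op_conditions[OF t f[folded f_def] ep_f G])
  obtain T0 g where T0: "finite T0" "T0 \<subseteq> A" "G = esum h l T0 g" using G(1) by (rule epE)
  \<comment> \<open>Zero coefficients are discarded, so that a longest element of \<open>T\<close>
    really occurs in \<open>G\<close>.\<close>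
  define T where "T = {u\<in>T0. g u \<noteq> 0}"
  have T: "finite T" "T \<subseteq> A" "\<And>u. u \<in> T \<Longrightarrow> g u \<noteq> 0" using T0 by (auto simp: T_def)
  have GT: "G = esum h l T g"
    unfolding T0(3) esum_def T_def using T0(1) by (intro ext sum.mono_neutral_right) auto
  \<comment> \<open>The limit along the ray of \<open>v\<close> is computed twice, from
    \<open>G\<close> and termwise from the operator.\<close>
  have leading: "(if v \<in> T then g v else 0) * echar h l v z =
      (\<Sum>i\<in>UNIV. (\<Prod>j\<in>UNIV - {i}. if v $ j < v $ i then t\<^sup>2 else if v $ i < v $ j then 1 else pair_a t (xratio h z i j))
        * ((if v \<in> S then c v else 0) * echar h l v (z + axis i 2))) +
      (\<Sum>(i, j)\<in>off_diag. B i j * ((if v \<in> S then c v else 0) * echar h l v (z + (axis i 1 + axis j 1)))) / 2"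
    if "\<And>u. u \<in> T \<Longrightarrow> norm u \<le> norm v" "\<And>u. u \<in> S \<Longrightarrow> norm u \<le> norm v"
      and B: "\<And>i j. i \<noteq> j \<Longrightarrow> ((\<lambda>\<tau>. coeff_b h t i j (z + \<tau> *\<^sub>R ray v)) \<longlongrightarrow> B i j) at_top" for v B
  proof -
    let ?e = "\<lambda>\<tau>. exp (- (complex_of_real \<tau> * (bil l (cvec v) / 2 + of_real (v \<bullet> v))))"
    have "((\<lambda>\<tau>. ?e \<tau> * twisted_op t f (z + \<tau> *\<^sub>R ray v)) \<longlongrightarrow>
      (\<Sum>i\<in>UNIV. (\<Prod>j\<in>UNIV - {i}. if v $ j < v $ i then t\<^sup>2 else if v $ i < v $ j then 1 else pair_a t (xratio h z i j))
        * ((if v \<in> S then c v else 0) * echar h l v (z + axis i 2))) +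
      (\<Sum>(i, j)\<in>off_diag. B i j * ((if v \<in> S then c v else 0) * echar h l v (z + (axis i 1 + axis j 1)))) / 2) at_top"
      unfolding f_def by (intro twisted_op_ray coeff_a_ray B esum_ray_tendsto S(1) that(2))
    then have "((\<lambda>\<tau>. ?e \<tau> * G (z + \<tau> *\<^sub>R ray v)) \<longlongrightarrow>
      (\<Sum>i\<in>UNIV. (\<Prod>j\<in>UNIV - {i}. if v $ j < v $ i then t\<^sup>2 else if v $ i < v $ j then 1 else pair_a t (xratio h z i j))
        * ((if v \<in> S then c v else 0) * echar h l v (z + axis i 2))) +
      (\<Sum>(i, j)\<in>off_diag. B i j * ((if v \<in> S then c v else 0) * echar h l v (z + (axis i 1 + axis j 1)))) / 2) at_top"
      by (rule Lim_transform_eventually) (use eventually_regular_ray[OF z, of v] in \<open>eventually_elim, simp add: G\<close>)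
    moreover have "((\<lambda>\<tau>. ?e \<tau> * G (z + \<tau> *\<^sub>R ray v)) \<longlongrightarrow> (if v \<in> T then g v else 0) * echar h l v z) at_top"
      using esum_ray_tendsto[OF T(1) that(1), of l g z 0] by (simp add: GT)
    ultimately show ?thesis using tendsto_unique[OF trivial_limit_at_top_linorder] by blast
  qed
  have ex_B: "\<exists>B. (\<forall>i j. i \<noteq> j \<longrightarrow> ((\<lambda>\<tau>. coeff_b h t i j (z + \<tau> *\<^sub>R ray v)) \<longlongrightarrow> B i j) at_top) \<and>
    (\<forall>i j. v $ i \<noteq> v $ j \<or> t = 1 \<longrightarrow> B i j = 0)" for v
  proof -
    define B where "B i j = (SOME L. ((\<lambda>\<tau>. coeff_b h t i j (z + \<tau> *\<^sub>R ray v)) \<longlongrightarrow> L) at_top \<and>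
      (v $ i \<noteq> v $ j \<or> t = 1 \<longrightarrow> L = 0))" for i j
    have "((\<lambda>\<tau>. coeff_b h t i j (z + \<tau> *\<^sub>R ray v)) \<longlongrightarrow> B i j) at_top \<and> (v $ i \<noteq> v $ j \<or> t = 1 \<longrightarrow> B i j = 0)" for i j
      unfolding B_def by (rule someI_ex) (rule coeff_b_ray)
    then show ?thesis by (intro exI[of _ B] conjI allI impI) (elim conjE mp, assumption | blast)+
  qed
  have TR: "norm u \<le> R" if "u \<in> T" for u
  proof (rule ccontr)
    assume large: "\<not> norm u \<le> R"
    have "T \<noteq> {}" using that by blast
    then obtain v where v: "v \<in> T" "\<And>u. u \<in> T \<Longrightarrow> norm u \<le> norm v"
      by (rule finite_arg_max[OF T(1), of norm]) blast
    have R: "R < norm v" using v(2)[OF that] large by linarith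
    have S': "norm u \<le> norm v" if "u \<in> S" for u using S(2)[OF that] R by (simp add: R_def)
    \<comment> \<open>Hence the limit computed from the operator is 0, whereas \<open>G\<close>
      contributes the nonzero coefficient \<open>g v\<close>.\<close>
    have "v \<notin> S" using S(2)[of v] R by (auto simp: R_def)
    obtain B where "\<forall>i j. i \<noteq> j \<longrightarrow> ((\<lambda>\<tau>. coeff_b h t i j (z + \<tau> *\<^sub>R ray v)) \<longlongrightarrow> B i j) at_top"
      using ex_B[of v] by (elim exE conjE)
    with leading[OF v(2) S', of B] \<open>v \<notin> S\<close> have "g v * echar h l v z = 0" using v(1) by (simp add: case_prod_beta)
    then show False using T(3)[OF v(1)] by simp
  qed
  define D where "D u = (if u \<in> T then g u else 0) - e * (if u \<in> S then c u else 0)" for u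
  have D0: "D v = 0" if v: "separated m v" "norm v \<le> R" for v
  proof -
    note sv = v(1) k v(2)[unfolded R_def]
    have nv: "norm v = R" using separated_rank_vec(1)[OF sv] by (simp add: R_def)
    obtain B where B: "\<forall>i j. i \<noteq> j \<longrightarrow> ((\<lambda>\<tau>. coeff_b h t i j (z + \<tau> *\<^sub>R ray v)) \<longlongrightarrow> B i j) at_top"
      "\<forall>i j. v $ i \<noteq> v $ j \<or> t = 1 \<longrightarrow> B i j = 0" using ex_B[of v] by (elim exE conjE)
    have B0: "B i j = 0" if "i \<noteq> j" for i j
    proof (cases "m = 0")
      case True
      then show ?thesis using B(2) t by simp
    next
      case False
      then have "v $ i \<noteq> v $ j" using separated_rank_vec(2)[OF sv] that by (auto simp: inj_def)
      then show ?thesis using B(2) by blast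
    qed
    have "(if v \<in> T then g v else 0) * echar h l v z =
      (\<Sum>i\<in>UNIV. (\<Prod>j\<in>UNIV - {i}. if v $ j < v $ i then t\<^sup>2 else if v $ i < v $ j then 1 else pair_a t (xratio h z i j))
        * ((if v \<in> S then c v else 0) * echar h l v (z + axis i 2))) +
      (\<Sum>(i, j)\<in>off_diag. B i j * ((if v \<in> S then c v else 0) * echar h l v (z + (axis i 1 + axis j 1)))) / 2"
      by (rule leading) (use TR S(2) nv B(1) in \<open>auto simp: R_def\<close>)
    also have "(\<Sum>(i, j)\<in>off_diag. B i j * ((if v \<in> S then c v else 0) * echar h l v (z + (axis i 1 + axis j 1)))) = 0"
      by (rule sum.neutral) (auto simp: off_diag_def B0)
    also have "(\<Sum>i\<in>UNIV. (\<Prod>j\<in>UNIV - {i}. if v $ j < v $ i then t\<^sup>2 else if v $ i < v $ j then 1 else pair_a t (xratio h z i j))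
        * ((if v \<in> S then c v else 0) * echar h l v (z + axis i 2)))
      = (\<Sum>i\<in>UNIV. t ^ (CARD('n) - 1) * qpow h (l $ i) * ((if v \<in> S then c v else 0) * echar h l v z))"
    proof (rule sum.cong[OF refl])
      fix i
      have "echar h l v (z + axis i 2) = echar h l v z * (qpow h (l $ i) * qpow h (complex_of_real (2 * v $ i)))"
        unfolding echar_add_right echar_axis qpow_add[symmetric] by (simp add: algebra_simps)
      then show "(\<Prod>j\<in>UNIV - {i}. if v $ j < v $ i then t\<^sup>2 else if v $ i < v $ j then 1 else pair_a t (xratio h z i j))
          * ((if v \<in> S then c v else 0) * echar h l v (z + axis i 2))
        = t ^ (CARD('n) - 1) * qpow h (l $ i) * ((if v \<in> S then c v else 0) * echar h l v z)"
        unfolding separated_leading_coeff[OF t sv z, of i, symmetric] by (simp only: ac_simps)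
    qed
    also have "\<dots> = e * (if v \<in> S then c v else 0) * echar h l v z"
      unfolding e_def orbitsum1_def sum_distrib_left sum_distrib_right by (simp only: ac_simps)
    finally have "(if v \<in> T then g v else 0) * echar h l v z = (e * (if v \<in> S then c v else 0)) * echar h l v z"
      by (simp only: div_0 add_0_right)
    then show ?thesis unfolding D_def by (simp only: mult_right_cancel[OF echar_nonzero] diff_self)
  qed
  have diff: "G w - e * f w = esum h l (T \<union> S) D w" for w
  proof -
    have "G w = esum h l (T \<union> S) (\<lambda>u. if u \<in> T then g u else 0) w"
      unfolding GT using T(1) S(1) by (subst esum_extend[of "T \<union> S" T]) auto
    moreover have "f w = esum h l (T \<union> S) (\<lambda>u. if u \<in> S then c u else 0) w"
      unfolding f_def using T(1) S(1) by (subst esum_extend[of "T \<union> S" S]) auto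
    ultimately show ?thesis
      by (simp add: esum_def D_def left_diff_distrib sum_subtractf sum_distrib_left mult.assoc)
  qed
  \<comment> \<open>The support is moved into \<Lambda>, with coefficient 0 at exponents that do not
    occur. This is possible because the nonzero coefficients of the difference sit at exponents that
    are not separated.\<close>
  define D' where "D' u = (if u \<in> T \<union> S then D u else 0)" for u
  have diff': "G w - e * f w = esum h l \<Lambda> D' w" for w
  proof -
    have "esum h l (T \<union> S) D w = (\<Sum>u\<in>{u\<in>T \<union> S. D u \<noteq> 0}. D u * echar h l u w)"
      unfolding esum_def using T(1) S(1) by (intro sum.mono_neutral_right) auto
    also have "\<dots> = (\<Sum>u\<in>\<Lambda>. D' u * echar h l u w)"
    proof (rule sum.mono_neutral_cong_left)
      show "{u \<in> T \<union> S. D u \<noteq> 0} \<subseteq> \<Lambda>"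
      proof
        fix u assume u: "u \<in> {u \<in> T \<union> S. D u \<noteq> 0}"
        then have "norm u \<le> R" using TR S(2) by (auto simp: R_def)
        then have "\<not> separated m u" using D0 u by auto
        moreover have "u \<in> A" using u T(2) SA by auto
        ultimately show "u \<in> \<Lambda>" using \<open>norm u \<le> R\<close> \<Lambda>(2) by (auto simp: A_def R_def)
      qed
    qed (use \<Lambda>(1) in \<open>auto simp: D'_def\<close>)
    finally show ?thesis unfolding diff by (simp add: esum_def)
  qed
  have "BA_conditions h m (esum h l \<Lambda> D')"
    unfolding diff'[symmetric, abs_def] BA_conditions_def
  proof (intro ballI allI impI)
    fix j a b \<epsilon> and w :: "complex ^ 'n"
    assume *: "j \<in> {1..m}" "\<epsilon> \<in> {1, -1 :: complex}" "a \<noteq> b" "qpow h (w $ a / 2) = \<epsilon> * qpow h (w $ b / 2)"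
    have "G (w + axis a (of_nat j)) = \<epsilon> ^ j * G (w + axis b (of_nat j))"
      "f (w + axis a (of_nat j)) = \<epsilon> ^ j * f (w + axis b (of_nat j))"
      using * BG f[folded f_def] unfolding BA_conditions_def by blast+
    then show "G (w + axis a (of_nat j)) - e * f (w + axis a (of_nat j))
        = \<epsilon> ^ j * (G (w + axis b (of_nat j)) - e * f (w + axis b (of_nat j)))"
      by (simp add: algebra_simps)
  qed
  from uniq[OF this] have "esum h l \<Lambda> D' z = 0" by (simp add: esum_def)
  then have "G z = e * f z" using diff'[of z] by simp
  then show ?thesis using G(2)[OF z] by (simp add: f_def e_def)
qed

end

subsection \<open>Difference operators\<close>

lemma sum_off_diag_symmetric:
  fixes g :: "'n::{finite, linorder} \<Rightarrow> 'n \<Rightarrow> complex"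
  assumes "\<And>i j. g i j = g j i"
  shows "(\<Sum>(i, j)\<in>off_diag. g i j) = 2 * (\<Sum>(i, j) | i < j. g i j)"
proof -
  have fin: "finite {(i, j). i < (j :: 'n)}" by (rule finite_subset[of _ UNIV]) auto
  have split: "(off_diag :: ('n \<times> 'n) set) = {(i, j). i < j} \<union> prod.swap ` {(i, j). i < j}"
    by (auto simp: off_diag_def image_iff)
  have "(\<Sum>(i, j)\<in>off_diag. g i j) = (\<Sum>(i, j)\<in>{(i, j). i < j}. g i j) + (\<Sum>(i, j)\<in>prod.swap ` {(i, j). i < j}. g i j)"
    unfolding split using fin by (intro sum.union_disjoint) auto
  also have "(\<Sum>(i, j)\<in>prod.swap ` {(i, j). i < j}. g i j) = (\<Sum>(i, j)\<in>{(i, j). i < j}. g i j)"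
    by (subst sum.reindex) (auto simp: case_prod_beta assms[of "snd _"] intro!: sum.cong)
  finally show ?thesis by simp
qed

lemma ivec_axis [simp]: "ivec (axis i c) = axis i (of_int c)"
  by (simp add: ivec_def axis_def vec_eq_iff)

lemma ivec_add [simp]: "ivec (a + b) = ivec a + ivec b"
  by (simp add: ivec_def vec_eq_iff)

lemma dop_apply_superset:
  assumes "finite K" "\<And>k. k \<notin> K \<Longrightarrow> D k = (\<lambda>_. 0)"
  shows "dop_apply D f z = (\<Sum>k\<in>K. D k z * f (z + ivec k))"
  unfolding dop_apply_def using assms by (intro sum.mono_neutral_left) auto

definition D21_support :: "(int ^ 'n) set" where
  "D21_support = range (\<lambda>i. axis i 2) \<union> (\<lambda>(i, j). axis i 1 + axis j 1) ` off_diag"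

lemma finite_D21_support: "finite (D21_support :: (int ^ 'n) set)"
  by (simp add: D21_support_def)

lemma perm_vec_inject:
  assumes "p permutes UNIV"
  shows "perm_vec p u = perm_vec p v \<longleftrightarrow> u = v"
proof
  assume eq: "perm_vec p u = perm_vec p v"
  show "u = v"
  proof (subst vec_eq_iff, rule allI)
    fix i
    obtain j where "i = p j" using permutes_surj[OF assms] by blast
    then show "u $ i = v $ i" using arg_cong[OF eq, of "\<lambda>x. x $ j"] by (simp add: perm_vec_def)
  qed
qed simp

lemma perm_vec_axis:
  assumes "p permutes UNIV"
  shows "perm_vec p (axis (p i) c) = axis i c"
  using permutes_inj[OF assms] by (auto simp: perm_vec_def axis_def vec_eq_iff inj_eq)

lemma perm_vec_add: "perm_vec p (u + v) = perm_vec p u + perm_vec p v"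
  by (simp add: perm_vec_def vec_eq_iff)

context generic_q
begin

lemma D21_eq:
  fixes k :: "int ^ 'n :: {finite, linorder}"
  shows "D21 h t k z = (\<Sum>i\<in>UNIV. if k = axis i 2 then coeff_a h t i z else 0) +
    (\<Sum>(i, j)\<in>off_diag. if k = axis i 1 + axis j 1 then coeff_b h t i j z else 0) / 2"
proof -
  have "(\<Sum>(i, j)\<in>off_diag. if k = axis i 1 + axis j 1 then coeff_b h t i j z else 0)
     = 2 * (\<Sum>(i, j) | i < j. if k = axis i 1 + axis j 1 then coeff_b h t i j z else 0)"
    by (rule sum_off_diag_symmetric) (simp add: add.commute coeff_b_commute[of t])
  then show ?thesis by (simp add: D21_def dop_monom_def)
qed

lemma D21_outside: "k \<notin> D21_support \<Longrightarrow> D21 h t k z = 0"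
  unfolding D21_eq D21_support_def by (auto intro!: sum.neutral simp: image_iff)

lemma dop_apply_D21_normalised:
  fixes f :: "complex ^ 'n :: {finite, linorder} \<Rightarrow> complex"
  shows "dop_apply (D21_normalised h t) f z = 1 / t ^ (CARD('n) - 1) * twisted_op t f z"
proof -
  let ?K = "D21_support :: (int ^ 'n :: {finite, linorder}) set"
  have "dop_apply (D21_normalised h t) f z = (\<Sum>k\<in>?K. D21_normalised h t k z * f (z + ivec k))"
    by (rule dop_apply_superset[OF finite_D21_support])
      (auto simp: D21_normalised_def dop_scale_def D21_outside)
  also have "\<dots> = 1 / t ^ (CARD('n) - 1) * (\<Sum>k\<in>?K. D21 h t k z * f (z + ivec k))"
    by (simp add: D21_normalised_def dop_scale_def sum_distrib_left)
  also have "(\<Sum>k\<in>?K. D21 h t k z * f (z + ivec k))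
      = (\<Sum>k\<in>?K. \<Sum>i\<in>UNIV. if k = axis i 2 then coeff_a h t i z * f (z + ivec k) else 0)
      + (\<Sum>k\<in>?K. \<Sum>p\<in>off_diag. if k = axis (fst p) 1 + axis (snd p) 1 then coeff_b h t (fst p) (snd p) z * f (z + ivec k) else 0) / 2"
    unfolding D21_eq case_prod_beta distrib_right sum.distrib sum_distrib_right times_divide_eq_left sum_divide_distrib
    by (intro arg_cong2[where f = "(+)"] sum.cong refl) auto
  also have "(\<Sum>k\<in>?K. \<Sum>i\<in>UNIV. if k = axis i 2 then coeff_a h t i z * f (z + ivec k) else 0)
      = (\<Sum>i\<in>UNIV. coeff_a h t i z * f (z + axis i 2))"
  proof (subst sum.swap, rule sum.cong[OF refl])
    fix i
    have "axis i 2 \<in> ?K" by (auto simp: D21_support_def)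
    then show "(\<Sum>k\<in>?K. if k = axis i 2 then coeff_a h t i z * f (z + ivec k) else 0) = coeff_a h t i z * f (z + axis i 2)"
      by (simp add: sum.delta[OF finite_D21_support])
  qed
  also have "(\<Sum>k\<in>?K. \<Sum>p\<in>off_diag. if k = axis (fst p) 1 + axis (snd p) 1 then coeff_b h t (fst p) (snd p) z * f (z + ivec k) else 0)
      = (\<Sum>p\<in>off_diag. coeff_b h t (fst p) (snd p) z * f (z + (axis (fst p) 1 + axis (snd p) 1)))"
  proof (subst sum.swap, rule sum.cong[OF refl])
    fix p :: "'n \<times> 'n" assume "p \<in> off_diag"
    then have "axis (fst p) 1 + axis (snd p) 1 \<in> ?K" by (auto simp: D21_support_def image_iff case_prod_beta)
    then show "(\<Sum>k\<in>?K. if k = axis (fst p) 1 + axis (snd p) 1 then coeff_b h t (fst p) (snd p) z * f (z + ivec k) else 0)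
        = coeff_b h t (fst p) (snd p) z * f (z + (axis (fst p) 1 + axis (snd p) 1))"
      by (simp add: sum.delta[OF finite_D21_support])
  qed
  finally show ?thesis by (simp add: twisted_op_def case_prod_beta)
qed

lemma polar_D21: "polar 0 half_lattice (D21 h t k)"
proof -
  have 1: "polar 0 half_lattice (\<lambda>z. if P then g z else 0)" if "P \<Longrightarrow> polar 0 half_lattice g" for P g
    using that polar_ep[OF ep_0] by (cases P) auto
  have "polar 0 half_lattice (\<lambda>z. (\<Sum>i\<in>UNIV. if k = axis i 2 then coeff_a h t i z else 0) +
    (1 / 2) * (\<Sum>p\<in>off_diag. if k = axis (fst p) 1 + axis (snd p) 1 then coeff_b h t (fst p) (snd p) z else 0))"
    by (intro polar_add polar_sum 1 polar_mult[OF polar_ep[OF ep_const]] polar_coeff_a polar_coeff_b hl_closed_half_lattice)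
      (auto simp: off_diag_def)
  then show ?thesis by (simp add: D21_eq[abs_def] case_prod_beta)
qed

lemma diffop_D21_normalised: "diffop h (D21_normalised h t)"
  unfolding diffop_def
proof (intro conjI allI)
  show "finite {k. D21_normalised h t k \<noteq> (\<lambda>_. 0)}"
    by (rule finite_subset[OF _ finite_D21_support])
      (rule subsetI, rule ccontr, simp add: D21_normalised_def dop_scale_def D21_outside)
  show "rational h (D21_normalised h t k)" for k
    unfolding D21_normalised_def dop_scale_def
    by (intro polar_rational polar_mult[OF polar_ep[OF ep_const]] polar_D21 hl_closed_half_lattice)
qed

lemma weyl_invariant_D21_normalised: "weyl_invariant h (D21_normalised h t :: ('n :: {finite, linorder}) dop)"
proof -
  have "D21 h t (perm_vec p k) (perm_vec p z) = D21 h t k z" if p: "p permutes UNIV"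
    for p :: "'n \<Rightarrow> 'n" and k :: "int ^ 'n :: {finite, linorder}" and z
  proof -
    have bij: "bij p" by (rule permutes_bij[OF p])
    have a: "coeff_a h t i (perm_vec p z) = coeff_a h t (p i) z" for i
      by (rule coeff_covariant(1)[OF bij, of "\<lambda>_. 1"]) (auto simp: perm_vec_def)
    have b: "coeff_b h t i j (perm_vec p z) = coeff_b h t (p i) (p j) z" for i j
      using coeff_covariant(2)[OF bij, of "\<lambda>_. 1" "perm_vec p z" z t i j] by (simp add: perm_vec_def)
    have k1: "perm_vec p k = axis i 2 \<longleftrightarrow> k = axis (p i) 2" for i
      using perm_vec_inject[OF p, of k "axis (p i) 2"] by (simp add: perm_vec_axis[OF p])
    have k2: "perm_vec p k = axis i 1 + axis j 1 \<longleftrightarrow> k = axis (p i) 1 + axis (p j) 1" for i j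
      using perm_vec_inject[OF p, of k "axis (p i) 1 + axis (p j) 1"] by (simp add: perm_vec_add perm_vec_axis[OF p])
    have bij2: "bij_betw (map_prod p p) off_diag off_diag"
    proof (rule bij_betw_byWitness[where f' = "map_prod (inv p) (inv p)"])
    qed (use permutes_inverses[OF p] in \<open>auto simp: off_diag_def dest: arg_cong[of _ _ p] arg_cong[of _ _ "inv p"]\<close>)
    have "(\<Sum>i\<in>UNIV. if k = axis (p i) 2 then coeff_a h t (p i) z else 0) = (\<Sum>i\<in>UNIV. if k = axis i 2 then coeff_a h t i z else 0)"
      by (rule sum.reindex_bij_betw[OF bij])
    moreover have "(\<Sum>x\<in>off_diag. if k = axis (p (fst x)) 1 + axis (p (snd x)) 1 then coeff_b h t (p (fst x)) (p (snd x)) z else 0)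
       = (\<Sum>x\<in>off_diag. if k = axis (fst x) 1 + axis (snd x) 1 then coeff_b h t (fst x) (snd x) z else 0)"
      using sum.reindex_bij_betw[OF bij2, of "\<lambda>x. if k = axis (fst x) 1 + axis (snd x) 1 then coeff_b h t (fst x) (snd x) z else 0"]
      unfolding fst_map_prod snd_map_prod .
    ultimately show ?thesis unfolding D21_eq k1 k2 a b case_prod_beta by simp
  qed
  then show ?thesis unfolding weyl_invariant_def D21_normalised_def dop_scale_def
    by (auto intro: generically_True)
qed

section \<open>The eigenvalue equation for the normalised operator\<close>

lemma BA_form_esum:
  "BA_form h m l f \<longleftrightarrow> (\<exists>c. f = esum h l (BA_support m) c)"
proof -
  have "qpow h (bil l z / 2) * (\<Sum>v\<in>BA_support m. c v * qpow h (bil (cvec v) z)) = esum h l (BA_support m) c z" for c z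
    by (simp add: esum_def echar_def qpow_add sum_distrib_left ac_simps)
  then show ?thesis unfolding BA_form_def fun_eq_iff by simp
qed

text \<open>In HOL a sum over an infinite set is 0, so an infinite support would force \<psi> to
  vanish.\<close>

lemma twisted_BA_finite_support:
  fixes \<psi> :: "complex ^ 'n :: {finite, linorder} \<Rightarrow> complex ^ 'n :: {finite, linorder} \<Rightarrow> complex"
  assumes "twisted_BA h m \<psi>"
  shows "finite (BA_support m :: (real ^ 'n :: {finite, linorder}) set)"
proof -
  obtain l :: "complex ^ 'n :: {finite, linorder}" where "\<psi> l \<noteq> (\<lambda>_. 0)" "BA_form h m l (\<psi> l)"
    using generically_ex[OF assms[unfolded twisted_BA_def]] by blast
  then show ?thesis unfolding BA_form_esum by (auto simp: esum_def[abs_def] intro: ccontr)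
qed

lemma finite_half_lattice_cball:
  "finite {u :: real ^ 'n. u \<in> half_lattice \<and> norm u \<le> R}"
proof -
  define N where "N = \<lceil>2 * \<bar>R\<bar>\<rceil>"
  have "{u :: real ^ 'n. u \<in> half_lattice \<and> norm u \<le> R} \<subseteq> (\<lambda>k. \<chi> i. of_int (k i) / 2) ` (UNIV \<rightarrow>\<^sub>E {- N..N})"
  proof
    fix u :: "real ^ 'n" assume u: "u \<in> {u. u \<in> half_lattice \<and> norm u \<le> R}"
    have b: "of_int \<lfloor>2 * u $ i\<rfloor> = 2 * u $ i" "\<lfloor>2 * u $ i\<rfloor> \<in> {- N..N}" for i
    proof -
      show *: "of_int \<lfloor>2 * u $ i\<rfloor> = 2 * u $ i" using u by (auto simp: half_lattice_def)
      have "\<bar>2 * u $ i\<bar> \<le> 2 * \<bar>R\<bar>" using component_le_norm_cart[of u i] u by auto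
      then have "\<bar>real_of_int \<lfloor>2 * u $ i\<rfloor>\<bar> \<le> of_int N" unfolding * N_def by linarith
      then show "\<lfloor>2 * u $ i\<rfloor> \<in> {- N..N}" by (simp add: abs_le_iff)
    qed
    show "u \<in> (\<lambda>k. \<chi> i. of_int (k i) / 2) ` (UNIV \<rightarrow>\<^sub>E {- N..N})"
    proof (rule image_eqI[of _ _ "\<lambda>i. \<lfloor>2 * u $ i\<rfloor>"])
      show "u = (\<chi> i. of_int \<lfloor>2 * u $ i\<rfloor> / 2)" unfolding b(1) by (simp add: vec_eq_iff)
    qed (use b(2) in blast)
  qed
  then show ?thesis by (rule finite_subset) (simp add: finite_PiE)
qed

lemma twisted_hamiltonian_D21_normalised:
  fixes \<psi> :: "complex ^ 'n :: {finite, linorder} \<Rightarrow> complex ^ 'n :: {finite, linorder} \<Rightarrow> complex"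
  assumes BA: "twisted_BA h m \<psi>"
  shows "twisted_hamiltonian h \<psi> (orbitsum1 h) (D21_normalised h (1 / q ^ m))"
proof -
  define t where "t = 1 / q ^ m"
  let ?S = "BA_support m :: (real ^ 'n :: {finite, linorder}) set"
  define R where "R = norm (rank_vec m (id :: 'n \<Rightarrow> 'n))"
  have S: "finite ?S" "\<And>u. u \<in> ?S \<Longrightarrow> norm u \<le> R"
    using twisted_BA_finite_support[OF BA] BA_support_norm unfolding R_def norm_rho[symmetric] by blast+
  \<comment> \<open>All exponents that the difference of D f and its expected multiple can have. The
    set does not depend on \<lambda>, so genericity can be invoked before \<lambda> is fixed. The
    radius \<open>2 * R\<close> comes from |u| \<le> |u + s| + |s|.\<close>
  define \<Lambda> where "\<Lambda> = {w \<in> (\<lambda>(u, s). u + s) ` ({u \<in> half_lattice. norm u \<le> 2 * R} \<times> ?S). \<not> separated m w}"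
  have "finite ((\<lambda>(u, s). u + s) ` ({u \<in> half_lattice. norm u \<le> 2 * R} \<times> ?S))"
    by (intro finite_imageI finite_cartesian_product finite_half_lattice_cball S(1))
  then have fin: "finite \<Lambda>" by (rule rev_finite_subset) (auto simp: \<Lambda>_def)
  have \<Lambda>: "u + s \<in> \<Lambda>" if "s \<in> ?S" "u \<in> half_lattice" "norm (u + s) \<le> R" "\<not> separated m (u + s)" for u s
  proof -
    have "norm u \<le> norm (u + s) + norm s" by (metis add_diff_cancel_right' norm_triangle_ineq4)
    then have "norm u \<le> 2 * R" using S(2)[OF that(1)] that(3) by linarith
    then show ?thesis using that by (auto simp: \<Lambda>_def)
  qed
  have "generically h (\<lambda>l :: complex ^ 'n :: {finite, linorder}. \<forall>c. BA_conditions h m (esum h l \<Lambda> c) \<longrightarrow> (\<forall>v\<in>\<Lambda>. c v = 0))"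
    by (rule BA_unique_generic[OF fin]) (auto simp: \<Lambda>_def)
  from generically_conj[OF BA[unfolded twisted_BA_def] this]
  have eig: "generically h (\<lambda>l. generically h (\<lambda>z. dop_apply (D21_normalised h t) (\<psi> l) z = orbitsum1 h l * \<psi> l z))"
  proof (rule generically_mono)
    fix l :: "complex ^ 'n :: {finite, linorder}"
    assume l: "(\<psi> l \<noteq> (\<lambda>_. 0) \<and> BA_form h m l (\<psi> l) \<and> BA_conditions h m (\<psi> l)) \<and>
      (\<forall>c. BA_conditions h m (esum h l \<Lambda> c) \<longrightarrow> (\<forall>v\<in>\<Lambda>. c v = 0))"
    then obtain c where c: "\<psi> l = esum h l ?S c" unfolding BA_form_esum by blast
    show "generically h (\<lambda>z. dop_apply (D21_normalised h t) (\<psi> l) z = orbitsum1 h l * \<psi> l z)"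
      using generically_regular
    proof (rule generically_mono)
      fix z :: "complex ^ 'n :: {finite, linorder}" assume z: "regular_point z"
      have "twisted_op t (esum h l ?S c) z = t ^ (CARD('n) - 1) * orbitsum1 h l * esum h l ?S c z"
        by (rule twisted_op_eigenfunction[OF t_def, where k = "id :: 'n \<Rightarrow> 'n" and \<Lambda> = \<Lambda>])
          (use S fin \<Lambda> l c z in \<open>auto simp: R_def\<close>)
      moreover have "t \<noteq> 0" by (simp add: t_def)
      ultimately show "dop_apply (D21_normalised h t) (\<psi> l) z = orbitsum1 h l * \<psi> l z"
        unfolding dop_apply_D21_normalised c by simp
    qed
  qed
  then show ?thesis unfolding twisted_hamiltonian_def t_def[symmetric]
    using diffop_D21_normalised weyl_invariant_D21_normalised by blast
qed

section \<open>Uniqueness of the Hamiltonian\<close>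

lemma laurent_coeff_0:
  fixes K :: "(int ^ 'n) set"
  assumes "finite K" "\<And>z. (\<Sum>k\<in>K. c k * qpow h (bil (ivec k) z / 2)) = 0" "k \<in> K"
  shows "c k = 0"
proof -
  define e where "e k = (\<chi> i. (of_int (k $ i) / 2 :: real))" for k :: "int ^ 'n"
  have e: "qpow h (bil (ivec k) z / 2) = echar h 0 (e k) z" for k z
    by (simp add: echar_def e_def bil_def cvec_def ivec_def sum_divide_distrib)
  have inj: "inj e" by (auto simp: inj_def e_def vec_eq_iff)
  have "(\<Sum>j | j \<in> K \<and> (\<forall>w\<in>UNIV. echar h 0 (e j) w = echar h 0 (e k) w). c j) = 0"
    using assms by (intro character_classes) (auto simp: echar_add_right e)
  moreover have "{j. j \<in> K \<and> (\<forall>w\<in>UNIV. echar h 0 (e j) w = echar h 0 (e k) w)} = {k}"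
    using assms(3) inj by (auto simp: echar_eq_iff inj_eq)
  ultimately show ?thesis by simp
qed

lemma rational_diff:
  assumes "rational h f" "rational h g"
  shows "rational h (\<lambda>z. f z - g z)"
proof -
  obtain P Q where f: "laurent h P" "laurent h Q" "Q \<noteq> (\<lambda>_. 0)" "\<And>z. Q z \<noteq> 0 \<Longrightarrow> f z = P z / Q z"
    using assms(1) unfolding rational_def by blast
  obtain P' Q' where g: "laurent h P'" "laurent h Q'" "Q' \<noteq> (\<lambda>_. 0)" "\<And>z. Q' z \<noteq> 0 \<Longrightarrow> g z = P' z / Q' z"
    using assms(2) unfolding rational_def by blast
  show ?thesis unfolding rational_def
  proof (intro exI conjI allI impI)
    show "laurent h (\<lambda>z. P z * Q' z - P' z * Q z)" "laurent h (\<lambda>z. Q z * Q' z)"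
      by (intro laurent_diff laurent_mult f g)+
    show "(\<lambda>z. Q z * Q' z) \<noteq> (\<lambda>_. 0)" by (intro laurent_mult_nonzero f g)
    show "f z - g z = (P z * Q' z - P' z * Q z) / (Q z * Q' z)" if "Q z * Q' z \<noteq> 0" for z
      using that f(4)[of z] g(4)[of z] by (simp add: field_simps)
  qed
qed

text \<open>If \<open>\<Sum>\<^sub>k N\<^sub>k T\<^sup>k\<close> annihilates \<open>\<psi>\<close>, compare the coefficient of the product of a longest exponent
  of the \<open>N\<^sub>k\<close> and a suitable exponent of \<open>\<psi>\<close>: it is a nonzero Laurent polynomial in \<open>q\<^sup>\<lambda>\<^sup>/\<^sup>2\<close> times
  a coefficient of \<open>\<psi>\<close>.\<close>

lemma annihilator_trivial:
  fixes \<psi> :: "complex ^ 'n \<Rightarrow> complex ^ 'n \<Rightarrow> complex" and K :: "(int ^ 'n) set"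
  assumes K: "finite K" and N: "\<And>k. k \<in> K \<Longrightarrow> laurent h (N k)" and S: "finite S"
    and \<psi>: "generically h (\<lambda>l. \<psi> l \<noteq> (\<lambda>_. 0) \<and> (\<exists>c. \<psi> l = esum h l S c) \<and> (\<forall>z. (\<Sum>k\<in>K. N k z * \<psi> l (z + ivec k)) = 0))"
    and k: "k0 \<in> K"
  shows "N k0 z0 = 0"
proof (rule ccontr)
  assume nz: "N k0 z0 \<noteq> 0"
  have "\<forall>k\<in>K. \<exists>Sc. finite (fst Sc) \<and> N k = esum h 0 (fst Sc) (snd Sc)"
  proof
    fix k assume "k \<in> K"
    then obtain U c where "finite U" "N k = esum h 0 U c"
      using N[of k] unfolding laurent_ep by (blast elim: epE)
    then show "\<exists>Sc. finite (fst Sc) \<and> N k = esum h 0 (fst Sc) (snd Sc)" by (intro exI[of _ "(U, c)"]) simp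
  qed
  from bchoice[OF this] obtain Sc where Sc: "\<And>k. k \<in> K \<Longrightarrow> finite (fst (Sc k))"
    "\<And>k. k \<in> K \<Longrightarrow> N k = esum h 0 (fst (Sc k)) (snd (Sc k))" by blast
  define U where "U = (\<Union>k\<in>K. fst (Sc k))"
  define p where "p k u = (if u \<in> fst (Sc k) then snd (Sc k) u else 0)" for k u
  have U: "finite U" using K Sc by (simp add: U_def)
  define M where "M = {u\<in>U. \<exists>k\<in>K. p k u \<noteq> 0}"
  have M: "finite M" using U by (simp add: M_def)
  have Np: "N k z = (\<Sum>u\<in>M. p k u * echar h 0 u z)" if "k \<in> K" for k z
  proof -
    have "N k z = esum h 0 U (p k) z"
      unfolding Sc(2)[OF that] p_def by (subst esum_extend[of U]) (use U that in \<open>auto simp: U_def\<close>)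
    also have "\<dots> = (\<Sum>u\<in>M. p k u * echar h 0 u z)"
      unfolding esum_def by (rule sum.mono_neutral_right) (use U that in \<open>auto simp: M_def\<close>)
    finally show ?thesis .
  qed
  have "M \<noteq> {}" using nz Np[OF k, of z0] by auto
  then obtain u where u: "u \<in> M" "\<And>T. finite T \<Longrightarrow> T \<noteq> {} \<Longrightarrow>
    \<exists>v\<in>T. \<forall>u'\<in>M. \<forall>v'\<in>T. u' + v' = u + v \<longrightarrow> u' = u \<and> v' = v"
    using leading_exponent[OF M] by blast
  define R where "R v l = (\<Sum>k\<in>K. p k u * qpow h (bil (cvec v) (ivec k)) * qpow h (bil (ivec k) l / 2))"
    for v :: "real ^ 'n" and l :: "complex ^ 'n"
  have "laurent h (R v)" for v unfolding laurent_def R_def[abs_def]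
    by (intro exI[of _ K] exI[of _ "\<lambda>k. p k u * qpow h (bil (cvec v) (ivec k))"] conjI K refl)
  moreover have "R v \<noteq> (\<lambda>_. 0)" for v
  proof
    assume R0: "R v = (\<lambda>_. 0)"
    have "p k u = 0" if "k \<in> K" for k
      using laurent_coeff_0[OF K, of "\<lambda>k. p k u * qpow h (bil (cvec v) (ivec k))" k] fun_cong[OF R0] that
      by (simp add: R_def)
    then show False using u(1) by (auto simp: M_def)
  qed
  ultimately have "generically h (\<lambda>l. \<forall>v\<in>S. R v l \<noteq> 0)"
    using S by (intro generically_ball generically_laurent)
  from generically_ex[OF generically_conj[OF \<psi> this]] obtain l c where
    l: "\<psi> l \<noteq> (\<lambda>_. 0)" "\<psi> l = esum h l S c" "\<And>z. (\<Sum>k\<in>K. N k z * \<psi> l (z + ivec k)) = 0" "\<And>v. v \<in> S \<Longrightarrow> R v l \<noteq> 0"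
    by blast
  define T where "T = {v\<in>S. c v \<noteq> 0}"
  have T: "finite T" using S by (simp add: T_def)
  have \<psi>T: "\<psi> l z = (\<Sum>v\<in>T. c v * echar h l v z)" for z
    unfolding l(2) esum_def T_def using S by (intro sum.mono_neutral_right) auto
  have "T \<noteq> {}" using l(1) \<psi>T by auto
  from u(2)[OF T this] obtain v where v: "v \<in> T" "\<forall>u'\<in>M. \<forall>v'\<in>T. u' + v' = u + v \<longrightarrow> u' = u \<and> v' = v" by blast
  have bil_comm: "bil x y = bil y x" for x y :: "complex ^ 'n" by (simp add: bil_def mult.commute)
  have "(\<Sum>u\<in>M. \<Sum>v\<in>T. (\<Sum>k\<in>K. p k u * c v * echar h l v (ivec k)) * echar h l (u + v) z) = 0" for z
  proof -
    have "(\<Sum>k\<in>K. N k z * \<psi> l (z + ivec k)) = (\<Sum>k\<in>K. \<Sum>u\<in>M. \<Sum>v\<in>T. p k u * c v * echar h l v (ivec k) * echar h l (u + v) z)"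
      by (rule sum.cong[OF refl])
        (simp add: Np \<psi>T sum_product echar_add_right ac_simps flip: echar_mult)
    also have "\<dots> = (\<Sum>u\<in>M. \<Sum>v\<in>T. \<Sum>k\<in>K. p k u * c v * echar h l v (ivec k) * echar h l (u + v) z)"
      by (subst sum.swap, rule sum.cong[OF refl], rule sum.swap)
    finally show ?thesis using l(3) by (simp add: sum_distrib_right)
  qed
  from esum_pair_coeff_0[OF M T this u(1) v(1)] v(2)
  have "(\<Sum>k\<in>K. p k u * c v * echar h l v (ivec k)) = 0" by blast
  also have "(\<Sum>k\<in>K. p k u * c v * echar h l v (ivec k)) = c v * R v l"
    by (simp add: R_def sum_distrib_left echar_def qpow_add bil_comm[of l] ac_simps)
  finally show False using v(1) l(4) by (simp add: T_def)
qed

text \<open>A common denominator turns the difference of the two operators into one with Laurent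
  polynomial coefficients \<open>N k\<close> that annihilates \<psi>, and
  \<open>annihilator_trivial\<close> applies.\<close>

lemma twisted_hamiltonian_unique:
  fixes \<psi> :: "complex ^ 'n :: {finite, linorder} \<Rightarrow> complex ^ 'n :: {finite, linorder} \<Rightarrow> complex"
  assumes BA: "twisted_BA h m \<psi>" and D: "twisted_hamiltonian h \<psi> e D" and E: "twisted_hamiltonian h \<psi> e E"
  shows "dop_eq h D E"
proof -
  define K where "K = {k. D k \<noteq> (\<lambda>_. 0)} \<union> {k. E k \<noteq> (\<lambda>_. 0)}"
  have K: "finite K" using D E by (simp add: K_def twisted_hamiltonian_def diffop_def)
  have out: "D k = (\<lambda>_. 0)" "E k = (\<lambda>_. 0)" if "k \<notin> K" for k using that by (auto simp: K_def)
  have "\<forall>k\<in>K. \<exists>PQ. laurent h (fst PQ) \<and> laurent h (snd PQ) \<and> snd PQ \<noteq> (\<lambda>_. 0) \<and>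
    (\<forall>z. snd PQ z \<noteq> 0 \<longrightarrow> D k z - E k z = fst PQ z / snd PQ z)"
  proof
    fix k
    have "rational h (\<lambda>z. D k z - E k z)"
      using D E by (intro rational_diff) (auto simp: twisted_hamiltonian_def diffop_def)
    then obtain P Q where "laurent h P" "laurent h Q" "Q \<noteq> (\<lambda>_. 0)" "\<forall>z. Q z \<noteq> 0 \<longrightarrow> D k z - E k z = P z / Q z"
      unfolding rational_def by blast
    then show "\<exists>PQ. laurent h (fst PQ) \<and> laurent h (snd PQ) \<and> snd PQ \<noteq> (\<lambda>_. 0) \<and>
      (\<forall>z. snd PQ z \<noteq> 0 \<longrightarrow> D k z - E k z = fst PQ z / snd PQ z)"
      by (intro exI[of _ "(P, Q)"]) simp
  qed
  from bchoice[OF this] obtain PQ where PQ: "\<And>k. k \<in> K \<Longrightarrow> laurent h (fst (PQ k))" "\<And>k. k \<in> K \<Longrightarrow> laurent h (snd (PQ k))"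
    "\<And>k. k \<in> K \<Longrightarrow> snd (PQ k) \<noteq> (\<lambda>_. 0)"
    "\<And>k z. k \<in> K \<Longrightarrow> snd (PQ k) z \<noteq> 0 \<Longrightarrow> D k z - E k z = fst (PQ k) z / snd (PQ k) z" by blast
  define Q where "Q z = (\<Prod>k\<in>K. snd (PQ k) z)" for z
  define N where "N k z = fst (PQ k) z * (\<Prod>j\<in>K - {k}. snd (PQ j) z)" for k z
  have Q: "laurent h Q" "Q \<noteq> (\<lambda>_. 0)"
    unfolding Q_def[abs_def] by (rule laurent_prod laurent_prod_nonzero; use K PQ in blast)+
  have N: "laurent h (N k)" if "k \<in> K" for k
    unfolding N_def[abs_def] using K PQ that by (intro laurent_mult laurent_prod) auto
  have NQ: "N k z = (D k z - E k z) * Q z" if "k \<in> K" "Q z \<noteq> 0" for k z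
  proof -
    have "snd (PQ k) z \<noteq> 0" using that K by (auto simp: Q_def)
    moreover have "Q z = snd (PQ k) z * (\<Prod>j\<in>K - {k}. snd (PQ j) z)"
      unfolding Q_def by (rule prod.remove[OF K that(1)])
    ultimately show ?thesis using PQ(4)[OF that(1), of z] by (simp add: N_def)
  qed
  have "generically h (\<lambda>l. (\<psi> l \<noteq> (\<lambda>_. 0) \<and> BA_form h m l (\<psi> l) \<and> BA_conditions h m (\<psi> l)) \<and>
    generically h (\<lambda>z. dop_apply D (\<psi> l) z = e l * \<psi> l z) \<and> generically h (\<lambda>z. dop_apply E (\<psi> l) z = e l * \<psi> l z))"
    using BA D E unfolding twisted_BA_def twisted_hamiltonian_def
    by (elim conjE) (rule generically_conj[OF _ generically_conj])
  then have gen: "generically h (\<lambda>l. \<psi> l \<noteq> (\<lambda>_. 0) \<and> (\<exists>c. \<psi> l = esum h l (BA_support m) c) \<and>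
    (\<forall>z. (\<Sum>k\<in>K. N k z * \<psi> l (z + ivec k)) = 0))"
  proof (rule generically_mono)
    fix l :: "complex ^ 'n :: {finite, linorder}"
    assume l: "(\<psi> l \<noteq> (\<lambda>_. 0) \<and> BA_form h m l (\<psi> l) \<and> BA_conditions h m (\<psi> l)) \<and>
      generically h (\<lambda>z. dop_apply D (\<psi> l) z = e l * \<psi> l z) \<and> generically h (\<lambda>z. dop_apply E (\<psi> l) z = e l * \<psi> l z)"
    then obtain c where c: "\<psi> l = esum h l (BA_support m) c" unfolding BA_form_esum by blast
    have ep\<psi>: "ep h l UNIV (\<psi> l)" unfolding c by (rule epI) (use twisted_BA_finite_support[OF BA] in auto)
    have "generically h (\<lambda>z. dop_apply D (\<psi> l) z = e l * \<psi> l z \<and> dop_apply E (\<psi> l) z = e l * \<psi> l z)"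
      using l by (intro generically_conj) auto
    then obtain Q' where Q': "laurent h Q'" "Q' \<noteq> (\<lambda>_. 0)"
      "\<And>z. Q' z \<noteq> 0 \<Longrightarrow> dop_apply D (\<psi> l) z = e l * \<psi> l z \<and> dop_apply E (\<psi> l) z = e l * \<psi> l z"
      unfolding generically_def by blast
    \<comment> \<open>The eigenvalue equations hold only off the zeros of a polynomial
      \<open>Q'\<close> depending on \<lambda>. Multiplied by Q' Q the sum vanishes everywhere, and
      there are no zero divisors.\<close>
    have "(\<Sum>k\<in>K. N k z * \<psi> l (z + ivec k)) = 0" for z
    proof (rule ep_domain)
      show "ep h 0 half_lattice (\<lambda>z. Q' z * Q z)"
        unfolding laurent_ep[symmetric] by (intro laurent_mult Q' Q)
      show "(\<lambda>z. Q' z * Q z) \<noteq> (\<lambda>_. 0)" by (intro laurent_mult_nonzero Q Q')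
      show "ep h l UNIV (\<lambda>z. \<Sum>k\<in>K. N k z * \<psi> l (z + ivec k))"
        using N by (intro ep_sum K ep_mult[OF _ ep_shift[OF ep\<psi>], of half_lattice]) (auto simp: laurent_ep)
      fix z :: "complex ^ 'n :: {finite, linorder}"
      show "Q' z * Q z * (\<Sum>k\<in>K. N k z * \<psi> l (z + ivec k)) = 0"
      proof (cases "Q' z = 0 \<or> Q z = 0")
        case False
        have "(\<Sum>k\<in>K. N k z * \<psi> l (z + ivec k)) = (\<Sum>k\<in>K. Q z * (D k z * \<psi> l (z + ivec k) - E k z * \<psi> l (z + ivec k)))"
        proof (rule sum.cong[OF refl])
          fix k assume "k \<in> K"
          then have NDE: "N k z = (D k z - E k z) * Q z" using NQ False by blast
          show "N k z * \<psi> l (z + ivec k) = Q z * (D k z * \<psi> l (z + ivec k) - E k z * \<psi> l (z + ivec k))"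
            unfolding NDE by (simp add: algebra_simps)
        qed
        also have "\<dots> = Q z * (dop_apply D (\<psi> l) z - dop_apply E (\<psi> l) z)"
          by (simp only: dop_apply_superset[OF K out(1)] dop_apply_superset[OF K out(2)] simp_thms
              sum_distrib_left sum_subtractf right_diff_distrib)
        finally show ?thesis using Q'(3)[of z] False by simp
      qed auto
    qed
    then show "\<psi> l \<noteq> (\<lambda>_. 0) \<and> (\<exists>c. \<psi> l = esum h l (BA_support m) c) \<and> (\<forall>z. (\<Sum>k\<in>K. N k z * \<psi> l (z + ivec k)) = 0)"
      using l c by blast
  qed
  have N0: "N k z = 0" if "k \<in> K" for k z
    by (rule annihilator_trivial[OF K N twisted_BA_finite_support[OF BA] gen that])
  show ?thesis unfolding dop_eq_def
  proof
    fix k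
    show "generically h (\<lambda>z. D k z = E k z)"
    proof (cases "k \<in> K")
      case True
      show ?thesis
        using generically_laurent[OF Q] by (rule generically_mono) (use NQ[OF True] N0[OF True] in auto)
    next
      case False
      then show ?thesis using out[OF False] generically_True by simp
    qed
  qed
qed

subsection \<open>Families in \<open>t\<close>\<close>

lemma rational_mult:
  assumes "rational h f" "rational h g"
  shows "rational h (\<lambda>z. f z * g z)"
proof -
  obtain P Q where f: "laurent h P" "laurent h Q" "Q \<noteq> (\<lambda>_. 0)" "\<And>z. Q z \<noteq> 0 \<Longrightarrow> f z = P z / Q z"
    using assms(1) unfolding rational_def by blast
  obtain P' Q' where g: "laurent h P'" "laurent h Q'" "Q' \<noteq> (\<lambda>_. 0)" "\<And>z. Q' z \<noteq> 0 \<Longrightarrow> g z = P' z / Q' z"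
    using assms(2) unfolding rational_def by blast
  show ?thesis unfolding rational_def
  proof (intro exI conjI allI impI)
    show "laurent h (\<lambda>z. P z * P' z)" "laurent h (\<lambda>z. Q z * Q' z)"
      by (intro laurent_mult f g)+
    show "(\<lambda>z. Q z * Q' z) \<noteq> (\<lambda>_. 0)" by (intro laurent_mult_nonzero f g)
    show "f z * g z = P z * P' z / (Q z * Q' z)" if "Q z * Q' z \<noteq> 0" for z
      using that f(4)[of z] g(4)[of z] by simp
  qed
qed

lemma rational_ep: "ep h 0 half_lattice f \<Longrightarrow> rational h f"
  by (intro polar_rational polar_ep)

lemma rational_add:
  assumes "rational h f" "rational h g"
  shows "rational h (\<lambda>z. f z + g z)"
  using rational_diff[OF assms(1) rational_diff[OF rational_ep[OF ep_0] assms(2)]] by simp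

text \<open>The identities between such families hold at every point, also at zeros of the denominators, where
  both sides use the convention \<open>x / 0 = 0\<close>.\<close>

inductive t_poly :: "(complex \<Rightarrow> complex ^ 'n \<Rightarrow> complex) \<Rightarrow> bool" where
  coeff: "rational h C \<Longrightarrow> t_poly (\<lambda>t. C)"
| times_t: "t_poly \<phi> \<Longrightarrow> t_poly (\<lambda>t z. t * \<phi> t z)"
| add: "t_poly \<phi> \<Longrightarrow> t_poly \<psi> \<Longrightarrow> t_poly (\<lambda>t z. \<phi> t z + \<psi> t z)"

lemma t_poly_rational_mult: "t_poly \<phi> \<Longrightarrow> rational h C \<Longrightarrow> t_poly (\<lambda>t z. C z * \<phi> t z)"
proof (induction rule: t_poly.induct)
  case (coeff D)
  then show ?case using t_poly.coeff[OF rational_mult] by blast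
next
  case (times_t \<phi>)
  then show ?case using t_poly.times_t[of "\<lambda>t z. C z * \<phi> t z"] by (simp add: mult.left_commute)
next
  case (add \<phi> \<psi>)
  then show ?case using t_poly.add[of "\<lambda>t z. C z * \<phi> t z" "\<lambda>t z. C z * \<psi> t z"] by (simp add: distrib_left)
qed

lemma t_poly_mult: "t_poly \<phi> \<Longrightarrow> t_poly \<psi> \<Longrightarrow> t_poly (\<lambda>t z. \<phi> t z * \<psi> t z)"
proof (induction rule: t_poly.induct)
  case (coeff C)
  then show ?case using t_poly_rational_mult by blast
next
  case (times_t \<phi>)
  then show ?case using t_poly.times_t[of "\<lambda>t z. \<phi> t z * \<psi> t z"] by (simp add: mult.assoc)
next
  case (add \<phi> \<phi>')
  then show ?case using t_poly.add[of "\<lambda>t z. \<phi> t z * \<psi> t z" "\<lambda>t z. \<phi>' t z * \<psi> t z"] by (simp add: distrib_right)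
qed

lemma t_poly_ep: "ep h 0 half_lattice f \<Longrightarrow> t_poly (\<lambda>t. f)"
  by (intro t_poly.coeff rational_ep)

lemma t_poly_const: "t_poly (\<lambda>t z. k)"
  by (rule t_poly_ep[OF ep_const])

lemma t_poly_sum: "finite I \<Longrightarrow> (\<And>i. i \<in> I \<Longrightarrow> t_poly (f i)) \<Longrightarrow> t_poly (\<lambda>t z. \<Sum>i\<in>I. f i t z)"
proof (induction I rule: finite_induct)
  case empty
  then show ?case using t_poly_const[of 0] by simp
next
  case (insert i I)
  then show ?case using t_poly.add[of "f i" "\<lambda>t z. \<Sum>i\<in>I. f i t z"] by simp
qed

lemma t_poly_prod: "finite I \<Longrightarrow> (\<And>i. i \<in> I \<Longrightarrow> t_poly (f i)) \<Longrightarrow> t_poly (\<lambda>t z. \<Prod>i\<in>I. f i t z)"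
proof (induction I rule: finite_induct)
  case empty
  then show ?case using t_poly_const[of 1] by simp
next
  case (insert i I)
  then show ?case using t_poly_mult[of "f i" "\<lambda>t z. \<Prod>i\<in>I. f i t z"] by simp
qed

lemma t_poly_linear: "rational h C \<Longrightarrow> t_poly (\<lambda>t z. k - k' * t * C z)"
proof -
  assume C: "rational h C"
  have "t_poly (\<lambda>t z. k + t * (- k' * C z))"
    by (intro t_poly.add t_poly_const t_poly.times_t t_poly.coeff rational_mult[OF rational_ep[OF ep_const] C])
  then show ?thesis by (simp add: mult_ac)
qed

lemma rational_xratio: "rational h (\<lambda>z. xratio h z i j)"
  by (rule rational_ep[OF ep_xratio])

lemma t_poly_coeff_a: "t_poly (\<lambda>t. coeff_a h t i)"
proof -
  have "t_poly (\<lambda>t z. \<Prod>j\<in>UNIV - {i}. ((1 - 1 * t * xratio h z i j) * (1 - q * t * xratio h z i j)) *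
      (1 / (1 - xratio h z i j) * (1 / (1 - q * xratio h z i j))))"
  proof (rule t_poly_prod)
    fix j assume "j \<in> UNIV - {i}"
    then have "rational h (\<lambda>z. 1 / (1 - xratio h z i j) * (1 / (1 - q * xratio h z i j)))"
      by (intro rational_mult polar_rational polar_inverse) auto
    then show "t_poly (\<lambda>t z. ((1 - 1 * t * xratio h z i j) * (1 - q * t * xratio h z i j)) *
      (1 / (1 - xratio h z i j) * (1 / (1 - q * xratio h z i j))))"
      by (intro t_poly_mult[OF t_poly_mult] t_poly_linear rational_xratio t_poly.coeff)
  qed simp
  then show ?thesis by (simp add: coeff_a_def[abs_def] qpow_1)
qed

lemma t_poly_coeff_b:
  assumes "i \<noteq> j"
  shows "t_poly (\<lambda>t. coeff_b h t i j)"
proof -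
  have t: "t_poly (\<lambda>t z. t - k)" for k
    using t_poly_linear[OF rational_ep[OF ep_const], of "- k" "- 1" 1] by simp
  have *: "t_poly (\<lambda>t z. ((Q * (t - 1)) * (t - q)) * (((xhalf_ratio h z i j + xhalf_ratio h z j i) *
      (1 / (1 - q * xratio h z i j) * (1 / (1 - q * xratio h z j i)))) *
      (\<Prod>l\<in>UNIV - {i, j}. ((1 - 1 * t * xratio h z i l) * (1 - 1 * t * xratio h z j l)) *
      (1 / (1 - xratio h z i l) * (1 / (1 - xratio h z j l))))))"
  proof (intro t_poly_mult[OF t_poly_mult[OF t_poly_mult[OF t_poly_const t] t] t_poly_mult])
    have "rational h (\<lambda>z. (xhalf_ratio h z i j + xhalf_ratio h z j i) *
      (1 / (1 - q * xratio h z i j) * (1 / (1 - q * xratio h z j i))))"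
      using assms by (intro rational_mult polar_rational polar_inverse rational_ep ep_add ep_xhalf_ratio) auto
    then show "t_poly (\<lambda>t z. (xhalf_ratio h z i j + xhalf_ratio h z j i) *
      (1 / (1 - q * xratio h z i j) * (1 / (1 - q * xratio h z j i))))" by (rule t_poly.coeff)
    show "t_poly (\<lambda>t z. \<Prod>l\<in>UNIV - {i, j}. ((1 - 1 * t * xratio h z i l) * (1 - 1 * t * xratio h z j l)) *
      (1 / (1 - xratio h z i l) * (1 / (1 - xratio h z j l))))"
    proof (rule t_poly_prod)
      fix l assume "l \<in> UNIV - {i, j}"
      then have "rational h (\<lambda>z. 1 / (1 - xratio h z i l) * (1 / (1 - xratio h z j l)))"
        by (intro rational_mult polar_rational polar_inverse) auto
      then show "t_poly (\<lambda>t z. ((1 - 1 * t * xratio h z i l) * (1 - 1 * t * xratio h z j l)) *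
        (1 / (1 - xratio h z i l) * (1 / (1 - xratio h z j l))))"
        by (intro t_poly_mult[OF t_poly_mult] t_poly_linear rational_xratio t_poly.coeff)
    qed simp
  qed
  have eq: "coeff_b h t i j z = ((Q * (t - 1)) * (t - q)) * (((xhalf_ratio h z i j + xhalf_ratio h z j i) *
      (1 / (1 - q * xratio h z i j) * (1 / (1 - q * xratio h z j i)))) *
      (\<Prod>l\<in>UNIV - {i, j}. ((1 - 1 * t * xratio h z i l) * (1 - 1 * t * xratio h z j l)) *
      (1 / (1 - xratio h z i l) * (1 / (1 - xratio h z j l)))))" for t z
    by (simp add: coeff_b_def qpow_1 Q_def mult.assoc)
  show ?thesis using * unfolding eq[symmetric] .
qed

lemma t_poly_D21: "t_poly (\<lambda>t. D21 h t k)"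
proof -
  have 1: "t_poly (\<lambda>t z. if P then g t z else 0)" if "P \<Longrightarrow> t_poly g" for P and g :: "complex \<Rightarrow> complex ^ 'a :: {finite, linorder} \<Rightarrow> complex"
    using that t_poly_const[of 0] by (cases P) auto
  have "t_poly (\<lambda>t z. (\<Sum>i\<in>UNIV. if k = axis i 2 then coeff_a h t i z else 0) +
    (1 / 2) * (\<Sum>p\<in>off_diag. if k = axis (fst p) 1 + axis (snd p) 1 then coeff_b h t (fst p) (snd p) z else 0))"
    by (intro t_poly.add t_poly_sum 1 t_poly_mult[OF t_poly_const] t_poly_coeff_a t_poly_coeff_b)
      (auto simp: off_diag_def)
  then show ?thesis by (simp add: D21_eq[abs_def] case_prod_beta)
qed

text \<open>The vanishing of the coefficients beyond \<open>N\<close> is recorded so that expansions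
  of different degrees can be padded to a common one.\<close>

lemma t_poly_expand:
  "t_poly \<phi> \<Longrightarrow> \<exists>N C. (\<forall>r. rational h (C r)) \<and> (\<forall>r>N. C r = (\<lambda>_. 0)) \<and> (\<forall>t z. \<phi> t z = (\<Sum>r\<le>N. t ^ r * C r z))"
proof (induction rule: t_poly.induct)
  case (coeff D)
  then show ?case
    using rational_ep[OF ep_0] by (intro exI[of _ 0] exI[of _ "\<lambda>r. if r = 0 then D else (\<lambda>_. 0)"]) auto
next
  case (times_t \<phi>)
  then obtain N :: nat and C where C: "\<And>r. rational h (C r)" "\<And>r. r > N \<Longrightarrow> C r = (\<lambda>_. 0)"
    "\<And>t z. \<phi> t z = (\<Sum>r\<le>N. t ^ r * C r z)" by blast
  define C' where "C' r = (case r of 0 \<Rightarrow> (\<lambda>_. 0) | Suc r \<Rightarrow> C r)" for r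
  have "(\<Sum>r\<le>Suc N. t ^ r * C' r z) = t * \<phi> t z" for t z
    by (subst sum.atMost_Suc_shift) (simp add: C'_def C(3) sum_distrib_left mult.assoc)
  moreover have "rational h (C' r)" for r using C(1) rational_ep[OF ep_0] by (cases r) (auto simp: C'_def)
  moreover have "C' r = (\<lambda>_. 0)" if "r > Suc N" for r using that C(2) by (cases r) (auto simp: C'_def)
  ultimately show ?case by (intro exI[of _ "Suc N"] exI[of _ C']) auto
next
  case (add \<phi> \<psi>)
  obtain N :: nat and C where C: "\<And>r. rational h (C r)" "\<And>r. r > N \<Longrightarrow> C r = (\<lambda>_. 0)"
    "\<And>t z. \<phi> t z = (\<Sum>r\<le>N. t ^ r * C r z)" using add.IH(1) by blast
  obtain N' :: nat and C' where C': "\<And>r. rational h (C' r)" "\<And>r. r > N' \<Longrightarrow> C' r = (\<lambda>_. 0)"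
    "\<And>t z. \<psi> t z = (\<Sum>r\<le>N'. t ^ r * C' r z)" using add.IH(2) by blast
  have "\<phi> t z = (\<Sum>r\<le>max N N'. t ^ r * C r z)" for t z
    unfolding C(3) by (rule sum.mono_neutral_left) (auto simp: C(2))
  moreover have "\<psi> t z = (\<Sum>r\<le>max N N'. t ^ r * C' r z)" for t z
    unfolding C'(3) by (rule sum.mono_neutral_left) (auto simp: C'(2))
  ultimately show ?case
    using C C' by (intro exI[of _ "max N N'"] exI[of _ "\<lambda>r z. C r z + C' r z"])
      (auto intro: rational_add simp: distrib_left sum.distrib)
qed

lemma laurent_family_D21_normalised:
  "laurent_family h (D21_normalised h :: complex \<Rightarrow> ('n :: {finite, linorder}) dop)"
proof -
  define P where "P k NC \<longleftrightarrow> (\<forall>r. rational h (snd NC r)) \<and> (\<forall>r>fst NC. snd NC r = (\<lambda>_. 0)) \<and>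
    (\<forall>t z. D21 h t k z = (\<Sum>r\<le>fst NC. t ^ r * snd NC r z))"
    for k :: "int ^ 'n :: {finite, linorder}" and NC
  have "\<forall>k. \<exists>NC. P k NC"
  proof
    fix k :: "int ^ 'n :: {finite, linorder}"
    obtain N C where "(\<forall>r. rational h (C r)) \<and> (\<forall>r>N. C r = (\<lambda>_. 0)) \<and> (\<forall>t z. D21 h t k z = (\<Sum>r\<le>N. t ^ r * C r z))"
      using t_poly_expand[OF t_poly_D21, of k] by blast
    then show "\<exists>NC. P k NC" unfolding P_def by (intro exI[of _ "(N, C)"]) simp
  qed
  from choice[OF this] obtain NC where "\<And>k. P k (NC k)" by blast
  then have NC: "rational h (snd (NC k) r)" "r > fst (NC k) \<Longrightarrow> snd (NC k) r = (\<lambda>_. 0)"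
    "D21 h t k z = (\<Sum>r\<le>fst (NC k). t ^ r * snd (NC k) r z)" for k r t z
    unfolding P_def by blast+
  let ?K = "D21_support :: (int ^ 'n :: {finite, linorder}) set"
  \<comment> \<open>One finite set of powers of \<open>t\<close> must serve all shifts; there are
    finitely many of these, so a uniform degree exists.\<close>
  define N where "N = Max (insert 0 ((\<lambda>k. fst (NC k)) ` ?K))"
  have le: "fst (NC k) \<le> N" if "k \<in> ?K" for k
    unfolding N_def using that finite_D21_support by (intro Max_ge) auto
  define d where "d = CARD('n) - 1"
  \<comment> \<open>The normalising factor t^(1-n) lowers all exponents by \<open>d\<close>, so the
    coefficient of t^r comes from degree r + d.\<close>
  define C where "C r k = (if k \<in> ?K then snd (NC k) (nat (r + int d)) else (\<lambda>_. 0))" for r :: int and k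
  define L where "L = (\<lambda>r. int r - int d) ` {..N}"
  have "D21_normalised h t k z = (\<Sum>r\<in>L. t powi r * C r k z)" if t: "t \<noteq> 0" for t k z
  proof (cases "k \<in> ?K")
    case True
    have "D21 h t k z = (\<Sum>r\<le>fst (NC k). t ^ r * snd (NC k) r z)" by (rule NC(3))
    also have "\<dots> = (\<Sum>r\<le>N. t ^ r * snd (NC k) r z)"
      using le[OF True] by (intro sum.mono_neutral_left) (auto simp: NC(2))
    finally have "D21_normalised h t k z = (\<Sum>r\<le>N. (t ^ r / t ^ d) * snd (NC k) r z)"
      by (simp add: D21_normalised_def dop_scale_def d_def sum_distrib_left sum_divide_distrib)
    also have "\<dots> = (\<Sum>r\<in>L. t powi r * C r k z)"
      unfolding L_def using True t
      by (subst sum.reindex) (auto simp: inj_on_def C_def power_int_diff intro!: sum.cong)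
    finally show ?thesis .
  next
    case False
    then show ?thesis by (simp add: C_def D21_normalised_def dop_scale_def D21_outside)
  qed
  moreover have "diffop h (C r)" for r
    unfolding diffop_def
  proof (intro conjI allI)
    show "finite {k. C r k \<noteq> (\<lambda>_. 0)}"
      by (rule finite_subset[OF _ finite_D21_support]) (auto simp: C_def)
    show "rational h (C r k)" for k
      using NC(1) rational_ep[OF ep_0] by (auto simp: C_def)
  qed
  ultimately show ?thesis unfolding laurent_family_def
    by (intro exI[of _ L] exI[of _ C]) (auto simp: L_def fun_eq_iff)
qed

text \<open>After multiplication by the power \<open>b\<close> of the variable this is a polynomial
  of degree at most \<open>2 * b\<close> with \<open>2 * b + 1\<close> distinct zeros
  q^(-m).\<close>

lemma laurent_poly_zero:
  fixes d :: "int \<Rightarrow> complex"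
  assumes "\<And>m. m \<le> 2 * b \<Longrightarrow> (\<Sum>r\<in>{- int b..int b}. (1 / q ^ m) powi r * d r) = 0"
    and "r \<in> {- int b..int b}"
  shows "d r = 0"
proof -
  define c where "c i = d (int i - int b)" for i :: nat
  have img: "{- int b..int b} = (\<lambda>i. int i - int b) ` {..2 * b}"
  proof (intro equalityI subsetI)
    fix r assume "r \<in> {- int b..int b}"
    then show "r \<in> (\<lambda>i. int i - int b) ` {..2 * b}" by (intro image_eqI[of _ _ "nat (r + int b)"]) auto
  qed auto
  have root: "(\<Sum>i\<le>2 * b. c i * (1 / q ^ m) ^ i) = 0" if "m \<le> 2 * b" for m
  proof -
    define s where "s = 1 / q ^ m"
    have s: "s \<noteq> 0" by (simp add: s_def)
    have "(\<Sum>r\<in>{- int b..int b}. s powi r * d r) = (\<Sum>i\<le>2 * b. s powi (int i - int b) * c i)"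
      unfolding img by (subst sum.reindex) (auto simp: inj_on_def c_def)
    also have "\<dots> = (\<Sum>i\<le>2 * b. c i * s ^ i) / s ^ b"
      using s by (simp add: power_int_diff sum_divide_distrib mult.commute)
    finally show ?thesis using assms(1)[OF that] s by (simp add: s_def)
  qed
  have inj: "inj_on (\<lambda>m. 1 / q ^ m) {..2 * b}"
    by (auto simp: inj_on_def q_power_inject)
  have "c i = 0" if "i \<le> 2 * b" for i
  proof (rule ccontr)
    assume "c i \<noteq> 0"
    with that have fin: "finite {z. (\<Sum>i\<le>2 * b. c i * z ^ i) = 0} \<and> card {z. (\<Sum>i\<le>2 * b. c i * z ^ i) = 0} \<le> 2 * b"
      by (intro polyfun_rootbound exI[of _ i]) auto
    have "(\<lambda>m. 1 / q ^ m) ` {..2 * b} \<subseteq> {z. (\<Sum>i\<le>2 * b. c i * z ^ i) = 0}"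
      using root by auto
    then have "card ((\<lambda>m. 1 / q ^ m) ` {..2 * b}) \<le> 2 * b"
      using fin card_mono le_trans by blast
    then show False by (simp add: card_image[OF inj])
  qed
  then show ?thesis using assms(2) unfolding img by (auto simp: c_def)
qed

text \<open>The powers of \<open>t\<close> in both families lie between -b and b, so
  \<open>2 * b + 1\<close> values of \<open>m\<close> determine the difference at each
  \<open>z\<close>. That finitely many suffice is essential: only finitely many generic conditions
  are intersected.\<close>

lemma laurent_family_unique:
  fixes F G :: "complex \<Rightarrow> ('n::finite) dop"
  assumes F: "laurent_family h F" and G: "laurent_family h G"
    and eq: "\<And>m. dop_eq h (F (1 / q ^ m)) (G (1 / q ^ m))" and t: "t \<noteq> 0"
  shows "dop_eq h (F t) (G t)"
proof -
  obtain L C where L: "finite L" "\<And>t. t \<noteq> 0 \<Longrightarrow> F t = (\<lambda>k z. \<Sum>r\<in>L. t powi r * C r k z)"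
    using F unfolding laurent_family_def by blast
  obtain L' C' where L': "finite L'" "\<And>t. t \<noteq> 0 \<Longrightarrow> G t = (\<lambda>k z. \<Sum>r\<in>L'. t powi r * C' r k z)"
    using G unfolding laurent_family_def by blast
  define b where "b = Max (insert 0 ((\<lambda>r. nat \<bar>r\<bar>) ` (L \<union> L')))"
  have b: "L \<union> L' \<subseteq> {- int b..int b}"
  proof
    fix r assume "r \<in> L \<union> L'"
    then have "nat \<bar>r\<bar> \<le> b" unfolding b_def using L(1) L'(1) by (intro Max_ge) auto
    then show "r \<in> {- int b..int b}" by auto
  qed
  define d where "d k z r = (if r \<in> L then C r k z else 0) - (if r \<in> L' then C' r k z else 0)" for k z r
  have FG: "F t k z - G t k z = (\<Sum>r\<in>{- int b..int b}. t powi r * d k z r)" if "t \<noteq> 0" for t k z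
  proof -
    have "F t k z = (\<Sum>r\<in>{- int b..int b}. t powi r * (if r \<in> L then C r k z else 0))"
      unfolding L(2)[OF that] using b by (intro sum.mono_neutral_cong_left) auto
    moreover have "G t k z = (\<Sum>r\<in>{- int b..int b}. t powi r * (if r \<in> L' then C' r k z else 0))"
      unfolding L'(2)[OF that] using b by (intro sum.mono_neutral_cong_left) auto
    ultimately show ?thesis by (simp only: d_def right_diff_distrib sum_subtractf)
  qed
  show ?thesis unfolding dop_eq_def
  proof
    fix k
    have "generically h (\<lambda>z. \<forall>m\<in>{..2 * b}. F (1 / q ^ m) k z = G (1 / q ^ m) k z)"
      using eq by (intro generically_ball) (auto simp: dop_eq_def)
    then show "generically h (\<lambda>z. F t k z = G t k z)"
    proof (rule generically_mono)
      fix z assume z: "\<forall>m\<in>{..2 * b}. F (1 / q ^ m) k z = G (1 / q ^ m) k z"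
      have "(\<Sum>r\<in>{- int b..int b}. (1 / q ^ m) powi r * d k z r) = 0" if "m \<le> 2 * b" for m
      proof -
        have "(1 / q ^ m) \<noteq> 0" by simp
        from FG[OF this, of k z] z that show ?thesis by simp
      qed
      from laurent_poly_zero[OF this] have "F t k z - G t k z = 0"
        unfolding FG[OF t] by (intro sum.neutral) auto
      then show "F t k z = G t k z" by simp
    qed
  qed
qed

end

theorem proposition5p1:
  fixes h q :: complex
    and \<psi> :: "nat \<Rightarrow> complex ^ 'n :: {finite, linorder} \<Rightarrow> complex ^ 'n :: {finite, linorder} \<Rightarrow> complex"
  assumes "exp h = q"
    and "\<forall>k::nat. k \<ge> 1 \<longrightarrow> q ^ k \<noteq> 1"
    and "\<forall>m. twisted_BA h m (\<psi> m)"
  shows "(\<forall>m. twisted_hamiltonian h (\<psi> m) (orbitsum1 h) (D21_normalised h (1 / q ^ m)) \<and>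
           (\<forall>D. twisted_hamiltonian h (\<psi> m) (orbitsum1 h) D \<longrightarrow>
                dop_eq h D (D21_normalised h (1 / q ^ m)))) \<and>
         twisted_hamiltonian_family h \<psi> (orbitsum1 h) (D21_normalised h) \<and>
         (\<forall>F. twisted_hamiltonian_family h \<psi> (orbitsum1 h) F \<longrightarrow>
              (\<forall>t. t \<noteq> 0 \<longrightarrow> dop_eq h (F t) (D21_normalised h t)))"
proof -
  interpret generic_q h q
    by unfold_locales (use assms in auto)
  have BA: "twisted_BA h m (\<psi> m)" for m using assms(3) by blast
  have ham: "twisted_hamiltonian h (\<psi> m) (orbitsum1 h) (D21_normalised h (1 / q ^ m))" for m
    by (rule twisted_hamiltonian_D21_normalised[OF BA])
  have uniq: "dop_eq h D (D21_normalised h (1 / q ^ m))"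
    if "twisted_hamiltonian h (\<psi> m) (orbitsum1 h) D" for m D
    by (rule twisted_hamiltonian_unique[OF BA that ham])
  have tm: "qpow h (- of_nat m) = 1 / q ^ m" for m
    by (simp add: qpow_minus qpow_of_nat)
  have family: "twisted_hamiltonian_family h \<psi> (orbitsum1 h) (D21_normalised h)"
    unfolding twisted_hamiltonian_family_def tm using laurent_family_D21_normalised ham by blast
  have "dop_eq h (F t) (D21_normalised h t)"
    if "twisted_hamiltonian_family h \<psi> (orbitsum1 h) F" "t \<noteq> 0" for F t
  proof (rule laurent_family_unique[OF _ laurent_family_D21_normalised _ that(2)])
    show "laurent_family h F" using that(1) by (simp add: twisted_hamiltonian_family_def)
    show "dop_eq h (F (1 / q ^ m)) (D21_normalised h (1 / q ^ m))" for m
      using that(1) unfolding twisted_hamiltonian_family_def tm by (intro uniq) blast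
  qed
  with ham uniq family show ?thesis by blast
qed

end
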